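(* Let $\Omega\subset\mathbb{R}^2$ be open and let $u\in\mathrm{Lip}(\Omega)$ be a vanishing viscosity solution in $\Omega$ of $$X_{1,u}\left(\frac{X_{1,u}u}{\sqrt{1+|X_{1,u}u|^2}}\right)=0$$ (so that $x_3=u(x_1,x_2)$ is a Lipschitz continuous vanishing viscosity minimal graph). Then the flow of the vector field $X_{1,u}$ yields a foliation of $\Omega$ by polynomial curves $\gamma$ of degree at most two. Moreover, for every fixed $x_0\in\Omega$, denoting by $\gamma$ the unique leaf passing through $x_0$, the function $u$ is differentiable at $x_0$ in the Lie sense along $\gamma$, and the equation above reduces to $$\frac{d^2}{dt^2}\bigl(u(\gamma(t))\bigr)=0 .$$
   Context: Coordinates on $\mathbb{R}^2$ are $x=(x_1,x_2)$, $\partial_i=\partial/\partial x_i$, and $X_{1,u}=\partial_1+u\,\partial_2$. Vanishing viscosity solution: $u\in \mathrm{Lip}(\Omega)$ is a vanishing viscosity solution of the equation above if there exist positive numbers $\epsilon_j\to0$ and functions $u_j\in C^\infty(\Omega)$ such that (i) for all $j$, with $X_{1,u_j}=\partial_1+u_j\partial_2$, $X_{2,u_j}=\epsilon_j\partial_2$ and $\nabla_{\epsilon_j}u_j=(X_{1,u_j}u_j,X_{2,u_j}u_j)$, $$\sum_{i=1}^2X_{i,u_j}\left(\frac{X_{i,u_j}u_j}{\sqrt{1+|\nabla_{\epsilon_j}u_j|^2}}\right)=0\quad\text{in }\Omega;$$ (ii) $(u_j)$ is bounded in $\mathrm{Lip}(\Omega)$ and converges to $u$ uniformly on compact subsets of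 $\Omega$. Leaves are the integral curves $\gamma'=X_{1,u}(\gamma)$; they have the form $t\mapsto(t,y(t))$ up to translation of the parameter, and "polynomial curve of degree at most two" means that $y$ is a polynomial of degree at most two. Lie differentiability: if $X$ is a Lipschitz vector field on $\Omega$, $\xi_0\in\Omega$, and $\gamma$ solves $\gamma'=X(\gamma)$, $\gamma(0)=\xi_0$, then $f\in C^\alpha_{\mathrm{loc}}(\Omega)$, $\alpha\in(0,1)$, has Lie derivative at $\xi_0$ in the direction $X$ if $\frac{d}{dh}(f\circ\gamma)|_{h=0}$ exists; here this is applied with $X=X_{1,u}$. *)

theory Defs
  imports "HOL-Analysis.Analysis" "HOL-Computational_Algebra.Polynomial"
begin

text \<open>The plane is \<open>real \<times> real\<close>, whose norm in the library is the Euclidean one.\<close>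

type_synonym plane = "real \<times> real"

definition pd1 :: "(plane \<Rightarrow> real) \<Rightarrow> plane \<Rightarrow> real" where
  "pd1 f x = deriv (\<lambda>t. f (t, snd x)) (fst x)"

definition pd2 :: "(plane \<Rightarrow> real) \<Rightarrow> plane \<Rightarrow> real" where
  "pd2 f x = deriv (\<lambda>t. f (fst x, t)) (snd x)"

text \<open>\<open>Ck_on k \<Omega> f\<close>: \<open>f\<close> is of class \<open>C^k\<close> on the open set \<open>\<Omega>\<close>.\<close>

fun Ck_on :: "nat \<Rightarrow> plane set \<Rightarrow> (plane \<Rightarrow> real) \<Rightarrow> bool" where
  "Ck_on 0 \<Omega> f \<longleftrightarrow> continuous_on \<Omega> f"
| "Ck_on (Suc k) \<Omega> f \<longleftrightarrow>
     (\<forall>x\<in>\<Omega>. f differentiable (at x)) \<and> Ck_on k \<Omega> (pd1 f) \<and> Ck_on k \<Omega> (pd2 f)"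

definition smooth_on_plane :: "plane set \<Rightarrow> (plane \<Rightarrow> real) \<Rightarrow> bool" where
  "smooth_on_plane \<Omega> f \<longleftrightarrow> (\<forall>k. Ck_on k \<Omega> f)"

text \<open>The first-order operators \<open>X_{1,u} = \<partial>_1 + u \<partial>_2\<close> and \<open>X_2 = \<epsilon> \<partial>_2\<close>.\<close>

definition X1 :: "(plane \<Rightarrow> real) \<Rightarrow> (plane \<Rightarrow> real) \<Rightarrow> plane \<Rightarrow> real" where
  "X1 u f x = pd1 f x + u x * pd2 f x"

definition X2 :: "real \<Rightarrow> (plane \<Rightarrow> real) \<Rightarrow> plane \<Rightarrow> real" where
  "X2 \<epsilon> f x = \<epsilon> * pd2 f x"

definition grad_eps :: "real \<Rightarrow> (plane \<Rightarrow> real) \<Rightarrow> plane \<Rightarrow> plane" where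
  "grad_eps \<epsilon> u x = (X1 u u x, X2 \<epsilon> u x)"

definition regularized_minimal_graph :: "plane set \<Rightarrow> real \<Rightarrow> (plane \<Rightarrow> real) \<Rightarrow> bool" where
  "regularized_minimal_graph \<Omega> \<epsilon> u \<longleftrightarrow>
     (\<forall>x\<in>\<Omega>.
        X1 u (\<lambda>y. X1 u u y / sqrt (1 + (norm (grad_eps \<epsilon> u y))\<^sup>2)) x
      + X2 \<epsilon> (\<lambda>y. X2 \<epsilon> u y / sqrt (1 + (norm (grad_eps \<epsilon> u y))\<^sup>2)) x = 0)"

text \<open>
  Boundedness of \<open>(u_j)\<close> in \<open>Lip(\<Omega>)\<close> is a common Lipschitz constant on \<open>\<Omega>\<close>. No separate
  bound on the values is imposed: by the convergence it is automatic at every point (and on all of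
  \<open>\<Omega>\<close> if \<open>\<Omega>\<close> is bounded and \<open>\<Omega> \<noteq> {}\<close>), and a uniform bound on an unbounded \<open>\<Omega>\<close> would exclude
  affine graphs over the whole plane.
\<close>

definition vanishing_viscosity_solution :: "plane set \<Rightarrow> (plane \<Rightarrow> real) \<Rightarrow> bool" where
  "vanishing_viscosity_solution \<Omega> u \<longleftrightarrow>
     (\<exists>C. C-lipschitz_on \<Omega> u) \<and>
     (\<exists>(\<epsilon> :: nat \<Rightarrow> real) (v :: nat \<Rightarrow> plane \<Rightarrow> real).
        (\<forall>j. \<epsilon> j > 0) \<and> \<epsilon> \<longlonglongrightarrow> 0 \<and>
        (\<forall>j. smooth_on_plane \<Omega> (v j)) \<and>
        (\<forall>j. regularized_minimal_graph \<Omega> (\<epsilon> j) (v j)) \<and>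
        (\<exists>C. \<forall>j. C-lipschitz_on \<Omega> (v j)) \<and>
        (\<forall>K. compact K \<and> K \<subseteq> \<Omega> \<longrightarrow> uniform_limit K v u sequentially))"

text \<open>\<open>X_{1,u}\<close> as a vector field rather than as an operator.\<close>

definition X1_field :: "(plane \<Rightarrow> real) \<Rightarrow> plane \<Rightarrow> plane" where
  "X1_field u x = (1, u x)"

definition integral_curve ::
  "(plane \<Rightarrow> plane) \<Rightarrow> plane set \<Rightarrow> (real \<Rightarrow> plane) \<Rightarrow> real set \<Rightarrow> bool" where
  "integral_curve X \<Omega> \<gamma> I \<longleftrightarrow>
     I \<noteq> {} \<and> open I \<and> is_interval I \<and> \<gamma> ` I \<subseteq> \<Omega> \<and>
     (\<forall>t\<in>I. (\<gamma> has_vector_derivative X (\<gamma> t)) (at t))"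

definition maximal_integral_curve ::
  "(plane \<Rightarrow> plane) \<Rightarrow> plane set \<Rightarrow> (real \<Rightarrow> plane) \<Rightarrow> real set \<Rightarrow> bool" where
  "maximal_integral_curve X \<Omega> \<gamma> I \<longleftrightarrow>
     integral_curve X \<Omega> \<gamma> I \<and>
     (\<forall>\<sigma> J. integral_curve X \<Omega> \<sigma> J \<and> I \<subseteq> J \<and> (\<forall>t\<in>I. \<sigma> t = \<gamma> t) \<longrightarrow> J = I)"

definition leaves :: "(plane \<Rightarrow> plane) \<Rightarrow> plane set \<Rightarrow> plane set set" where
  "leaves X \<Omega> = {\<gamma> ` I | \<gamma> I. maximal_integral_curve X \<Omega> \<gamma> I}"

text \<open>
  A topological foliation by curves: a partition into connected sets, such that every point has a
  chart in which the components of the trace of each leaf are exactly the horizontal slices that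
  they meet.
\<close>

definition foliation :: "plane set \<Rightarrow> plane set set \<Rightarrow> bool" where
  "foliation \<Omega> F \<longleftrightarrow>
     partition_on \<Omega> F \<and> (\<forall>L\<in>F. connected L) \<and>
     (\<forall>x\<in>\<Omega>. \<exists>U \<phi> \<psi>. open U \<and> x \<in> U \<and> U \<subseteq> \<Omega> \<and>
        homeomorphism U ({-1<..<1::real} \<times> {-1<..<1::real}) \<phi> \<psi> \<and>
        (\<forall>L\<in>F. \<forall>C\<in>components (L \<inter> U). \<exists>c\<in>{-1<..<1}. \<phi> ` C = {-1<..<1} \<times> {c}))"

text \<open>\<open>s\<close> is the translation of the parameter that makes the first coordinate the parameter.\<close>

definition polynomial_curve_deg_le :: "nat \<Rightarrow> (real \<Rightarrow> plane) \<Rightarrow> real set \<Rightarrow> bool" where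
  "polynomial_curve_deg_le n \<gamma> I \<longleftrightarrow>
     (\<exists>(p :: real poly) s. degree p \<le> n \<and> (\<forall>t\<in>I. \<gamma> t = (t + s, poly p (t + s))))"

text \<open>
  For a Lipschitz field \<open>X\<close> the germ at \<open>0\<close> of an integral curve \<open>\<gamma>\<close> with \<open>\<gamma> 0 = x\<close> is unique,
  so the existential quantifier involves no choice and \<open>lie_deriv\<close> is well defined.
\<close>

definition has_lie_derivative ::
  "(plane \<Rightarrow> plane) \<Rightarrow> plane set \<Rightarrow> (plane \<Rightarrow> real) \<Rightarrow> plane \<Rightarrow> real \<Rightarrow> bool" where
  "has_lie_derivative X \<Omega> f x D \<longleftrightarrow>
     (\<exists>\<gamma> I. integral_curve X \<Omega> \<gamma> I \<and> 0 \<in> I \<and> \<gamma> 0 = x \<and>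
            ((\<lambda>h. f (\<gamma> h)) has_real_derivative D) (at 0))"

definition lie_deriv ::
  "(plane \<Rightarrow> plane) \<Rightarrow> plane set \<Rightarrow> (plane \<Rightarrow> real) \<Rightarrow> plane \<Rightarrow> real" where
  "lie_deriv X \<Omega> f x = (THE D. has_lie_derivative X \<Omega> f x D)"

end

theory Submission
  imports Defs
begin

text \<open>
  Write \<open>p = X\<^sub>1 v v\<close> for the slope of a smooth approximating graph \<open>v\<close>. Its equation reads
  \<open>X\<^sub>1 A + \<epsilon> \<partial>\<^sub>2 B = 0\<close> with \<open>A = flux1 \<epsilon> v\<close> and \<open>B = flux2 \<epsilon> v\<close>, where \<open>\<epsilon> B = O(\<epsilon>\<^sup>2)\<close> and \<open>A\<close> differs by \<open>O(\<epsilon>)\<close> from the increasing function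
  \<open>a(p) = p / sqrt (1 + p\<^sup>2)\<close> of the slope. Since the approximations \<open>v\<^sub>j\<close> are only uniformly Lipschitz, their slopes
  a priori converge only weakly, and the point is to pass to the limit in the nonlinear flux \<open>a(p\<^sub>j)\<close>.

  Strong convergence comes from monotonicity (Minty's argument). Multiply the equation of \<open>v\<^sub>j\<close> by \<open>v\<^sub>j - v\<^sub>k\<close>
  and integrate over a rectangle: every boundary term and every zero order term carries the small
  factor \<open>v\<^sub>j - v\<^sub>k\<close> or \<open>\<epsilon>\<^sub>j\<^sup>2\<close>, so \<open>\<integral> A\<^sub>j (p\<^sub>j - p\<^sub>k)\<close> is small (\<open>flux_pairing_bound\<close>). Adding the same
  estimate with \<open>j\<close> and \<open>k\<close> exchanged gives \<open>\<integral> (a(p\<^sub>j) - a(p\<^sub>k)) (p\<^sub>j - p\<^sub>k) \<rightarrow> 0\<close>, hence the slopes are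
  Cauchy in \<open>L\<^sup>1\<close> (\<open>slopes_L1_Cauchy\<close>).

  Next take a thin strip between two integral curves \<open>f < g\<close> of the limit field and let \<open>m(t)\<close> be the average
  of \<open>A\<^sub>j\<close> over the vertical segment from \<open>f(t)\<close> to \<open>g(t)\<close>. As \<open>f\<close> and \<open>g\<close> are almost characteristic for
  \<open>v\<^sub>j\<close>, no flux crosses them up to \<open>O(sup \<bar>v\<^sub>j - u\<bar>)\<close>, and the equation becomes
  \<open>(g - f) m' \<approx> \<integral> (A\<^sub>j - const) (\<partial>\<^sub>2 v\<^sub>j - (g - f)' / (g - f))\<close>, because the second factor has
  almost zero mean. So \<open>m\<close> is constant up to the mean oscillation of \<open>A\<^sub>j\<close> on vertical segments, and \<open>u\<close> is
  affine along \<open>f\<close> up to an error of the same kind (\<open>leaf_almost_affine\<close>). Summing over the strips that partition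
  a flow box, these errors add up to the \<open>L\<^sup>1\<close> distance of \<open>p\<^sub>j\<close> from one fixed continuous slope \<open>p\<^sub>k\<close>
  plus the oscillation of \<open>p\<^sub>k\<close> across a strip; choosing \<open>k\<close>, the number of strips and \<open>j\<close> in this order makes the total
  arbitrarily small. The deviation from being affine depends continuously on the leaf, so it vanishes on every
  leaf (\<open>flow_line_collinear\<close>).

  What remains is the theory of the field \<open>(1, u)\<close> with \<open>u\<close> Lipschitz. Gronwall's inequality gives uniqueness and a
  flow box whose flow is bi-Lipschitz in the initial height; all integral curves are graphs over the first coordinate,
  so a leaf meets a flow box in at most one plaque and flow boxes are charts of the foliation. Integrating
  the affine function \<open>u \<circ> \<gamma>\<close> shows that the leaves are parabolas or lines.
\<close>

section \<open>Continuously differentiable functions and the fluxes of the equation\<close>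

declare Ck_on.simps [simp del]

lemma Ck_on_1_iff:
  "Ck_on 1 S f \<longleftrightarrow> (\<forall>x\<in>S. f differentiable (at x)) \<and> continuous_on S (pd1 f) \<and> continuous_on S (pd2 f)"
  unfolding One_nat_def Ck_on.simps ..

lemma Ck_on_imp_continuous_on:
  assumes "Ck_on (Suc k) S f" shows "continuous_on S f"
proof (rule continuous_at_imp_continuous_on, rule ballI)
  fix x assume "x \<in> S"
  with assms have "f differentiable (at x)" unfolding Ck_on.simps by blast
  then show "isCont f x" by (rule differentiable_imp_continuous_within)
qed

lemma Ck_on_1_continuous_partials:
  "Ck_on 1 S f \<Longrightarrow> continuous_on S (pd1 f)" "Ck_on 1 S f \<Longrightarrow> continuous_on S (pd2 f)"
  unfolding Ck_on_1_iff by blast+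

lemma has_derivative_compose_Pair:
  assumes a: "(a has_derivative a') (at t within T)" and b: "(b has_derivative b') (at t within T)"
    and f: "(f has_derivative D) (at (a t, b t))"
  shows "((\<lambda>t. f (a t, b t)) has_derivative (\<lambda>h. D (a' h, b' h))) (at t within T)"
  using has_derivative_compose[of "\<lambda>t. (a t, b t)" "\<lambda>h. (a' h, b' h)" t T f D]
    has_derivative_Pair[OF a b] f by blast

lemma Ck_on_1_continuous: "Ck_on 1 S f \<Longrightarrow> continuous_on S f"
  unfolding One_nat_def by (rule Ck_on_imp_continuous_on)

lemma partials_of_has_derivative:
  assumes "(f has_derivative D) (at x)"
  shows "((\<lambda>t. f (t, snd x)) has_real_derivative D (1, 0)) (at (fst x))"
    and "((\<lambda>t. f (fst x, t)) has_real_derivative D (0, 1)) (at (snd x))"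
    and "pd1 f x = D (1, 0)" and "pd2 f x = D (0, 1)"
    and "D = (\<lambda>h. pd1 f x * fst h + pd2 f x * snd h)"
proof -
  have lin: "linear D"
    using assms has_derivative_linear by blast
  have scale: "D (h, 0) = D (1, 0) * h" "D (0, h) = D (0, 1) * h" for h
    using linear_scale[OF lin, of h "(1, 0)"] linear_scale[OF lin, of h "(0, 1)"] by simp_all
  then have scale_fun: "(\<lambda>h. D (h, 0)) = (*) (D (1, 0))" "(\<lambda>h. D (0, h)) = (*) (D (0, 1))"
    by blast+
  have f: "(f has_derivative D) (at (fst x, snd x))"
    using assms by simp
  have "((\<lambda>t. f (t, snd x)) has_derivative (\<lambda>h. D (h, 0))) (at (fst x))"
    by (rule has_derivative_compose_Pair[OF has_derivative_ident has_derivative_const f])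
  then show 1: "((\<lambda>t. f (t, snd x)) has_real_derivative D (1, 0)) (at (fst x))"
    by (simp only: has_field_derivative_def scale_fun)
  have "((\<lambda>t. f (fst x, t)) has_derivative (\<lambda>h. D (0, h))) (at (snd x))"
    by (rule has_derivative_compose_Pair[OF has_derivative_const has_derivative_ident f])
  then show 2: "((\<lambda>t. f (fst x, t)) has_real_derivative D (0, 1)) (at (snd x))"
    by (simp only: has_field_derivative_def scale_fun)
  show p1: "pd1 f x = D (1, 0)" and p2: "pd2 f x = D (0, 1)"
    using 1 2 by (simp_all add: pd1_def pd2_def DERIV_imp_deriv)
  show "D = (\<lambda>h. pd1 f x * fst h + pd2 f x * snd h)"
  proof
    fix h :: plane
    have "D h = D ((fst h, 0) + (0, snd h))" by simp
    also have "\<dots> = D (fst h, 0) + D (0, snd h)"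
      using lin linear_add by blast
    finally show "D h = pd1 f x * fst h + pd2 f x * snd h"
      by (simp add: p1 p2 scale[of "fst h"] scale[of "snd h"])
  qed
qed

lemma Ck_on_has_derivative:
  assumes "Ck_on (Suc k) S f" "x \<in> S"
  shows "(f has_derivative (\<lambda>h. pd1 f x * fst h + pd2 f x * snd h)) (at x)"
proof -
  from assms obtain D where D: "(f has_derivative D) (at x)"
    unfolding Ck_on.simps differentiable_def by blast
  with partials_of_has_derivative(5)[OF D] show ?thesis by simp
qed

lemma Ck_on_chain:
  assumes "Ck_on (Suc k) S f" "(a t, b t) \<in> S"
    and "(a has_real_derivative a') (at t within T)" "(b has_real_derivative b') (at t within T)"
  shows "((\<lambda>t. f (a t, b t)) has_real_derivative pd1 f (a t, b t) * a' + pd2 f (a t, b t) * b') (at t within T)"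
proof -
  have "((\<lambda>t. f (a t, b t)) has_derivative (\<lambda>h. pd1 f (a t, b t) * fst (a' * h, b' * h) +
      pd2 f (a t, b t) * snd (a' * h, b' * h))) (at t within T)"
    using assms(3,4) unfolding has_field_derivative_def
    by (rule has_derivative_compose_Pair) (rule Ck_on_has_derivative[OF assms(1,2)])
  then show ?thesis
    unfolding has_field_derivative_def by (rule has_derivative_eq_rhs) (simp add: fun_eq_iff algebra_simps)
qed

text \<open>
  \<open>Ck_on\<close> refers to the partial derivatives selected by \<open>deriv\<close>. This rule lets one exhibit the derivative
  instead, which makes closure under products and compositions routine.
\<close>

lemma Ck_on_1_intro:
  assumes "\<And>x. x \<in> S \<Longrightarrow> (f has_derivative (\<lambda>h. f1 x * fst h + f2 x * snd h)) (at x)"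
    and "continuous_on S f1" "continuous_on S f2"
  shows "Ck_on 1 S f"
proof -
  have "pd1 f x = f1 x" "pd2 f x = f2 x" if "x \<in> S" for x
    using partials_of_has_derivative(3,4)[OF assms(1)[OF that]] by simp_all
  then have "continuous_on S (pd1 f)" "continuous_on S (pd2 f)"
    using assms(2,3) continuous_on_cong[OF refl, of S "pd1 f" f1] continuous_on_cong[OF refl, of S "pd2 f" f2]
    by simp_all
  moreover have "\<forall>x\<in>S. f differentiable (at x)"
    using assms(1) unfolding differentiable_def by fast
  ultimately show ?thesis
    unfolding Ck_on_1_iff by blast
qed

lemma Ck_on_1_mult:
  assumes "Ck_on 1 S f" "Ck_on 1 S g" shows "Ck_on 1 S (\<lambda>x. f x * g x)"
proof (rule Ck_on_1_intro)
  show "((\<lambda>x. f x * g x) has_derivative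
        (\<lambda>h. (f x * pd1 g x + pd1 f x * g x) * fst h + (f x * pd2 g x + pd2 f x * g x) * snd h)) (at x)"
    if "x \<in> S" for x
    using has_derivative_mult[OF assms[unfolded One_nat_def, THEN Ck_on_has_derivative, OF that]]
    by (simp add: algebra_simps)
  have "continuous_on S f" "continuous_on S g"
    using assms by (simp_all only: Ck_on_1_continuous)
  with assms show "continuous_on S (\<lambda>x. f x * pd1 g x + pd1 f x * g x)"
      "continuous_on S (\<lambda>x. f x * pd2 g x + pd2 f x * g x)"
    unfolding Ck_on_1_iff by (intro continuous_on_mult continuous_on_add; blast)+
qed

lemma Ck_on_1_add:
  assumes "Ck_on 1 S f" "Ck_on 1 S g" shows "Ck_on 1 S (\<lambda>x. f x + g x)"
proof (rule Ck_on_1_intro)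
  show "((\<lambda>x. f x + g x) has_derivative
        (\<lambda>h. (pd1 f x + pd1 g x) * fst h + (pd2 f x + pd2 g x) * snd h)) (at x)"
    if "x \<in> S" for x
    using has_derivative_add[OF assms[unfolded One_nat_def, THEN Ck_on_has_derivative, OF that]]
    by (simp add: algebra_simps)
  show "continuous_on S (\<lambda>x. pd1 f x + pd1 g x)" "continuous_on S (\<lambda>x. pd2 f x + pd2 g x)"
    using assms unfolding Ck_on_1_iff by (intro continuous_on_add; blast)+
qed

lemma Ck_on_1_const: "Ck_on 1 S (\<lambda>x. c)"
  by (rule Ck_on_1_intro[where ?f1.0 = "\<lambda>_. 0" and ?f2.0 = "\<lambda>_. 0"]) auto

lemma Ck_on_1_compose:
  assumes "Ck_on 1 S f" "\<And>y. y \<in> f ` S \<Longrightarrow> (g has_real_derivative g' y) (at y)" "continuous_on (f ` S) g'"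
  shows "Ck_on 1 S (\<lambda>x. g (f x))"
proof (rule Ck_on_1_intro)
  show "((\<lambda>x. g (f x)) has_derivative
        (\<lambda>h. (g' (f x) * pd1 f x) * fst h + (g' (f x) * pd2 f x) * snd h)) (at x)"
    if "x \<in> S" for x
  proof -
    have "(g has_derivative (*) (g' (f x))) (at (f x))"
      using assms(2) that by (auto simp: has_field_derivative_def)
    from has_derivative_compose[of f _ x UNIV g, OF
        Ck_on_has_derivative[OF assms(1)[unfolded One_nat_def] that] this]
    show ?thesis by (simp add: algebra_simps)
  qed
  have "continuous_on S (\<lambda>x. g' (f x))"
    by (rule continuous_on_compose2[OF assms(3) Ck_on_imp_continuous_on[OF assms(1)[unfolded One_nat_def]]]) simp
  with assms(1) show "continuous_on S (\<lambda>x. g' (f x) * pd1 f x)" "continuous_on S (\<lambda>x. g' (f x) * pd2 f x)"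
    unfolding Ck_on_1_iff by (intro continuous_on_mult; blast)+
qed

lemma smooth_on_plane_Ck_1:
  assumes "smooth_on_plane S v"
  shows "Ck_on 1 S v" "Ck_on 1 S (pd1 v)" "Ck_on 1 S (pd2 v)"
proof -
  have "Ck_on 1 S v" "Ck_on 2 S v"
    using assms by (auto simp only: smooth_on_plane_def)
  then show "Ck_on 1 S v" "Ck_on 1 S (pd1 v)" "Ck_on 1 S (pd2 v)"
    unfolding numeral_2_eq_2 One_nat_def Ck_on.simps by blast+
qed

text \<open>
  The two quantities whose \<open>X\<^sub>1\<close>- and \<open>X\<^sub>2\<close>-derivatives appear in the regularized equation.
\<close>

definition flux1 :: "real \<Rightarrow> (plane \<Rightarrow> real) \<Rightarrow> plane \<Rightarrow> real" where
  "flux1 \<epsilon> v y = X1 v v y / sqrt (1 + (norm (grad_eps \<epsilon> v y))\<^sup>2)"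

definition flux2 :: "real \<Rightarrow> (plane \<Rightarrow> real) \<Rightarrow> plane \<Rightarrow> real" where
  "flux2 \<epsilon> v y = X2 \<epsilon> v y / sqrt (1 + (norm (grad_eps \<epsilon> v y))\<^sup>2)"

text \<open>
  The limit of \<open>flux1\<close> as a function of the slope when \<open>\<epsilon> \<rightarrow> 0\<close>.
\<close>

definition limit_flux :: "real \<Rightarrow> real" where
  "limit_flux p = p / sqrt (1 + p\<^sup>2)"

lemma norm_grad_eps: "(norm (grad_eps \<epsilon> v y))\<^sup>2 = (X1 v v y)\<^sup>2 + (\<epsilon> * pd2 v y)\<^sup>2"
  by (simp add: grad_eps_def X2_def norm_Pair)

lemma minimal_graph_flux_equation:
  assumes "regularized_minimal_graph \<Omega> \<epsilon> v" "x \<in> \<Omega>"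
  shows "pd1 (flux1 \<epsilon> v) x + v x * pd2 (flux1 \<epsilon> v) x + \<epsilon> * pd2 (flux2 \<epsilon> v) x = 0"
proof -
  have "X1 v (flux1 \<epsilon> v) x + X2 \<epsilon> (flux2 \<epsilon> v) x = 0"
    using assms unfolding regularized_minimal_graph_def flux1_def[abs_def] flux2_def[abs_def] by blast
  then show ?thesis by (simp add: X1_def X2_def)
qed

lemma C1_slope:
  assumes "smooth_on_plane S v" shows "Ck_on 1 S (X1 v v)"
  unfolding X1_def[abs_def]
  by (intro Ck_on_1_add Ck_on_1_mult smooth_on_plane_Ck_1 assms)

lemma C1_flux:
  assumes "smooth_on_plane S v"
  shows "Ck_on 1 S (flux1 \<epsilon> v)" "Ck_on 1 S (flux2 \<epsilon> v)"
proof -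
  let ?g = "\<lambda>r::real. inverse (sqrt (1 + r))"
  let ?W = "\<lambda>y. X1 v v y * X1 v v y + (\<epsilon> * pd2 v y) * (\<epsilon> * pd2 v y)"
  have q: "Ck_on 1 S (\<lambda>y. \<epsilon> * pd2 v y)"
    by (intro Ck_on_1_mult Ck_on_1_const smooth_on_plane_Ck_1 assms)
  have W: "Ck_on 1 S ?W"
    by (intro Ck_on_1_add Ck_on_1_mult q C1_slope assms)
  have pos: "1 + y > 0" if "y \<in> ?W ` S" for y
    using that by (auto simp: add_pos_nonneg)
  have "Ck_on 1 S (\<lambda>x. ?g (?W x))"
  proof (rule Ck_on_1_compose[OF W])
    let ?g' = "\<lambda>y. - (inverse (sqrt (1 + y)) * (inverse (sqrt (1 + y)) / 2) * inverse (sqrt (1 + y)))"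
    show "(?g has_real_derivative ?g' y) (at y)" if "y \<in> ?W ` S" for y
      using pos[OF that] by (auto intro!: derivative_eq_intros)
    show "continuous_on (?W ` S) ?g'"
      using pos by (intro continuous_intros) force+
  qed
  then have "Ck_on 1 S (\<lambda>x. X1 v v x * ?g (?W x))" "Ck_on 1 S (\<lambda>x. (\<epsilon> * pd2 v x) * ?g (?W x))"
    by (intro Ck_on_1_mult q C1_slope assms; assumption)+
  moreover have "flux1 \<epsilon> v = (\<lambda>x. X1 v v x * ?g (?W x))" "flux2 \<epsilon> v = (\<lambda>x. (\<epsilon> * pd2 v x) * ?g (?W x))"
    unfolding fun_eq_iff flux1_def flux2_def norm_grad_eps X2_def
    by (simp_all add: power2_eq_square divide_inverse algebra_simps)
  ultimately show "Ck_on 1 S (flux1 \<epsilon> v)" "Ck_on 1 S (flux2 \<epsilon> v)"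
    by simp_all
qed

lemma limit_flux_deriv:
  "(limit_flux has_real_derivative 1 / (sqrt (1 + p\<^sup>2)) ^ 3) (at p within T)"
proof -
  have pos: "1 + p\<^sup>2 > 0" by (simp add: add_pos_nonneg)
  then have s: "sqrt (1 + p\<^sup>2) > 0" "sqrt (1 + p\<^sup>2) * sqrt (1 + p\<^sup>2) = 1 + p\<^sup>2" by auto
  have "((\<lambda>p. p / sqrt (1 + p\<^sup>2)) has_real_derivative
        (1 * sqrt (1 + p\<^sup>2) - p * (inverse (sqrt (1 + p\<^sup>2)) / 2 * (2 * p))) / (sqrt (1 + p\<^sup>2) * sqrt (1 + p\<^sup>2)))
        (at p within T)"
    by (rule derivative_eq_intros refl | use pos in simp)+
  also have "(1 * sqrt (1 + p\<^sup>2) - p * (inverse (sqrt (1 + p\<^sup>2)) / 2 * (2 * p))) / (sqrt (1 + p\<^sup>2) * sqrt (1 + p\<^sup>2))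
        = 1 / (sqrt (1 + p\<^sup>2)) ^ 3"
  proof -
    have "(w - p * (inverse w / 2 * (2 * p))) / (w * w) = 1 / w ^ 3" if "w > 0" "w * w = 1 + p\<^sup>2" for w
    proof -
      have "w * (w - p * (inverse w / 2 * (2 * p))) = w * w - p\<^sup>2"
        using that(1) by (simp add: field_simps power2_eq_square)
      then have "w - p * (inverse w / 2 * (2 * p)) = 1 / w"
        using that by (simp add: eq_divide_eq mult.commute)
      then show ?thesis by (simp add: power3_eq_cube)
    qed
    from this[OF s] show ?thesis by simp
  qed
  finally show ?thesis
    by (simp add: limit_flux_def[abs_def])
qed

text \<open>
  The derivative \<open>(1 + z\<^sup>2)\<close> to the power \<open>- 3 / 2\<close> is bounded below for \<open>\<bar>z\<bar> \<le> P\<close>. This strict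
  monotonicity turns control of the fluxes into control of the slopes, both pointwise and in Minty's argument.
\<close>

lemma limit_flux_expansive:
  assumes "\<bar>p\<bar> \<le> P" "\<bar>q\<bar> \<le> P"
  shows "\<bar>p - q\<bar> \<le> sqrt (1 + P\<^sup>2) ^ 3 * \<bar>limit_flux p - limit_flux q\<bar>"
    and "(p - q)\<^sup>2 \<le> sqrt (1 + P\<^sup>2) ^ 3 * ((limit_flux p - limit_flux q) * (p - q))"
proof -
  have ineq: "p - q \<le> sqrt (1 + P\<^sup>2) ^ 3 * (limit_flux p - limit_flux q)"
    if bounds: "\<bar>p\<bar> \<le> P" "\<bar>q\<bar> \<le> P" and less: "q < p" for p q
  proof -
    obtain z where z: "q < z" "z < p"
      and eq: "limit_flux p - limit_flux q = (p - q) * (1 / sqrt (1 + z\<^sup>2) ^ 3)"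
      using MVT2[OF less, of limit_flux "\<lambda>z. 1 / sqrt (1 + z\<^sup>2) ^ 3"] limit_flux_deriv by blast
    have "z\<^sup>2 \<le> P\<^sup>2"
      using z bounds by (intro abs_le_square_iff[THEN iffD1]) linarith
    then have le: "sqrt (1 + z\<^sup>2) ^ 3 \<le> sqrt (1 + P\<^sup>2) ^ 3"
      by (intro power_mono) auto
    have pos: "sqrt (1 + z\<^sup>2) ^ 3 > 0"
      by (simp add: add_pos_nonneg)
    have "p - q = sqrt (1 + z\<^sup>2) ^ 3 * (limit_flux p - limit_flux q)"
      using pos by (simp add: eq)
    also have "\<dots> \<le> sqrt (1 + P\<^sup>2) ^ 3 * (limit_flux p - limit_flux q)"
      using le pos less by (intro mult_right_mono) (simp_all add: eq)
    finally show ?thesis .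
  qed
  have pos: "sqrt (1 + P\<^sup>2) ^ 3 > 0"
    by (simp add: add_pos_nonneg)
  consider "q < p" | "p < q" | "p = q" by linarith
  then have *: "\<bar>p - q\<bar> \<le> sqrt (1 + P\<^sup>2) ^ 3 * \<bar>limit_flux p - limit_flux q\<bar> \<and>
    (p - q)\<^sup>2 \<le> sqrt (1 + P\<^sup>2) ^ 3 * ((limit_flux p - limit_flux q) * (p - q))"
  proof cases
    case 1
    note i = ineq[OF assms 1]
    then have "0 < sqrt (1 + P\<^sup>2) ^ 3 * (limit_flux p - limit_flux q)" using 1 by linarith
    then have "0 < limit_flux p - limit_flux q" using pos zero_less_mult_pos by blast
    moreover have "(p - q) * (p - q) \<le> sqrt (1 + P\<^sup>2) ^ 3 * (limit_flux p - limit_flux q) * (p - q)"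
      using i 1 by (intro mult_right_mono) auto
    ultimately show ?thesis using 1 i by (simp add: power2_eq_square mult.assoc)
  next
    case 2
    note i = ineq[OF assms(2,1) 2]
    then have "0 < sqrt (1 + P\<^sup>2) ^ 3 * (limit_flux q - limit_flux p)" using 2 by linarith
    then have "0 < limit_flux q - limit_flux p" using pos zero_less_mult_pos by blast
    moreover have "(q - p) * (q - p) \<le> sqrt (1 + P\<^sup>2) ^ 3 * (limit_flux q - limit_flux p) * (q - p)"
      using i 2 by (intro mult_right_mono) auto
    moreover have "(q - p) * (q - p) = (p - q)\<^sup>2"
      "sqrt (1 + P\<^sup>2) ^ 3 * (limit_flux q - limit_flux p) * (q - p)
        = sqrt (1 + P\<^sup>2) ^ 3 * ((limit_flux p - limit_flux q) * (p - q))"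
      by algebra+
    ultimately show ?thesis using 2 i by simp
  next
    case 3
    then show ?thesis by simp
  qed
  then show "\<bar>p - q\<bar> \<le> sqrt (1 + P\<^sup>2) ^ 3 * \<bar>limit_flux p - limit_flux q\<bar>"
    "(p - q)\<^sup>2 \<le> sqrt (1 + P\<^sup>2) ^ 3 * ((limit_flux p - limit_flux q) * (p - q))"
    by blast+
qed

lemma limit_flux_nonexpansive: "\<bar>limit_flux p - limit_flux q\<bar> \<le> \<bar>p - q\<bar>"
proof -
  have "\<bar>limit_flux p - limit_flux q\<bar> \<le> 1 * \<bar>p - q\<bar>"
    unfolding real_norm_def[symmetric]
  proof (rule field_differentiable_bound[of UNIV])
    show "(limit_flux has_field_derivative 1 / (sqrt (1 + z\<^sup>2)) ^ 3) (at z within UNIV)" for z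
      by (rule limit_flux_deriv)
    have "1 \<le> sqrt (1 + z\<^sup>2) ^ 3" for z :: real
      by (intro one_le_power) simp
    then show "norm (1 / (sqrt (1 + z\<^sup>2)) ^ 3) \<le> 1" for z :: real
      using le_imp_inverse_le[of 1 "sqrt (1 + z\<^sup>2) ^ 3"] by (simp add: inverse_eq_divide)
  qed auto
  then show ?thesis by simp
qed

lemma abs_limit_flux_le_1: "\<bar>limit_flux p\<bar> \<le> 1"
proof -
  have "\<bar>p\<bar> = sqrt (p\<^sup>2)" by simp
  also have "\<dots> \<le> sqrt (1 + p\<^sup>2)" by (intro real_sqrt_le_mono) simp
  finally show ?thesis
    by (simp add: limit_flux_def divide_le_eq_1 add_pos_nonneg)
qed

lemma sqrt_grad_pos: "0 < sqrt (1 + (norm (grad_eps \<epsilon> v y))\<^sup>2)" "1 \<le> sqrt (1 + (norm (grad_eps \<epsilon> v y))\<^sup>2)"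
  by (simp_all add: add_pos_nonneg)

text \<open>
  The last estimate says that the viscous correction to the flux is of order \<open>\<epsilon>\<close>: the denominators
  \<open>sqrt (1 + p\<^sup>2 + q\<^sup>2)\<close> and \<open>sqrt (1 + p\<^sup>2)\<close> differ by at most \<open>\<bar>q\<bar>\<close>.
\<close>

lemma abs_flux_le:
  shows "\<bar>flux1 \<epsilon> v y\<bar> \<le> 1" and "\<bar>flux1 \<epsilon> v y\<bar> \<le> \<bar>limit_flux (X1 v v y)\<bar>"
    and "\<bar>flux2 \<epsilon> v y\<bar> \<le> \<bar>\<epsilon> * pd2 v y\<bar>"
    and "\<bar>flux1 \<epsilon> v y - limit_flux (X1 v v y)\<bar> \<le> \<bar>\<epsilon> * pd2 v y\<bar>"
proof -
  let ?p = "X1 v v y" and ?q = "\<epsilon> * pd2 v y"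
  let ?W = "sqrt (1 + (norm (grad_eps \<epsilon> v y))\<^sup>2)" and ?V = "sqrt (1 + ?p\<^sup>2)"
  have V: "?V > 0" "\<bar>?p\<bar> \<le> ?V"
    using real_sqrt_le_mono[of "?p\<^sup>2" "1 + ?p\<^sup>2"] by (simp_all add: add_pos_nonneg)
  have VW: "?V \<le> ?W" by (simp add: norm_grad_eps)
  have W1: "1 \<le> ?W" and W0: "0 < ?W" by (fact sqrt_grad_pos)+
  have a: "\<bar>flux1 \<epsilon> v y\<bar> = \<bar>?p\<bar> / ?W" "\<bar>limit_flux ?p\<bar> = \<bar>?p\<bar> / ?V"
    using V W0 by (simp_all add: flux1_def limit_flux_def)
  show le: "\<bar>flux1 \<epsilon> v y\<bar> \<le> \<bar>limit_flux ?p\<bar>"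
    unfolding a by (rule divide_left_mono[OF VW abs_ge_zero mult_pos_pos[OF W0 V(1)]])
  then show "\<bar>flux1 \<epsilon> v y\<bar> \<le> 1"
    using abs_limit_flux_le_1[of ?p] by linarith
  have "\<bar>flux2 \<epsilon> v y\<bar> = \<bar>?q\<bar> / ?W"
    using W0 by (simp add: flux2_def X2_def abs_mult)
  also have "\<dots> \<le> \<bar>?q\<bar> / 1"
    using W1 W0 by (intro divide_left_mono) (simp_all only: mult_pos_pos zero_less_one abs_ge_zero)
  finally show "\<bar>flux2 \<epsilon> v y\<bar> \<le> \<bar>?q\<bar>" by simp
  have "?W \<le> ?V + \<bar>?q\<bar>"
  proof (rule real_le_lsqrt)
    have "0 \<le> ?V * \<bar>?q\<bar>" using V by simp
    then show "1 + (norm (grad_eps \<epsilon> v y))\<^sup>2 \<le> (?V + \<bar>?q\<bar>)\<^sup>2"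
      by (simp add: norm_grad_eps power2_sum)
  qed (use V in auto)
  then have "\<bar>?W - ?V\<bar> \<le> \<bar>?q\<bar>" using VW by linarith
  have "flux1 \<epsilon> v y - limit_flux ?p = - ((?p / ?V) * (?W - ?V) / ?W)"
    using V W0 by (simp add: flux1_def limit_flux_def field_simps)
  then have "\<bar>flux1 \<epsilon> v y - limit_flux ?p\<bar> = \<bar>limit_flux ?p\<bar> * \<bar>?W - ?V\<bar> / ?W"
    using V W0 by (simp add: abs_mult limit_flux_def)
  also have "\<dots> \<le> 1 * \<bar>?q\<bar> / 1"
    using W1 \<open>\<bar>?W - ?V\<bar> \<le> \<bar>?q\<bar>\<close> abs_limit_flux_le_1[of ?p]
    by (intro frac_le mult_mono) auto
  finally show "\<bar>flux1 \<epsilon> v y - limit_flux ?p\<bar> \<le> \<bar>?q\<bar>" by simp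
qed

lemma abs_limit_flux_mono:
  assumes "\<bar>p\<bar> \<le> P" shows "\<bar>limit_flux p\<bar> \<le> limit_flux P"
proof -
  have "limit_flux x \<le> limit_flux y" if "x \<le> y" for x y
    using that
  proof (rule DERIV_nonneg_imp_nondecreasing)
    fix z :: real
    have "0 \<le> 1 / (sqrt (1 + z\<^sup>2)) ^ 3" by simp
    then show "\<exists>D. (limit_flux has_real_derivative D) (at z) \<and> 0 \<le> D"
      using limit_flux_deriv[of z UNIV] by blast
  qed
  from this[of p P] this[of "-p" P] assms show ?thesis
    by (simp add: limit_flux_def abs_le_iff)
qed

lemma abs_DERIV_le:
  fixes g :: "real \<Rightarrow> real"
  assumes D: "(g has_real_derivative D) (at t)"
    and ev: "eventually (\<lambda>h. \<bar>g (t + h) - g t\<bar> \<le> C * \<bar>h\<bar>) (at 0)"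
  shows "\<bar>D\<bar> \<le> C"
proof (rule tendsto_upperbound)
  show "((\<lambda>h. \<bar>(g (t + h) - g t) / h\<bar>) \<longlongrightarrow> \<bar>D\<bar>) (at 0)"
    by (rule tendsto_rabs[OF DERIV_D[OF D]])
  have "eventually (\<lambda>h. h \<noteq> (0::real)) (at 0)"
    by (rule eventually_neq_at_within)
  with ev show "eventually (\<lambda>h. \<bar>(g (t + h) - g t) / h\<bar> \<le> C) (at 0)"
    by eventually_elim (simp add: abs_divide pos_divide_le_eq)
qed simp

lemma lipschitz_on_partials_le:
  assumes "open S" "C-lipschitz_on S v" "Ck_on 1 S v" "x \<in> S"
  shows "\<bar>pd1 v x\<bar> \<le> C" "\<bar>pd2 v x\<bar> \<le> C"
proof -
  obtain D where D: "(v has_derivative D) (at x)"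
    using assms(3,4) unfolding Ck_on_1_iff differentiable_def by blast
  have ev: "eventually (\<lambda>h. \<bar>v (fst x + h * m, snd x + h * n) - v x\<bar> \<le> C * \<bar>h\<bar>) (at 0)"
    if mn: "m\<^sup>2 + n\<^sup>2 = 1" for m n :: real
  proof -
    have "((\<lambda>h. (fst x + h * m, snd x + h * n)) \<longlongrightarrow> (fst x + 0 * m, snd x + 0 * n)) (at (0::real))"
      by (intro tendsto_intros)
    then have "eventually (\<lambda>h. (fst x + h * m, snd x + h * n) \<in> S) (at 0)"
      using topological_tendstoD[OF _ assms(1)] assms(4) by simp
    then show ?thesis
    proof eventually_elim
      case (elim h)
      have "dist (fst x + h * m, snd x + h * n) x = sqrt (h\<^sup>2 * (m\<^sup>2 + n\<^sup>2))"
        by (cases x) (simp add: dist_Pair_Pair dist_real_def power_mult_distrib distrib_left)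
      then show ?case
        using lipschitz_onD[OF assms(2) elim assms(4)] by (simp add: mn dist_real_def)
    qed
  qed
  have ev1: "eventually (\<lambda>h. \<bar>v (fst x + h, snd x) - v (fst x, snd x)\<bar> \<le> C * \<bar>h\<bar>) (at 0)"
    and ev2: "eventually (\<lambda>h. \<bar>v (fst x, snd x + h) - v (fst x, snd x)\<bar> \<le> C * \<bar>h\<bar>) (at 0)"
    using ev[of 1 0] ev[of 0 1] by simp_all
  note p = partials_of_has_derivative[OF D]
  show "\<bar>pd1 v x\<bar> \<le> C" using abs_DERIV_le[OF p(1) ev1] p(3) by simp
  show "\<bar>pd2 v x\<bar> \<le> C" using abs_DERIV_le[OF p(2) ev2] p(4) by simp
qed

section \<open>Strong convergence of the slopes\<close>

lemma integral_pd1_rectangle: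
  assumes F: "Ck_on 1 S F" and R: "cbox (a, c) (b, d) \<subseteq> S" and ab: "a \<le> b"
  shows "integral (cbox (a, c) (b, d)) (pd1 F) = integral {c..d} (\<lambda>x. F (b, x) - F (a, x))"
proof -
  have cont: "continuous_on (cbox (a, c) (b, d)) (pd1 F)"
    using F R unfolding Ck_on_1_iff by (blast intro: continuous_on_subset)
  have "integral (cbox (a, c) (b, d)) (pd1 F) = integral (cbox a b) (\<lambda>t. integral (cbox c d) (\<lambda>x. pd1 F (t, x)))"
    by (rule integral_prod_continuous[OF cont])
  also have "\<dots> = integral (cbox c d) (\<lambda>x. integral (cbox a b) (\<lambda>t. pd1 F (t, x)))"
    using cont by (intro integral_swap_continuous) (simp add: case_prod_unfold)
  also have "\<dots> = integral (cbox c d) (\<lambda>x. F (b, x) - F (a, x))"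
  proof (rule integral_cong)
    fix x assume x: "x \<in> cbox c d"
    have "((\<lambda>t. pd1 F (t, x)) has_integral F (b, x) - F (a, x)) {a..b}"
    proof (rule fundamental_theorem_of_calculus[OF ab])
      fix t assume t: "t \<in> {a..b}"
      have "(t, x) \<in> S" using t x R by (auto simp: cbox_Pair_eq)
      from Ck_on_chain[of 0 S F "\<lambda>t. t" t "\<lambda>_. x" 1 "{a..b}" 0, OF F[unfolded One_nat_def] this]
      show "((\<lambda>t. F (t, x)) has_vector_derivative pd1 F (t, x)) (at t within {a..b})"
        by (simp add: has_real_derivative_iff_has_vector_derivative)
    qed
    then show "integral (cbox a b) (\<lambda>t. pd1 F (t, x)) = F (b, x) - F (a, x)"
      by (simp add: integral_unique)
  qed
  finally show ?thesis by simp
qed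

lemma integral_pd2_rectangle:
  assumes F: "Ck_on 1 S F" and R: "cbox (a, c) (b, d) \<subseteq> S" and cd: "c \<le> d"
  shows "integral (cbox (a, c) (b, d)) (pd2 F) = integral {a..b} (\<lambda>t. F (t, d) - F (t, c))"
proof -
  have cont: "continuous_on (cbox (a, c) (b, d)) (pd2 F)"
    using F R unfolding Ck_on_1_iff by (blast intro: continuous_on_subset)
  have "integral (cbox (a, c) (b, d)) (pd2 F) = integral (cbox a b) (\<lambda>t. integral (cbox c d) (\<lambda>x. pd2 F (t, x)))"
    by (rule integral_prod_continuous[OF cont])
  also have "\<dots> = integral (cbox a b) (\<lambda>t. F (t, d) - F (t, c))"
  proof (rule integral_cong)
    fix t assume t: "t \<in> cbox a b"
    have "((\<lambda>x. pd2 F (t, x)) has_integral F (t, d) - F (t, c)) {c..d}"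
    proof (rule fundamental_theorem_of_calculus[OF cd])
      fix x assume x: "x \<in> {c..d}"
      have "(t, x) \<in> S" using t x R by (auto simp: cbox_Pair_eq)
      from Ck_on_chain[of 0 S F "\<lambda>_. t" x "\<lambda>x. x" 0 "{c..d}" 1, OF F[unfolded One_nat_def] this]
      show "((\<lambda>x. F (t, x)) has_vector_derivative pd2 F (t, x)) (at x within {c..d})"
        by (simp add: has_real_derivative_iff_has_vector_derivative)
    qed
    then show "integral (cbox c d) (\<lambda>x. pd2 F (t, x)) = F (t, d) - F (t, c)"
      by (simp add: integral_unique)
  qed
  finally show ?thesis by simp
qed

lemma abs_integral_interval_le:
  fixes f :: "real \<Rightarrow> real"
  assumes "a \<le> b" "0 \<le> K" "\<And>x. x \<in> {a..b} \<Longrightarrow> \<bar>f x\<bar> \<le> K" "continuous_on {a..b} f"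
  shows "\<bar>integral {a..b} f\<bar> \<le> K * (b - a)"
  using integral_bound[of a b f K] assms by simp

text \<open>
  By the product rule, \<open>A (p\<^sub>v - p\<^sub>z)\<close> is the divergence of
  \<open>(A (v - z), (v A + \<epsilon> B) (v - z))\<close>, up to terms without derivatives of \<open>A\<close> and \<open>B\<close>: the derivatives of \<open>A\<close> and \<open>B\<close>
  combine to the left hand side of the equation. The remaining terms carry the factor \<open>v - z\<close> or \<open>\<epsilon>\<^sup>2\<close>.
\<close>

lemma flux_pairing_bound:
  fixes v z :: "plane \<Rightarrow> real"
  assumes v: "smooth_on_plane \<Omega> v" and z: "Ck_on 1 \<Omega> z"
    and eq: "regularized_minimal_graph \<Omega> \<epsilon> v" and \<epsilon>: "0 \<le> \<epsilon>"
    and R: "cbox (a, c) (b, d) \<subseteq> \<Omega>" and ab: "a \<le> b" and cd: "c \<le> d"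
    and pd: "\<And>x. x \<in> cbox (a, c) (b, d) \<Longrightarrow> \<bar>pd2 v x\<bar> \<le> C \<and> \<bar>pd2 z x\<bar> \<le> C"
    and M: "\<And>x. x \<in> cbox (a, c) (b, d) \<Longrightarrow> \<bar>v x\<bar> \<le> M"
    and \<eta>: "\<And>x. x \<in> cbox (a, c) (b, d) \<Longrightarrow> \<bar>v x - z x\<bar> \<le> \<eta>"
  shows "\<bar>integral (cbox (a, c) (b, d)) (\<lambda>x. flux1 \<epsilon> v x * (X1 v v x - X1 z z x))\<bar>
    \<le> 2 * \<eta> * (d - c) + 2 * (M + \<epsilon>\<^sup>2 * C) * \<eta> * (b - a)
      + (2 * C * \<eta> + 2 * C\<^sup>2 * \<epsilon>\<^sup>2) * ((b - a) * (d - c))"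
proof -
  define R where "R = cbox (a, c) (b, d)"
  let ?A = "flux1 \<epsilon> v" and ?B = "flux2 \<epsilon> v"
  let ?w = "\<lambda>x. v x + (- 1) * z x"
  let ?F = "\<lambda>x. ?A x * ?w x"
  let ?G = "\<lambda>x. (v x * ?A x + \<epsilon> * ?B x) * ?w x"
  note [simp] = R_def[symmetric]
  have R\<Omega>: "R \<subseteq> \<Omega>" using R by simp
  have corner: "(a, c) \<in> R" using ab cd by (simp add: R_def cbox_Pair_eq)
  have C0: "0 \<le> C" and M0: "0 \<le> M" and \<eta>0: "0 \<le> \<eta>"
    using pd[of "(a, c)"] M[of "(a, c)"] \<eta>[of "(a, c)"] corner by auto
  have Av: "Ck_on 1 \<Omega> v" "Ck_on 1 \<Omega> ?A" "Ck_on 1 \<Omega> ?B"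
    by (fact smooth_on_plane_Ck_1[OF v] C1_flux[OF v])+
  have w: "Ck_on 1 \<Omega> ?w" by (intro Ck_on_1_add Ck_on_1_mult Ck_on_1_const Av z)
  have F: "Ck_on 1 \<Omega> ?F" by (intro Ck_on_1_mult Av w)
  have G: "Ck_on 1 \<Omega> ?G" by (intro Ck_on_1_mult Ck_on_1_add Ck_on_1_const Av w)
  (* N is the divergence of (F, G) minus the integrand; it contains no derivative of A or B *)
  let ?N = "\<lambda>x. ?A x * ?w x * (pd2 v x - pd2 z x) + \<epsilon> * ?B x * (pd2 v x - pd2 z x)"
  have pointwise: "?A x * (X1 v v x - X1 z z x) = pd1 ?F x + pd2 ?G x - ?N x" if "x \<in> \<Omega>" for x
  proof -
    note D = Ck_on_has_derivative[of 0, unfolded One_nat_def[symmetric], OF _ that]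
    have dw: "(?w has_derivative (\<lambda>h. (pd1 v x * fst h + pd2 v x * snd h) - (pd1 z x * fst h + pd2 z x * snd h))) (at x)"
      using has_derivative_diff[OF D[OF Av(1)] D[OF z]] by simp
    have pF: "pd1 ?F x = ?A x * (pd1 v x - pd1 z x) + pd1 ?A x * ?w x"
      using partials_of_has_derivative(3)[OF has_derivative_mult[OF D[OF Av(2)] dw]] by simp
    have "((\<lambda>x. v x * ?A x + \<epsilon> * ?B x) has_derivative
        (\<lambda>h. (v x * (pd1 ?A x * fst h + pd2 ?A x * snd h) + (pd1 v x * fst h + pd2 v x * snd h) * ?A x)
          + \<epsilon> * (pd1 ?B x * fst h + pd2 ?B x * snd h))) (at x)"
      by (intro has_derivative_add has_derivative_mult has_derivative_mult_right D Av)
    from partials_of_has_derivative(4)[OF has_derivative_mult[OF this dw]]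
    have pG: "pd2 ?G x = (v x * ?A x + \<epsilon> * ?B x) * (pd2 v x - pd2 z x)
        + ((v x * pd2 ?A x + pd2 v x * ?A x) + \<epsilon> * pd2 ?B x) * ?w x"
      by simp
    have E: "pd1 ?A x = - (v x * pd2 ?A x) - \<epsilon> * pd2 ?B x"
      using minimal_graph_flux_equation[OF eq that] by linarith
    show ?thesis
      unfolding pF pG X1_def E by (simp add: algebra_simps)
  qed
  have cont: "continuous_on R v" "continuous_on R z" "continuous_on R ?A" "continuous_on R ?B"
      "continuous_on R (pd2 v)" "continuous_on R (pd2 z)" "continuous_on R (pd1 ?F)" "continuous_on R (pd2 ?G)"
    by (intro continuous_on_subset[OF _ R\<Omega>] Ck_on_1_continuous Ck_on_1_continuous_partials Av z F G)+
  have contN: "continuous_on R ?N"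
    by (intro continuous_intros cont)
  have int: "pd1 ?F integrable_on R" "pd2 ?G integrable_on R" "?N integrable_on R"
    unfolding R_def by (intro integrable_continuous; use cont contN in simp)+
  have "integral R (\<lambda>x. ?A x * (X1 v v x - X1 z z x)) = integral R (\<lambda>x. pd1 ?F x + pd2 ?G x - ?N x)"
    by (intro integral_cong pointwise) (use R\<Omega> in auto)
  also have "\<dots> = integral R (pd1 ?F) + integral R (pd2 ?G) - integral R ?N"
    using int by (simp add: integral_diff integral_add integrable_add)
  finally have split: "integral R (\<lambda>x. ?A x * (X1 v v x - X1 z z x))
      = integral R (pd1 ?F) + integral R (pd2 ?G) - integral R ?N" .
  have A1: "\<bar>?A x\<bar> \<le> 1" for x by (rule abs_flux_le)
  have B1: "\<bar>\<epsilon> * ?B x\<bar> \<le> \<epsilon>\<^sup>2 * C" if "x \<in> R" for x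
  proof -
    have "\<bar>\<epsilon> * ?B x\<bar> \<le> \<epsilon> * \<bar>\<epsilon> * pd2 v x\<bar>"
      using abs_flux_le(3)[of \<epsilon> v x] \<epsilon> by (simp add: abs_mult mult_left_mono)
    also have "\<dots> \<le> \<epsilon> * (\<epsilon> * C)"
      using pd[of x] that \<epsilon> by (intro mult_left_mono) (simp_all add: abs_mult mult_left_mono)
    finally show ?thesis by (simp add: power2_eq_square mult.assoc)
  qed
  have w1: "\<bar>?w x\<bar> \<le> \<eta>" if "x \<in> R" for x using \<eta>[of x] that by simp
  have Fb: "\<bar>?F x\<bar> \<le> \<eta>" if "x \<in> R" for x
    using mult_mono[OF A1[of x] w1[OF that]] by (simp add: abs_mult)
  have Gb: "\<bar>?G x\<bar> \<le> (M + \<epsilon>\<^sup>2 * C) * \<eta>" if "x \<in> R" for x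
  proof -
    have "\<bar>v x * ?A x\<bar> \<le> M * 1"
      unfolding abs_mult using M[of x] A1[of x] that M0 by (intro mult_mono) auto
    then have "\<bar>v x * ?A x + \<epsilon> * ?B x\<bar> \<le> M + \<epsilon>\<^sup>2 * C" using B1[OF that] by linarith
    then show ?thesis
      unfolding abs_mult using w1[OF that] M0 C0 by (intro mult_mono) auto
  qed
  have Nb: "\<bar>?N x\<bar> \<le> 2 * C * \<eta> + 2 * C\<^sup>2 * \<epsilon>\<^sup>2" if "x \<in> R" for x
  proof -
    have d: "\<bar>pd2 v x - pd2 z x\<bar> \<le> 2 * C" using pd[of x] that by auto
    have "\<bar>?F x * (pd2 v x - pd2 z x)\<bar> \<le> \<eta> * (2 * C)"
      unfolding abs_mult[of "?F x"] using Fb[OF that] d \<eta>0 by (intro mult_mono) auto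
    moreover have "\<bar>\<epsilon> * ?B x * (pd2 v x - pd2 z x)\<bar> \<le> (\<epsilon>\<^sup>2 * C) * (2 * C)"
      unfolding abs_mult[of "\<epsilon> * ?B x"] using B1[OF that] d C0 by (intro mult_mono) auto
    ultimately show ?thesis
      by (simp add: power2_eq_square algebra_simps)
  qed
  have contF: "continuous_on R ?F" and contG: "continuous_on R ?G"
    by (intro continuous_intros cont)+
  have edge: "(\<lambda>x. (t, x)) ` {c..d} \<subseteq> R" "(\<lambda>t'. (t', x)) ` {a..b} \<subseteq> R"
    if "t \<in> {a..b}" "x \<in> {c..d}" for t x
    using that by (auto simp: R_def cbox_Pair_eq)
  have "\<bar>integral R (pd1 ?F)\<bar> \<le> (2 * \<eta>) * (d - c)"
  proof -
    have "integral R (pd1 ?F) = integral {c..d} (\<lambda>x. ?F (b, x) - ?F (a, x))"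
      unfolding R_def by (rule integral_pd1_rectangle[OF F R ab])
    also have "\<bar>\<dots>\<bar> \<le> (2 * \<eta>) * (d - c)"
    proof (rule abs_integral_interval_le[OF cd])
      show "continuous_on {c..d} (\<lambda>x. ?F (b, x) - ?F (a, x))"
        using edge(1)[of a c] edge(1)[of b c] ab cd
        by (intro continuous_on_diff continuous_on_compose2[OF contF] continuous_intros) auto
      fix x assume "x \<in> {c..d}"
      then show "\<bar>?F (b, x) - ?F (a, x)\<bar> \<le> 2 * \<eta>"
        using Fb[of "(a, x)"] Fb[of "(b, x)"] ab by (auto simp: R_def cbox_Pair_eq)
    qed (use \<eta>0 in simp)
    finally show ?thesis .
  qed
  moreover have "\<bar>integral R (pd2 ?G)\<bar> \<le> (2 * ((M + \<epsilon>\<^sup>2 * C) * \<eta>)) * (b - a)"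
  proof -
    have "integral R (pd2 ?G) = integral {a..b} (\<lambda>t. ?G (t, d) - ?G (t, c))"
      unfolding R_def by (rule integral_pd2_rectangle[OF G R cd])
    also have "\<bar>\<dots>\<bar> \<le> (2 * ((M + \<epsilon>\<^sup>2 * C) * \<eta>)) * (b - a)"
    proof (rule abs_integral_interval_le[OF ab])
      show "continuous_on {a..b} (\<lambda>t. ?G (t, d) - ?G (t, c))"
        using edge(2)[of a c] edge(2)[of a d] ab cd
        by (intro continuous_on_diff continuous_on_compose2[OF contG] continuous_intros) auto
      fix t assume "t \<in> {a..b}"
      then show "\<bar>?G (t, d) - ?G (t, c)\<bar> \<le> 2 * ((M + \<epsilon>\<^sup>2 * C) * \<eta>)"
        using Gb[of "(t, c)"] Gb[of "(t, d)"] cd by (auto simp: R_def cbox_Pair_eq)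
    qed (use \<eta>0 M0 C0 in simp)
    finally show ?thesis .
  qed
  moreover have "\<bar>integral R ?N\<bar> \<le> (2 * C * \<eta> + 2 * C\<^sup>2 * \<epsilon>\<^sup>2) * ((b - a) * (d - c))"
  proof -
    have "norm (integral R ?N) \<le> (2 * C * \<eta> + 2 * C\<^sup>2 * \<epsilon>\<^sup>2) * measure lborel R"
      using C0 \<eta>0 Nb int(3) unfolding R_def
      by (intro has_integral_bound[OF _ integrable_integral]) auto
    moreover have "measure lborel R = (b - a) * (d - c)"
      unfolding R_def content_Pair using ab cd by simp
    ultimately show ?thesis by (simp only: real_norm_def)
  qed
  ultimately show ?thesis
    unfolding R_def[symmetric] split mult.assoc by linarith
qed

text \<open>
  Minty's argument in quantitative form. Adding the pairing bounds for \<open>v\<close> and for \<open>z\<close> bounds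
  \<open>\<integral> (A - A') (p - p')\<close>, and monotonicity bounds \<open>\<integral> (p - p')\<^sup>2\<close>. The parameter \<open>\<kappa>\<close> comes from
  \<open>\<bar>D\<bar> \<le> \<kappa> + D\<^sup>2 / \<kappa>\<close>, which replaces the Cauchy-Schwarz inequality.
\<close>

lemma slope_L1_distance_bound:
  fixes v z :: "plane \<Rightarrow> real"
  assumes v: "smooth_on_plane \<Omega> v" "regularized_minimal_graph \<Omega> \<epsilon> v" "0 \<le> \<epsilon>"
    and z: "smooth_on_plane \<Omega> z" "regularized_minimal_graph \<Omega> \<delta> z" "0 \<le> \<delta>"
    and le1: "\<epsilon> \<le> 1" "\<delta> \<le> 1"
    and R: "cbox (a, c) (b, d) \<subseteq> \<Omega>" and ab: "a \<le> b" and cd: "c \<le> d"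
    and pd: "\<And>x. x \<in> cbox (a, c) (b, d) \<Longrightarrow> \<bar>pd2 v x\<bar> \<le> C \<and> \<bar>pd2 z x\<bar> \<le> C"
    and M: "\<And>x. x \<in> cbox (a, c) (b, d) \<Longrightarrow> \<bar>v x\<bar> \<le> M \<and> \<bar>z x\<bar> \<le> M"
    and P: "\<And>x. x \<in> cbox (a, c) (b, d) \<Longrightarrow> \<bar>X1 v v x\<bar> \<le> P \<and> \<bar>X1 z z x\<bar> \<le> P"
    and \<eta>: "\<And>x. x \<in> cbox (a, c) (b, d) \<Longrightarrow> \<bar>v x - z x\<bar> \<le> \<eta>"
    and \<kappa>: "0 < \<kappa>"
  defines "A \<equiv> (b - a) * (d - c)"
  shows "integral (cbox (a, c) (b, d)) (\<lambda>x. \<bar>X1 v v x - X1 z z x\<bar>)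
    \<le> \<kappa> * A + sqrt (1 + P\<^sup>2) ^ 3 / \<kappa> *
        (2 * (2 * (d - c) + 2 * (M + C) * (b - a) + 2 * C * A) * \<eta>
          + (2 * C\<^sup>2 + 2 * C * P) * A * (\<epsilon> + \<delta>))"
proof -
  let ?K = "2 * (d - c) + 2 * (M + C) * (b - a) + 2 * C * A"
  define R where "R = cbox (a, c) (b, d)"
  define L where "L = sqrt (1 + P\<^sup>2) ^ 3"
  let ?A = "flux1 \<epsilon> v" and ?B = "flux1 \<delta> z" and ?p = "X1 v v" and ?q = "X1 z z"
  have R\<Omega>: "R \<subseteq> \<Omega>" using R by (simp add: R_def)
  have corner: "(a, c) \<in> R" using ab cd by (simp add: R_def cbox_Pair_eq)
  have C0: "0 \<le> C" and M0: "0 \<le> M" and \<eta>0: "0 \<le> \<eta>" and P0: "0 \<le> P"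
    using pd[of "(a, c)"] M[of "(a, c)"] \<eta>[of "(a, c)"] P[of "(a, c)"] corner unfolding R_def by auto
  have A0: "0 \<le> A" using ab cd by (simp add: A_def)
  have L0: "0 \<le> L" by (simp add: L_def)
  have cont: "continuous_on R ?A" "continuous_on R ?B" "continuous_on R ?p" "continuous_on R ?q"
    by (intro continuous_on_subset[OF _ R\<Omega>] Ck_on_1_continuous C1_flux C1_slope v z)+
  have pointwise: "\<bar>?p x - ?q x\<bar> \<le> (\<kappa> + L / \<kappa> * (2 * C * P * (\<epsilon> + \<delta>)))
      + L / \<kappa> * (?A x * (?p x - ?q x) + ?B x * (?q x - ?p x))" if x: "x \<in> R" for x
  proof -
    let ?D = "?p x - ?q x"
    have bnd: "\<bar>?p x\<bar> \<le> P" "\<bar>?q x\<bar> \<le> P" and pdx: "\<bar>pd2 v x\<bar> \<le> C" "\<bar>pd2 z x\<bar> \<le> C"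
      using P pd x by (auto simp: R_def)
    have D: "\<bar>?D\<bar> \<le> 2 * P" using bnd by linarith
    have "\<bar>?A x - limit_flux (?p x)\<bar> \<le> \<epsilon> * C" "\<bar>?B x - limit_flux (?q x)\<bar> \<le> \<delta> * C"
      using abs_flux_le(4)[of \<epsilon> v x] abs_flux_le(4)[of \<delta> z x] pdx
        mult_left_mono[OF pdx(1) v(3)] mult_left_mono[OF pdx(2) z(3)] v(3) z(3)
      by (simp_all add: abs_mult)
    then have "\<bar>(limit_flux (?p x) - limit_flux (?q x)) - (?A x - ?B x)\<bar> \<le> (\<epsilon> + \<delta>) * C"
      by (simp add: algebra_simps)
    from mult_mono[OF this D] C0 P0 v(3) z(3)
    have "\<bar>((limit_flux (?p x) - limit_flux (?q x)) - (?A x - ?B x)) * ?D\<bar> \<le> (\<epsilon> + \<delta>) * C * (2 * P)"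
      by (simp add: abs_mult)
    then have "(limit_flux (?p x) - limit_flux (?q x)) * ?D \<le> (?A x - ?B x) * ?D + (\<epsilon> + \<delta>) * C * (2 * P)"
      by (simp add: left_diff_distrib)
    then have "L * ((limit_flux (?p x) - limit_flux (?q x)) * ?D)
        \<le> L * ((?A x - ?B x) * ?D + (\<epsilon> + \<delta>) * C * (2 * P))"
      using L0 by (rule mult_left_mono)
    with limit_flux_expansive(2)[OF bnd]
    have sq: "?D\<^sup>2 \<le> L * ((?A x - ?B x) * ?D + (\<epsilon> + \<delta>) * C * (2 * P))"
      by (simp add: L_def)
    have "\<bar>?D\<bar> \<le> \<kappa> + ?D\<^sup>2 / \<kappa>"
    proof -
      have "0 \<le> (\<bar>?D\<bar> - \<kappa>)\<^sup>2" "0 \<le> \<bar>?D\<bar> * \<kappa>" using \<kappa> by simp_all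
      then have "\<bar>?D\<bar> * \<kappa> \<le> \<kappa> * \<kappa> + ?D\<^sup>2"
        by (simp add: power2_diff power2_eq_square[of \<kappa>])
      then show ?thesis using \<kappa> by (simp add: field_simps)
    qed
    also have "\<dots> \<le> \<kappa> + L * ((?A x - ?B x) * ?D + (\<epsilon> + \<delta>) * C * (2 * P)) / \<kappa>"
      using sq \<kappa> by (intro add_left_mono divide_right_mono) auto
    also have "\<dots> = (\<kappa> + L / \<kappa> * (2 * C * P * (\<epsilon> + \<delta>)))
      + L / \<kappa> * (?A x * (?p x - ?q x) + ?B x * (?q x - ?p x))"
      using \<kappa> by (simp add: field_simps)
    finally show ?thesis .
  qed
  have int1: "(\<lambda>x. ?A x * (?p x - ?q x)) integrable_on R" "(\<lambda>x. ?B x * (?q x - ?p x)) integrable_on R"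
    "(\<lambda>x. \<bar>?p x - ?q x\<bar>) integrable_on R"
    unfolding R_def by (intro integrable_continuous continuous_intros cont[unfolded R_def])+
  have int2: "(\<lambda>x. \<kappa> + L / \<kappa> * (2 * C * P * (\<epsilon> + \<delta>))) integrable_on R"
    unfolding R_def by (rule integrable_const)
  have content: "measure lborel R = A"
    unfolding R_def content_Pair A_def using ab cd by simp
  have bound: "\<bar>integral R (\<lambda>x. flux1 e w x * (X1 w w x - X1 y y x))\<bar>
      \<le> ?K * \<eta> + 2 * C\<^sup>2 * A * e"
    if w: "smooth_on_plane \<Omega> w" "regularized_minimal_graph \<Omega> e w" "0 \<le> e" "e \<le> 1"
      and y: "smooth_on_plane \<Omega> y"
      and b: "\<And>x. x \<in> R \<Longrightarrow> \<bar>pd2 w x\<bar> \<le> C \<and> \<bar>pd2 y x\<bar> \<le> C" "\<And>x. x \<in> R \<Longrightarrow> \<bar>w x\<bar> \<le> M"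
        "\<And>x. x \<in> R \<Longrightarrow> \<bar>w x - y x\<bar> \<le> \<eta>"
    for w y e
  proof -
    have e2: "e\<^sup>2 \<le> e" using w by (simp add: power2_eq_square mult_left_le)
    then have e2': "e\<^sup>2 \<le> 1" using w by linarith
    have "\<bar>integral R (\<lambda>x. flux1 e w x * (X1 w w x - X1 y y x))\<bar>
      \<le> 2 * \<eta> * (d - c) + 2 * (M + e\<^sup>2 * C) * \<eta> * (b - a) + (2 * C * \<eta> + 2 * C\<^sup>2 * e\<^sup>2) * ((b - a) * (d - c))"
      unfolding R_def using w y b[unfolded R_def] R ab cd
      by (intro flux_pairing_bound[of \<Omega>] smooth_on_plane_Ck_1) auto
    also have "\<dots> \<le> 2 * \<eta> * (d - c) + 2 * (M + 1 * C) * \<eta> * (b - a) + (2 * C * \<eta> + 2 * C\<^sup>2 * e) * A"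
      unfolding A_def[symmetric] using e2 e2' ab C0 M0 \<eta>0 A0
      by (intro add_mono mult_right_mono mult_left_mono) auto
    also have "\<dots> = ?K * \<eta> + 2 * C\<^sup>2 * A * e"
      by (simp add: algebra_simps)
    finally show ?thesis .
  qed
  have b1: "\<bar>integral R (\<lambda>x. ?A x * (?p x - ?q x))\<bar>
      \<le> ?K * \<eta> + 2 * C\<^sup>2 * A * \<epsilon>"
    using pd M \<eta> unfolding R_def[symmetric] by (intro bound v z le1) auto
  have b2: "\<bar>integral R (\<lambda>x. ?B x * (?q x - ?p x))\<bar>
      \<le> ?K * \<eta> + 2 * C\<^sup>2 * A * \<delta>"
    using pd M \<eta> unfolding R_def[symmetric] by (intro bound v z le1) (auto simp: abs_minus_commute)
  have "integral R (\<lambda>x. \<bar>?p x - ?q x\<bar>) \<le> integral R (\<lambda>x. (\<kappa> + L / \<kappa> * (2 * C * P * (\<epsilon> + \<delta>)))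
      + L / \<kappa> * (?A x * (?p x - ?q x) + ?B x * (?q x - ?p x)))"
    by (intro integral_le pointwise int1 int2 integrable_add integrable_on_mult_right)
  also have "\<dots> = (\<kappa> + L / \<kappa> * (2 * C * P * (\<epsilon> + \<delta>))) * A + L / \<kappa> *
      (integral R (\<lambda>x. ?A x * (?p x - ?q x)) + integral R (\<lambda>x. ?B x * (?q x - ?p x)))"
  proof (rule integral_unique)
    have "((\<lambda>x. \<kappa> + L / \<kappa> * (2 * C * P * (\<epsilon> + \<delta>))) has_integral (\<kappa> + L / \<kappa> * (2 * C * P * (\<epsilon> + \<delta>))) * A) R"
      using has_integral_const[of "\<kappa> + L / \<kappa> * (2 * C * P * (\<epsilon> + \<delta>))" "(a, c)" "(b, d)"] content
      unfolding R_def by (simp only: real_scaleR_def mult.commute[of A])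
    then show "((\<lambda>x. (\<kappa> + L / \<kappa> * (2 * C * P * (\<epsilon> + \<delta>)))
        + L / \<kappa> * (?A x * (?p x - ?q x) + ?B x * (?q x - ?p x))) has_integral
      ((\<kappa> + L / \<kappa> * (2 * C * P * (\<epsilon> + \<delta>))) * A + L / \<kappa> *
      (integral R (\<lambda>x. ?A x * (?p x - ?q x)) + integral R (\<lambda>x. ?B x * (?q x - ?p x))))) R"
      by (intro has_integral_add has_integral_mult_right integrable_integral int1(1,2))
  qed
  also have "\<dots> \<le> (\<kappa> + L / \<kappa> * (2 * C * P * (\<epsilon> + \<delta>))) * A + L / \<kappa> *
      ((?K * \<eta> + 2 * C\<^sup>2 * A * \<epsilon>)
      + (?K * \<eta> + 2 * C\<^sup>2 * A * \<delta>))"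
    using b1 b2 L0 \<kappa> by (intro add_left_mono mult_left_mono add_mono) auto
  also have "\<dots> = \<kappa> * A + L / \<kappa> * (2 * ?K * \<eta>
          + (2 * C\<^sup>2 + 2 * C * P) * A * (\<epsilon> + \<delta>))"
    using \<kappa> by (simp add: field_simps)
  finally show ?thesis by (simp add: R_def L_def)
qed

section \<open>Averages over a thin strip between two leaves\<close>

lemma abs_diff_le_integral_of_derivative_bound:
  fixes h :: "real \<Rightarrow> real"
  assumes h: "\<And>t. t \<in> {a..b} \<Longrightarrow> (h has_real_derivative h' t) (at t within {a..b})"
    and G: "continuous_on {a..b} G" "\<And>t. t \<in> {a..b} \<Longrightarrow> \<bar>h' t\<bar> \<le> G t"
    and st: "s \<in> {a..b}" "t \<in> {a..b}"
  shows "\<bar>h t - h s\<bar> \<le> integral {a..b} G"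
proof -
  have *: "\<bar>h y - h x\<bar> \<le> integral {a..b} G" if "x \<le> y" "x \<in> {a..b}" "y \<in> {a..b}" for x y
  proof -
    have sub: "{x..y} \<subseteq> {a..b}" using that by auto
    have I: "(h' has_integral (h y - h x)) {x..y}"
    proof (rule fundamental_theorem_of_calculus[OF that(1)])
      fix z assume z: "z \<in> {x..y}"
      show "(h has_vector_derivative h' z) (at z within {x..y})"
        using has_field_derivative_subset[OF h sub] z sub
        by (auto simp flip: has_real_derivative_iff_has_vector_derivative)
    qed
    have Gi: "G integrable_on {x..y}"
      by (rule integrable_continuous_interval[OF continuous_on_subset[OF G(1) sub]])
    have "norm (integral {x..y} h') \<le> integral {x..y} G"
      using G(2) sub I Gi by (intro integral_norm_bound_integral) (auto simp: has_integral_integrable)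
    also have "\<dots> \<le> integral {a..b} G"
      using order_trans[OF abs_ge_zero G(2)]
      by (intro integral_subset_le[OF sub Gi integrable_continuous_interval[OF G(1)]]) auto
    finally show ?thesis using I by (simp add: integral_unique)
  qed
  show ?thesis
    using *[of s t] *[of t s] st by (cases "s \<le> t") (auto simp: abs_minus_commute)
qed

lemma integral_unit_add_const:
  fixes k :: real
  assumes "F integrable_on {0..1::real}" shows "integral {0..1} (\<lambda>\<theta>. F \<theta> + k) = integral {0..1} F + k"
  using has_integral_add[OF integrable_integral[OF assms] has_integral_const_real[of k 0 1]]
  by (simp add: integral_unique)

text \<open>
  A strip between two integral curves \<open>f < g\<close> of the limit field, of width comparable to \<open>\<omega>\<close>, together with a smooth
  approximation \<open>v\<close> that is \<open>\<eta>\<close>-close to \<open>u\<close>, and a continuous reference slope \<open>r\<close> whose oscillation across the strip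
  is at most \<open>\<mu>\<close>.
\<close>

locale thin_strip =
  fixes \<Omega> :: "plane set" and u v r :: "plane \<Rightarrow> real" and \<epsilon> C P \<eta> \<mu> \<omega> a b c d :: real
    and f g :: "real \<Rightarrow> real"
  assumes open_domain: "open \<Omega>"
    and rectangle: "cbox (a, c) (b, d) \<subseteq> \<Omega>"
    and smooth: "smooth_on_plane \<Omega> v"
    and minimal: "regularized_minimal_graph \<Omega> \<epsilon> v"
    and eps: "0 \<le> \<epsilon>" "\<epsilon> \<le> 1" "\<epsilon> * C \<le> \<eta>"
    and lip: "C-lipschitz_on \<Omega> u" "C-lipschitz_on \<Omega> v"
    and slope_le: "\<And>x. x \<in> cbox (a, c) (b, d) \<Longrightarrow> \<bar>X1 v v x\<bar> \<le> P"
    and close: "\<And>x. x \<in> cbox (a, c) (b, d) \<Longrightarrow> \<bar>v x - u x\<bar> \<le> \<eta>"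
    and leaf_f: "\<And>t. t \<in> {a..b} \<Longrightarrow> (f has_real_derivative u (t, f t)) (at t within {a..b})"
    and leaf_g: "\<And>t. t \<in> {a..b} \<Longrightarrow> (g has_real_derivative u (t, g t)) (at t within {a..b})"
    and range: "\<And>t. t \<in> {a..b} \<Longrightarrow> c \<le> f t \<and> g t \<le> d"
    and width: "\<And>t. t \<in> {a..b} \<Longrightarrow> \<omega> / 2 \<le> g t - f t \<and> g t - f t \<le> 2 * \<omega>"
    and width_pos: "0 < \<omega>"
    and ref_cont: "continuous_on (cbox (a, c) (b, d)) r"
    and ref_le: "\<And>x. x \<in> cbox (a, c) (b, d) \<Longrightarrow> \<bar>r x\<bar> \<le> P"
    and ref_osc: "\<And>t x y. (t, x) \<in> cbox (a, c) (b, d) \<Longrightarrow> (t, y) \<in> cbox (a, c) (b, d) \<Longrightarrow>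
      \<bar>x - y\<bar> \<le> 2 * \<omega> \<Longrightarrow> \<bar>r (t, x) - r (t, y)\<bar> \<le> \<mu>"
begin

abbreviation "R \<equiv> cbox (a, c) (b, d)"

definition w where "w t = g t - f t"

definition pt :: "real \<Rightarrow> real \<Rightarrow> plane" where "pt t \<theta> = (t, f t + \<theta> * w t)"

definition avg :: "(plane \<Rightarrow> real) \<Rightarrow> real \<Rightarrow> real" where
  "avg F t = integral {0..1} (\<lambda>\<theta>. F (pt t \<theta>))"

lemma w_bounds: "t \<in> {a..b} \<Longrightarrow> 0 < w t" "t \<in> {a..b} \<Longrightarrow> \<omega> / 2 \<le> w t" "t \<in> {a..b} \<Longrightarrow> w t \<le> 2 * \<omega>"
  using width[of t] width_pos by (auto simp: w_def)

lemma pt_in: assumes "t \<in> {a..b}" "\<theta> \<in> {0..1}" shows "pt t \<theta> \<in> R"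
proof -
  have "0 \<le> \<theta> * w t" "\<theta> * w t \<le> 1 * w t"
    using w_bounds[OF assms(1)] assms by (auto intro!: mult_right_mono)
  then have "c \<le> f t + \<theta> * w t" "f t + \<theta> * w t \<le> d"
    using range[OF assms(1)] by (auto simp: w_def)
  then show ?thesis using assms by (auto simp: pt_def cbox_Pair_eq)
qed

lemma pt_ends: "pt t 0 = (t, f t)" "pt t 1 = (t, g t)"
  by (simp_all add: pt_def w_def)

lemma pt_in_domain: "t \<in> {a..b} \<Longrightarrow> \<theta> \<in> {0..1} \<Longrightarrow> pt t \<theta> \<in> \<Omega>"
  using pt_in rectangle by blast

lemma ends_in_domain: "t \<in> {a..b} \<Longrightarrow> (t, f t) \<in> \<Omega>" "t \<in> {a..b} \<Longrightarrow> (t, g t) \<in> \<Omega>"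
  using pt_in_domain[of t 0] pt_in_domain[of t 1] by (simp_all add: pt_ends)

lemma C_nonneg: "0 \<le> C" using lip lipschitz_on_nonneg by blast

lemma continuous_leaves: "continuous_on {a..b} f" "continuous_on {a..b} g"
  by (rule DERIV_continuous_on, erule leaf_f leaf_g)+

lemma continuous_pt: "continuous_on ({a..b} \<times> {0..1}) (\<lambda>(t, \<theta>). pt t \<theta>)"
  unfolding pt_def w_def case_prod_unfold
  by (intro continuous_intros continuous_on_compose2[OF continuous_leaves(1)] continuous_on_compose2[OF continuous_leaves(2)]) auto

lemma continuous_along:
  fixes F :: "plane \<Rightarrow> real"
  assumes "continuous_on R F" shows "continuous_on ({a..b} \<times> {0..1}) (\<lambda>(t, \<theta>). F (pt t \<theta>))"
  using continuous_on_compose2[OF assms continuous_pt] pt_in by (auto simp: case_prod_unfold image_subset_iff)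

lemma continuous_slice:
  fixes F :: "plane \<Rightarrow> real"
  assumes "continuous_on R F" "t \<in> {a..b}" shows "continuous_on {0..1} (\<lambda>\<theta>. F (pt t \<theta>))"
proof -
  have "continuous_on {0..1} (\<lambda>\<theta>::real. (t, \<theta>))" by (intro continuous_intros)
  moreover have "(\<lambda>\<theta>. (t, \<theta>)) ` {0..1} \<subseteq> {a..b} \<times> {0..1}" using assms(2) by auto
  ultimately show ?thesis
    using continuous_on_compose2[OF continuous_along[OF assms(1)], of "{0..1}" "\<lambda>\<theta>. (t, \<theta>)"] by simp
qed

lemma integrable_slice:
  fixes F :: "plane \<Rightarrow> real"
  assumes "continuous_on R F" "t \<in> {a..b}" shows "(\<lambda>\<theta>. F (pt t \<theta>)) integrable_on {0..1}"
  by (rule integrable_continuous_interval[OF continuous_slice[OF assms]])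

lemma continuous_avg:
  assumes "continuous_on R F" shows "continuous_on {a..b} (avg F)"
  using integral_continuous_on_param[of "{a..b}" 0 1 "\<lambda>t \<theta>. F (pt t \<theta>)"] continuous_along[OF assms]
  by (simp add: avg_def[abs_def])

lemma w_deriv: "t \<in> {a..b} \<Longrightarrow> (w has_real_derivative u (t, g t) - u (t, f t)) (at t within {a..b})"
  unfolding w_def by (intro DERIV_diff leaf_f leaf_g)

lemma w_deriv_le: assumes t: "t \<in> {a..b}" shows "\<bar>u (t, g t) - u (t, f t)\<bar> \<le> C * w t"
  using lipschitz_onD[OF lip(1) ends_in_domain(2,1)[OF t]] w_bounds[OF t]
  by (auto simp: dist_Pair_Pair dist_real_def w_def)

text \<open>
  The speed in the second coordinate of the curve \<open>t \<mapsto> pt t \<theta>\<close> that divides the strip in a fixed ratio. It is close to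
  \<open>v\<close>, up to \<open>\<eta>\<close> on the two leaves that bound the strip and up to \<open>\<eta> + 4 C \<omega>\<close> between them.
\<close>

definition drift where "drift t \<theta> = u (t, f t) + \<theta> * (u (t, g t) - u (t, f t))"

abbreviation "rate F t \<theta> \<equiv> pd1 F (pt t \<theta>) + drift t \<theta> * pd2 F (pt t \<theta>)"

lemma pt_deriv_time:
  assumes "Ck_on 1 \<Omega> F" "t \<in> {a..b}" "\<theta> \<in> {0..1}"
  shows "((\<lambda>t. F (pt t \<theta>)) has_real_derivative rate F t \<theta>) (at t within {a..b})"
proof -
  have "((\<lambda>t. f t + \<theta> * w t) has_real_derivative drift t \<theta>) (at t within {a..b})"
    unfolding drift_def by (intro DERIV_add DERIV_cmult leaf_f w_deriv assms)
  from Ck_on_chain[OF assms(1)[unfolded One_nat_def] pt_in_domain[OF assms(2,3), unfolded pt_def] DERIV_ident this]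
  show ?thesis by (simp add: pt_def mult.commute)
qed

lemma pt_deriv_transversal:
  assumes "Ck_on 1 \<Omega> F" "t \<in> {a..b}" "\<theta> \<in> {0..1}"
  shows "((\<lambda>\<theta>. F (pt t \<theta>)) has_real_derivative w t * pd2 F (pt t \<theta>)) (at \<theta> within {0..1})"
proof -
  have "((\<lambda>\<theta>. f t + \<theta> * w t) has_real_derivative w t) (at \<theta> within {0..1})"
    by (auto intro!: derivative_eq_intros)
  from Ck_on_chain[OF assms(1)[unfolded One_nat_def] pt_in_domain[OF assms(2,3), unfolded pt_def] DERIV_const this]
  show ?thesis by (simp add: pt_def mult.commute)
qed

lemma continuous_on_R: "Ck_on 1 \<Omega> F \<Longrightarrow> continuous_on R F" "Ck_on 1 \<Omega> F \<Longrightarrow> continuous_on R (pd1 F)"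
  "Ck_on 1 \<Omega> F \<Longrightarrow> continuous_on R (pd2 F)"
  by (rule continuous_on_subset[OF _ rectangle], erule Ck_on_1_continuous Ck_on_1_continuous_partials)+

lemma continuous_drift: "continuous_on ({a..b} \<times> {0..1}) (\<lambda>(t, \<theta>). drift t \<theta>)"
proof -
  have u: "continuous_on R u"
    using lipschitz_on_continuous_on[OF lip(1)] rectangle continuous_on_subset by blast
  have "continuous_on {a..b} (\<lambda>t. u (pt t 0))" "continuous_on {a..b} (\<lambda>t. u (pt t 1))"
  proof -
    have "continuous_on {a..b} (\<lambda>t::real. (t, x))" for x :: real by (intro continuous_intros)
    moreover have "(\<lambda>t. (t, x)) ` {a..b} \<subseteq> {a..b} \<times> {0..1}" if "x \<in> {0..1}" for x :: real using that by auto
    ultimately have "continuous_on {a..b} (\<lambda>t. u (pt t x))" if "x \<in> {0..1}" for x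
      using continuous_on_compose2[OF continuous_along[OF u], of "{a..b}" "\<lambda>t. (t, x)"] that by simp
    from this[of 0] this[of 1]
    show "continuous_on {a..b} (\<lambda>t. u (pt t 0))" "continuous_on {a..b} (\<lambda>t. u (pt t 1))"
      by simp_all
  qed
  then have c: "continuous_on {a..b} (\<lambda>t. u (t, f t))" "continuous_on {a..b} (\<lambda>t. u (t, g t))"
    by (simp_all add: pt_ends)
  show ?thesis
    unfolding drift_def case_prod_unfold
    by (intro continuous_intros continuous_on_compose2[OF c(1)] continuous_on_compose2[OF c(2)]) auto
qed

lemma avg_deriv:
  assumes F: "Ck_on 1 \<Omega> F" and t: "t \<in> {a..b}"
  shows "(avg F has_real_derivative integral {0..1} (\<lambda>\<theta>. rate F t \<theta>))
    (at t within {a..b})"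
proof -
  have "((\<lambda>t. integral (cbox 0 1) (\<lambda>\<theta>. F (pt t \<theta>))) has_field_derivative
      integral (cbox 0 1) (\<lambda>\<theta>. rate F t \<theta>)) (at t within {a..b})"
  proof (rule leibniz_rule_field_derivative)
    show "((\<lambda>t. F (pt t \<theta>)) has_real_derivative rate F t \<theta>) (at t within {a..b})"
      if "t \<in> {a..b}" "\<theta> \<in> cbox 0 1" for t \<theta>
      using pt_deriv_time[OF F] that by simp
    show "(\<lambda>\<theta>. F (pt t \<theta>)) integrable_on cbox 0 1" if "t \<in> {a..b}" for t
      using integrable_slice[OF continuous_on_R(1)[OF F] that] by simp
    show "continuous_on ({a..b} \<times> cbox 0 1) (\<lambda>(t, \<theta>). rate F t \<theta>)"
      using continuous_along[OF continuous_on_R(2)[OF F]] continuous_along[OF continuous_on_R(3)[OF F]] continuous_drift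
      by (auto simp: case_prod_unfold intro!: continuous_intros)
  qed (use t in auto)
  then show ?thesis by (simp add: avg_def[abs_def])
qed

text \<open>
  The integral of \<open>e\<close> over time is what becomes small by the convergence of the slopes.
\<close>

definition e where "e = avg (\<lambda>x. \<bar>X1 v v x - r x\<bar>)"

definition E where "E = integral {a..b} e"

lemma continuous_slope: "continuous_on R (X1 v v)"
  by (intro continuous_on_R C1_slope smooth)

lemma continuous_e: "continuous_on {a..b} e"
  unfolding e_def by (intro continuous_avg continuous_intros continuous_slope ref_cont)

lemma slope_near_ref:
  assumes t: "t \<in> {a..b}"
  shows "integral {0..1} (\<lambda>\<theta>. \<bar>X1 v v (pt t \<theta>) - r (t, f t)\<bar>) \<le> e t + \<mu>"
proof -
  have "integral {0..1} (\<lambda>\<theta>. \<bar>X1 v v (pt t \<theta>) - r (t, f t)\<bar>)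
      \<le> integral {0..1} (\<lambda>\<theta>. \<bar>X1 v v (pt t \<theta>) - r (pt t \<theta>)\<bar> + \<mu>)"
  proof (rule integral_le)
    show "\<bar>X1 v v (pt t \<theta>) - r (t, f t)\<bar> \<le> \<bar>X1 v v (pt t \<theta>) - r (pt t \<theta>)\<bar> + \<mu>" if \<theta>: "\<theta> \<in> {0..1}" for \<theta>
    proof -
      have "\<bar>\<theta> * w t\<bar> \<le> 1 * (2 * \<omega>)"
        unfolding abs_mult using w_bounds[OF t] \<theta> by (intro mult_mono) auto
      then have "\<bar>r (pt t \<theta>) - r (t, f t)\<bar> \<le> \<mu>"
        using ref_osc[of t "f t + \<theta> * w t" "f t"] pt_in[OF t \<theta>] pt_in[OF t, of 0]
        by (simp add: pt_def)
      then show ?thesis by linarith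
    qed
  qed (intro integrable_slice[where F = "\<lambda>x. \<bar>X1 v v x - r (t, f t)\<bar>"]
        integrable_slice[where F = "\<lambda>x. \<bar>X1 v v x - r x\<bar> + \<mu>"] continuous_intros continuous_slope ref_cont t)+
  also have "\<dots> = e t + \<mu>"
  proof -
    have "(\<lambda>\<theta>. \<bar>X1 v v (pt t \<theta>) - r (pt t \<theta>)\<bar>) integrable_on {0..1}"
      by (intro integrable_slice[where F = "\<lambda>x. \<bar>X1 v v x - r x\<bar>"] continuous_intros continuous_slope ref_cont t)
    then show ?thesis by (simp only: integral_unit_add_const e_def avg_def)
  qed
  finally show ?thesis .
qed

lemma flux_near_ref:
  assumes t: "t \<in> {a..b}"
  shows "integral {0..1} (\<lambda>\<theta>. \<bar>flux1 \<epsilon> v (pt t \<theta>) - limit_flux (r (t, f t))\<bar>) \<le> e t + \<mu> + \<eta>"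
proof -
  note fl = continuous_on_R(1)[OF C1_flux(1)[OF smooth]]
  have "integral {0..1} (\<lambda>\<theta>. \<bar>flux1 \<epsilon> v (pt t \<theta>) - limit_flux (r (t, f t))\<bar>)
      \<le> integral {0..1} (\<lambda>\<theta>. \<bar>X1 v v (pt t \<theta>) - r (t, f t)\<bar> + \<eta>)"
  proof (rule integral_le)
    show "\<bar>flux1 \<epsilon> v (pt t \<theta>) - limit_flux (r (t, f t))\<bar> \<le> \<bar>X1 v v (pt t \<theta>) - r (t, f t)\<bar> + \<eta>"
      if \<theta>: "\<theta> \<in> {0..1}" for \<theta>
    proof -
      have "\<bar>pd2 v (pt t \<theta>)\<bar> \<le> C"
        using lipschitz_on_partials_le(2)[OF open_domain lip(2) smooth_on_plane_Ck_1(1)[OF smooth]] pt_in[OF t \<theta>] rectangle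
        by blast
      then have "\<bar>\<epsilon> * pd2 v (pt t \<theta>)\<bar> \<le> \<eta>"
        using eps mult_left_mono[of "\<bar>pd2 v (pt t \<theta>)\<bar>" C \<epsilon>] by (simp add: abs_mult)
      then show ?thesis
        using abs_flux_le(4)[of \<epsilon> v "pt t \<theta>"] limit_flux_nonexpansive[of "X1 v v (pt t \<theta>)" "r (t, f t)"]
        by linarith
    qed
  qed (intro integrable_slice[where F = "\<lambda>x. \<bar>X1 v v x - r (t, f t)\<bar> + \<eta>"]
        integrable_slice[where F = "\<lambda>x. \<bar>flux1 \<epsilon> v x - limit_flux (r (t, f t))\<bar>"] continuous_intros continuous_slope fl t)+
  also have "\<dots> = integral {0..1} (\<lambda>\<theta>. \<bar>X1 v v (pt t \<theta>) - r (t, f t)\<bar>) + \<eta>"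
  proof -
    have "(\<lambda>\<theta>. \<bar>X1 v v (pt t \<theta>) - r (t, f t)\<bar>) integrable_on {0..1}"
      by (intro integrable_slice[where F = "\<lambda>x. \<bar>X1 v v x - r (t, f t)\<bar>"] continuous_intros continuous_slope t)
    then show ?thesis by (rule integral_unit_add_const)
  qed
  finally show ?thesis using slope_near_ref[OF t] by linarith
qed

lemma eta_nonneg: "t \<in> {a..b} \<Longrightarrow> 0 \<le> \<eta>"
  using close[OF pt_in[of t 0]] by simp

lemma abs_pd2_le: assumes "t \<in> {a..b}" "\<theta> \<in> {0..1}" shows "\<bar>pd2 v (pt t \<theta>)\<bar> \<le> C"
  using lipschitz_on_partials_le(2)[OF open_domain lip(2) smooth_on_plane_Ck_1(1)[OF smooth] pt_in_domain[OF assms]] .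

lemma drift_ends:
  assumes t: "t \<in> {a..b}"
  shows "\<bar>drift t 0 - v (pt t 0)\<bar> \<le> \<eta>" "\<bar>drift t 1 - v (pt t 1)\<bar> \<le> \<eta>"
  using close[OF pt_in[OF t, of 0]] close[OF pt_in[OF t, of 1]]
  by (auto simp: drift_def pt_ends)

lemma oscillation_transversal:
  assumes t: "t \<in> {a..b}" and \<theta>: "\<theta> \<in> {0..1}"
  shows "\<bar>v (pt t \<theta>) - v (pt t 0)\<bar> \<le> C * (2 * \<omega>)"
proof -
  have "\<theta> * w t \<le> 1 * (2 * \<omega>)" "0 \<le> \<theta> * w t"
    using w_bounds[OF t] \<theta> mult_mono[of \<theta> 1 "w t" "2 * \<omega>"] by auto
  then have "dist (pt t \<theta>) (pt t 0) \<le> 2 * \<omega>"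
    by (simp add: pt_def dist_Pair_Pair dist_real_def)
  then have "C * dist (pt t \<theta>) (pt t 0) \<le> C * (2 * \<omega>)"
    using C_nonneg by (intro mult_left_mono) auto
  moreover have "\<bar>v (pt t \<theta>) - v (pt t 0)\<bar> \<le> C * dist (pt t \<theta>) (pt t 0)"
    using lipschitz_onD[OF lip(2) pt_in_domain[OF t \<theta>] pt_in_domain[OF t, of 0]] by (simp add: dist_real_def)
  ultimately show ?thesis by linarith
qed

lemma drift_close:
  assumes t: "t \<in> {a..b}" and \<theta>: "\<theta> \<in> {0..1}"
  shows "\<bar>drift t \<theta> - v (pt t \<theta>)\<bar> \<le> \<eta> + 4 * C * \<omega>"
proof -
  have "\<bar>\<theta> * (u (t, g t) - u (t, f t))\<bar> \<le> 1 * (C * w t)"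
    unfolding abs_mult using \<theta> w_deriv_le[OF t] by (intro mult_mono) auto
  also have "\<dots> \<le> C * (2 * \<omega>)"
    using w_bounds[OF t] C_nonneg by (simp add: mult_left_mono)
  finally have "\<bar>drift t \<theta> - drift t 0\<bar> \<le> C * (2 * \<omega>)" by (simp add: drift_def)
  with oscillation_transversal[OF t \<theta>] drift_ends(1)[OF t] show ?thesis by linarith
qed

lemma continuous_drift_slice: "t \<in> {a..b} \<Longrightarrow> continuous_on {0..1} (drift t)"
  unfolding drift_def[abs_def] by (intro continuous_intros)

text \<open>
  The conservation law for the strip. After multiplication by the width, the equation turns the derivative of
  the average of \<open>A\<close> into a total \<open>\<theta>\<close>-derivative \<open>H'\<close> minus \<open>N\<close>. Subtracting the constant \<open>\<kappa>\<close> from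
  \<open>A\<close> in both does not change \<open>H' - N\<close>, and it makes \<open>N\<close> comparable to the oscillation of \<open>A\<close> times the width. The
  boundary terms are of order \<open>\<eta>\<close>: the bounding curves are leaves of \<open>u\<close>, \<open>v\<close> is \<open>\<eta>\<close>-close to \<open>u\<close>, and
  \<open>\<bar>\<epsilon> B\<bar> \<le> \<eta>\<close>.
\<close>

lemma avg_flux_deriv_le:
  assumes t: "t \<in> {a..b}"
  shows "\<bar>integral {0..1} (\<lambda>\<theta>. rate (flux1 \<epsilon> v) t \<theta>)\<bar>
    \<le> 2 * C * (e t + \<mu> + \<eta>) + 12 * \<eta> / \<omega>"
proof -
  let ?A = "flux1 \<epsilon> v" and ?B = "flux2 \<epsilon> v" and ?\<kappa> = "limit_flux (r (t, f t))"
  let ?W = "u (t, g t) - u (t, f t)"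
  define D where "D = integral {0..1} (\<lambda>\<theta>. rate ?A t \<theta>)"
  define H where "H \<theta> = (drift t \<theta> - v (pt t \<theta>)) * (?A (pt t \<theta>) - ?\<kappa>) - \<epsilon> * ?B (pt t \<theta>)" for \<theta>
  define N where "N \<theta> = (?W - w t * pd2 v (pt t \<theta>)) * (?A (pt t \<theta>) - ?\<kappa>)" for \<theta>
  note C1 = smooth_on_plane_Ck_1(1)[OF smooth] C1_flux[OF smooth, of \<epsilon>]
  note cont = continuous_slice[OF continuous_on_R(1)[OF C1(1)] t] continuous_slice[OF continuous_on_R(1)[OF C1(2)] t]
    continuous_slice[OF continuous_on_R(2)[OF C1(2)] t] continuous_slice[OF continuous_on_R(3)[OF C1(1)] t]
    continuous_slice[OF continuous_on_R(3)[OF C1(2)] t] continuous_drift_slice[OF t]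
  have Nc: "continuous_on {0..1} N"
    unfolding N_def by (intro continuous_intros cont)
  have w0: "0 < w t" and w1: "\<omega> / 2 \<le> w t" using w_bounds[OF t] by auto
  have I1: "((\<lambda>\<theta>. w t * (rate ?A t \<theta>) + N \<theta>) has_integral (H 1 - H 0)) {0..1}"
  proof (rule fundamental_theorem_of_calculus)
    fix \<theta> :: real assume \<theta>: "\<theta> \<in> {0..1}"
    have "(drift t has_real_derivative ?W) (at \<theta> within {0..1})"
      unfolding drift_def[abs_def] by (auto intro!: derivative_eq_intros)
    then have "(H has_real_derivative
        (drift t \<theta> - v (pt t \<theta>)) * (w t * pd2 ?A (pt t \<theta>) - 0)
          + (?W - w t * pd2 v (pt t \<theta>)) * (?A (pt t \<theta>) - ?\<kappa>)
        - \<epsilon> * (w t * pd2 ?B (pt t \<theta>))) (at \<theta> within {0..1})"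
      unfolding H_def
      by (intro DERIV_diff DERIV_mult' DERIV_cmult DERIV_const pt_deriv_transversal C1 t \<theta>)
    moreover have E: "pd1 ?A (pt t \<theta>) = - v (pt t \<theta>) * pd2 ?A (pt t \<theta>) - \<epsilon> * pd2 ?B (pt t \<theta>)"
      using minimal_graph_flux_equation[OF minimal pt_in_domain[OF t \<theta>]] by simp
    have "(drift t \<theta> - v (pt t \<theta>)) * (w t * pd2 ?A (pt t \<theta>) - 0)
          + (?W - w t * pd2 v (pt t \<theta>)) * (?A (pt t \<theta>) - ?\<kappa>)
        - \<epsilon> * (w t * pd2 ?B (pt t \<theta>)) = w t * (rate ?A t \<theta>) + N \<theta>"
      unfolding N_def E by (simp add: algebra_simps)
    ultimately show "(H has_vector_derivative w t * (rate ?A t \<theta>) + N \<theta>)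
        (at \<theta> within {0..1})"
      by (simp add: has_real_derivative_iff_has_vector_derivative)
  qed simp
  have I2: "((\<lambda>\<theta>. w t * (rate ?A t \<theta>) + N \<theta>) has_integral
      (w t * D + integral {0..1} N)) {0..1}"
    unfolding D_def using Nc cont
    by (intro has_integral_add has_integral_mult_right integrable_integral integrable_continuous_interval continuous_intros)
  have D: "w t * D = H 1 - H 0 - integral {0..1} N"
    using has_integral_unique[OF I1 I2] by linarith
  have A2: "\<bar>?A x - ?\<kappa>\<bar> \<le> 2" for x
    using abs_flux_le(1)[of \<epsilon> v x] abs_limit_flux_le_1[of "r (t, f t)"] by linarith
  have B: "\<bar>\<epsilon> * ?B (pt t \<theta>)\<bar> \<le> \<eta>" if \<theta>: "\<theta> \<in> {0..1}" for \<theta>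
  proof -
    have "\<bar>?B (pt t \<theta>)\<bar> \<le> \<bar>\<epsilon> * pd2 v (pt t \<theta>)\<bar>" by (rule abs_flux_le)
    also have "\<dots> \<le> \<epsilon> * C"
      unfolding abs_mult using abs_pd2_le[OF t \<theta>] eps by (simp add: mult_left_mono)
    also have "\<dots> \<le> \<eta>" by (rule eps)
    finally have "\<epsilon> * \<bar>?B (pt t \<theta>)\<bar> \<le> 1 * \<eta>"
      using eps eta_nonneg[OF t] by (intro mult_mono) auto
    then show ?thesis using eps by (simp add: abs_mult)
  qed
  have Hb: "\<bar>H \<theta>\<bar> \<le> 3 * \<eta>" if "\<theta> \<in> {0..1}" "\<bar>drift t \<theta> - v (pt t \<theta>)\<bar> \<le> \<eta>" for \<theta>
  proof -
    have "\<bar>(drift t \<theta> - v (pt t \<theta>)) * (?A (pt t \<theta>) - ?\<kappa>)\<bar> \<le> \<eta> * 2"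
      unfolding abs_mult using that A2[of "pt t \<theta>"] eta_nonneg[OF t] by (intro mult_mono) auto
    with B[OF that(1)] show ?thesis unfolding H_def by linarith
  qed
  have H: "\<bar>H 0\<bar> \<le> 3 * \<eta>" "\<bar>H 1\<bar> \<le> 3 * \<eta>"
    using Hb[of 0] Hb[of 1] drift_ends[OF t] by auto
  have "norm (integral {0..1} N) \<le> integral {0..1} (\<lambda>\<theta>. (2 * C * w t) * \<bar>?A (pt t \<theta>) - ?\<kappa>\<bar>)"
  proof (rule integral_norm_bound_integral)
    show "N integrable_on {0..1}" using Nc by (rule integrable_continuous_interval)
    show "(\<lambda>\<theta>. (2 * C * w t) * \<bar>?A (pt t \<theta>) - ?\<kappa>\<bar>) integrable_on {0..1}"
      by (intro integrable_continuous_interval continuous_intros cont)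
    fix \<theta> :: real assume \<theta>: "\<theta> \<in> {0..1}"
    have "\<bar>w t * pd2 v (pt t \<theta>)\<bar> \<le> w t * C"
      unfolding abs_mult using abs_pd2_le[OF t \<theta>] w0 by (simp add: mult_left_mono)
    then have "\<bar>?W - w t * pd2 v (pt t \<theta>)\<bar> \<le> 2 * C * w t"
      using w_deriv_le[OF t] mult.commute[of "w t" C] by linarith
    then show "norm (N \<theta>) \<le> (2 * C * w t) * \<bar>?A (pt t \<theta>) - ?\<kappa>\<bar>"
      unfolding N_def real_norm_def abs_mult by (rule mult_right_mono) simp
  qed
  also have "\<dots> = (2 * C * w t) * integral {0..1} (\<lambda>\<theta>. \<bar>?A (pt t \<theta>) - ?\<kappa>\<bar>)"
    by (rule integral_mult_right)
  also have "\<dots> \<le> (2 * C * w t) * (e t + \<mu> + \<eta>)"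
    using flux_near_ref[OF t] C_nonneg w0 by (intro mult_left_mono) auto
  finally have Nb: "\<bar>integral {0..1} N\<bar> \<le> (2 * C * w t) * (e t + \<mu> + \<eta>)" by simp
  have "w t * \<bar>D\<bar> = \<bar>w t * D\<bar>" using w0 by (simp add: abs_mult)
  also have "\<dots> \<le> 6 * \<eta> + (2 * C * w t) * (e t + \<mu> + \<eta>)"
    unfolding D using H Nb by linarith
  also have "\<dots> \<le> w t * (12 * \<eta> / \<omega>) + (2 * C * w t) * (e t + \<mu> + \<eta>)"
    using mult_right_mono[OF w1, of "12 * \<eta> / \<omega>"] eta_nonneg[OF t] width_pos by simp
  also have "\<dots> = w t * (2 * C * (e t + \<mu> + \<eta>) + 12 * \<eta> / \<omega>)"
    by (simp add: algebra_simps)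
  finally show ?thesis
    using w0 by (simp add: D_def)
qed

text \<open>
  The total variation in time that \<open>avg_flux_deriv_le\<close> permits to the average flux.
\<close>

definition \<Delta> where "\<Delta> = 2 * C * (E + (b - a) * (\<mu> + \<eta>)) + (b - a) * (12 * \<eta> / \<omega>)"

lemma has_integral_e: "(e has_integral E) {a..b}"
  unfolding E_def by (intro integrable_integral integrable_continuous_interval continuous_e)

lemma avg_flux_variation:
  assumes st: "s \<in> {a..b}" "t \<in> {a..b}"
  shows "\<bar>avg (flux1 \<epsilon> v) t - avg (flux1 \<epsilon> v) s\<bar> \<le> \<Delta>"
proof -
  let ?G = "\<lambda>t. 2 * C * e t + (2 * C * (\<mu> + \<eta>) + 12 * \<eta> / \<omega>)"
  have ab: "a \<le> b" using st by auto
  have "\<bar>avg (flux1 \<epsilon> v) t - avg (flux1 \<epsilon> v) s\<bar> \<le> integral {a..b} ?G"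
  proof (rule abs_diff_le_integral_of_derivative_bound[OF avg_deriv[OF C1_flux(1)[OF smooth]]])
    show "continuous_on {a..b} ?G" by (intro continuous_intros continuous_e)
  qed (use avg_flux_deriv_le st in \<open>auto simp: algebra_simps\<close>)
  also have "(?G has_integral (2 * C * E + (2 * C * (\<mu> + \<eta>) + 12 * \<eta> / \<omega>) * (b - a))) {a..b}"
    using has_integral_const_real[of "2 * C * (\<mu> + \<eta>) + 12 * \<eta> / \<omega>" a b] ab
    by (intro has_integral_add has_integral_mult_right has_integral_e) (simp add: mult.commute)
  then have "integral {a..b} ?G = \<Delta>"
    by (simp add: integral_unique \<Delta>_def algebra_simps)
  finally show ?thesis .
qed

lemma exists_slope_of_avg_flux:
  assumes t: "t \<in> {a..b}"
  shows "\<exists>q. \<bar>q\<bar> \<le> P \<and> limit_flux q = avg (flux1 \<epsilon> v) t"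
proof -
  have P0: "0 \<le> P" using slope_le[OF pt_in[OF t, of 0]] by simp
  have "\<bar>flux1 \<epsilon> v (pt t \<theta>)\<bar> \<le> limit_flux P" if "\<theta> \<in> {0..1}" for \<theta>
    using abs_flux_le(2)[of \<epsilon> v "pt t \<theta>"] abs_limit_flux_mono[OF slope_le[OF pt_in[OF t that]]] by linarith
  then have "\<bar>avg (flux1 \<epsilon> v) t\<bar> \<le> limit_flux P * (1 - 0)"
    unfolding avg_def using P0
    by (intro abs_integral_interval_le continuous_slice[OF continuous_on_R(1)[OF C1_flux(1)[OF smooth]] t])
       (auto simp: limit_flux_def)
  then have "limit_flux (- P) \<le> avg (flux1 \<epsilon> v) t" "avg (flux1 \<epsilon> v) t \<le> limit_flux P"
    by (auto simp: limit_flux_def)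
  moreover have "continuous_on {-P..P} limit_flux"
    by (rule DERIV_continuous_on[OF limit_flux_deriv])
  ultimately obtain q where "- P \<le> q" "q \<le> P" "limit_flux q = avg (flux1 \<epsilon> v) t"
    using IVT'[of limit_flux "- P" "avg (flux1 \<epsilon> v) t" P] P0 by auto
  then show ?thesis by (intro exI[of _ q]) auto
qed

lemma avg_slope_near:
  assumes t: "t \<in> {a..b}" and s: "s \<in> {a..b}" and q: "\<bar>q\<bar> \<le> P" "limit_flux q = avg (flux1 \<epsilon> v) s"
  shows "\<bar>avg (X1 v v) t - q\<bar> \<le> (e t + \<mu>) + sqrt (1 + P\<^sup>2) ^ 3 * (e t + \<mu> + \<eta> + \<Delta>)"
proof -
  let ?p = "r (t, f t)"
  have diff: "\<bar>avg F t - k\<bar> \<le> integral {0..1} (\<lambda>\<theta>. \<bar>F (pt t \<theta>) - k\<bar>)" if F: "continuous_on R F" for F k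
  proof -
    note c = continuous_slice[OF F t]
    have "((\<lambda>\<theta>. F (pt t \<theta>) - k) has_integral avg F t - k) {0..1}"
      unfolding avg_def using has_integral_const_real[of k 0 1]
      by (intro has_integral_diff integrable_integral integrable_continuous_interval c) simp
    then have "avg F t - k = integral {0..1} (\<lambda>\<theta>. F (pt t \<theta>) - k)"
      by (simp add: integral_unique)
    also have "norm \<dots> \<le> integral {0..1} (\<lambda>\<theta>. \<bar>F (pt t \<theta>) - k\<bar>)"
      by (intro integral_norm_bound_integral integrable_continuous_interval continuous_intros c) auto
    finally show ?thesis by simp
  qed
  have "\<bar>avg (flux1 \<epsilon> v) t - limit_flux ?p\<bar> \<le> e t + \<mu> + \<eta>"
    using diff[OF continuous_on_R(1)[OF C1_flux(1)[OF smooth]], of \<epsilon> "limit_flux ?p"] flux_near_ref[OF t] by linarith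
  then have "\<bar>limit_flux ?p - limit_flux q\<bar> \<le> e t + \<mu> + \<eta> + \<Delta>"
    using avg_flux_variation[OF s t] unfolding q(2) by linarith
  then have "sqrt (1 + P\<^sup>2) ^ 3 * \<bar>limit_flux ?p - limit_flux q\<bar> \<le> sqrt (1 + P\<^sup>2) ^ 3 * (e t + \<mu> + \<eta> + \<Delta>)"
    by (intro mult_left_mono) auto
  moreover have "\<bar>?p - q\<bar> \<le> sqrt (1 + P\<^sup>2) ^ 3 * \<bar>limit_flux ?p - limit_flux q\<bar>"
    using ref_le[OF pt_in[OF t, of 0]] q(1) by (intro limit_flux_expansive) (auto simp: pt_ends)
  moreover have "\<bar>avg (X1 v v) t - ?p\<bar> \<le> e t + \<mu>"
    using diff[OF continuous_slope, of ?p] slope_near_ref[OF t] by linarith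
  ultimately show ?thesis by linarith
qed

text \<open>
  The common slope \<open>q\<close> is determined by \<open>a(q) = m(s)\<close>, where \<open>m\<close> is the average flux at the base time. Since \<open>m\<close>
  hardly varies and \<open>a\<close> is expansive, the average of the slope stays close to \<open>q\<close>; it is the time
  derivative of the average of \<open>v\<close>, up to the difference between the drift and \<open>v\<close>.
\<close>

theorem leaf_almost_affine:
  assumes s: "s \<in> {a..b}"
  defines "L \<equiv> sqrt (1 + P\<^sup>2) ^ 3"
  shows "\<exists>q. \<forall>t\<in>{a..b}. \<bar>u (t, f t) - u (s, f s) - q * (t - s)\<bar>
    \<le> (1 + L) * (E + \<mu> * (b - a)) + (b - a) * (L * (\<eta> + \<Delta>) + C * (\<eta> + 4 * C * \<omega>)) + 2 * (\<eta> + 2 * C * \<omega>)"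
proof -
  obtain q where q: "\<bar>q\<bar> \<le> P" "limit_flux q = avg (flux1 \<epsilon> v) s"
    using exists_slope_of_avg_flux[OF s] by blast
  note C1 = smooth_on_plane_Ck_1(1)[OF smooth]
  let ?G = "\<lambda>t. (1 + L) * e t + ((1 + L) * \<mu> + L * (\<eta> + \<Delta>) + C * (\<eta> + 4 * C * \<omega>))"
  have ab: "a \<le> b" using s by auto
  have deriv: "((\<lambda>t. avg v t - q * t) has_real_derivative
      integral {0..1} (\<lambda>\<theta>. rate v t \<theta>) - q) (at t within {a..b})"
    if "t \<in> {a..b}" for t
    by (intro DERIV_diff avg_deriv C1 that) (auto intro!: derivative_eq_intros)
  have bound: "\<bar>integral {0..1} (\<lambda>\<theta>. rate v t \<theta>) - q\<bar> \<le> ?G t"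
    if t: "t \<in> {a..b}" for t
  proof -
    let ?N = "\<lambda>\<theta>. (drift t \<theta> - v (pt t \<theta>)) * pd2 v (pt t \<theta>)"
    have c: "continuous_on {0..1} ?N"
      by (intro continuous_intros continuous_drift_slice continuous_slice continuous_on_R C1 t)
    have "((\<lambda>\<theta>. X1 v v (pt t \<theta>) + ?N \<theta>) has_integral avg (X1 v v) t + integral {0..1} ?N) {0..1}"
      unfolding avg_def using c
      by (intro has_integral_add integrable_integral integrable_slice continuous_slope integrable_continuous_interval t)
    moreover have "X1 v v (pt t \<theta>) + ?N \<theta> = rate v t \<theta>" for \<theta>
      by (simp add: X1_def algebra_simps)
    ultimately have eq: "integral {0..1} (\<lambda>\<theta>. rate v t \<theta>)
        = avg (X1 v v) t + integral {0..1} ?N"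
      by (simp add: integral_unique)
    have "0 \<le> \<eta> + 4 * C * \<omega>" using eta_nonneg[OF t] C_nonneg width_pos by simp
    then have "\<bar>integral {0..1} ?N\<bar> \<le> ((\<eta> + 4 * C * \<omega>) * C) * (1 - 0)"
      using drift_close[OF t] abs_pd2_le[OF t] C_nonneg
      by (intro abs_integral_interval_le c) (auto simp: abs_mult intro!: mult_mono)
    with avg_slope_near[OF t s q] show ?thesis
      unfolding eq L_def[symmetric] by (simp add: algebra_simps)
  qed
  have G: "(?G has_integral (1 + L) * E + ((1 + L) * \<mu> + L * (\<eta> + \<Delta>) + C * (\<eta> + 4 * C * \<omega>)) * (b - a)) {a..b}"
    using has_integral_const_real[of "(1 + L) * \<mu> + L * (\<eta> + \<Delta>) + C * (\<eta> + 4 * C * \<omega>)" a b] ab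
    by (intro has_integral_add has_integral_mult_right has_integral_e) (simp add: mult.commute)
  have near: "\<bar>avg v t - u (t, f t)\<bar> \<le> \<eta> + 2 * C * \<omega>" if t: "t \<in> {a..b}" for t
  proof -
    note c = continuous_slice[OF continuous_on_R(1)[OF C1] t]
    have "((\<lambda>\<theta>. v (pt t \<theta>) - v (pt t 0)) has_integral avg v t - v (pt t 0)) {0..1}"
      unfolding avg_def using has_integral_const_real[of "v (pt t 0)" 0 1]
      by (intro has_integral_diff integrable_integral integrable_continuous_interval c) simp
    then have "avg v t - v (pt t 0) = integral {0..1} (\<lambda>\<theta>. v (pt t \<theta>) - v (pt t 0))"
      by (simp add: integral_unique)
    also have "\<bar>\<dots>\<bar> \<le> (C * (2 * \<omega>)) * (1 - 0)"
      using oscillation_transversal[OF t] C_nonneg width_pos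
      by (intro abs_integral_interval_le continuous_intros c) auto
    finally show ?thesis
      using close[OF pt_in[OF t, of 0]] by (simp add: pt_ends)
  qed
  show ?thesis
  proof (intro exI[of _ q] ballI)
    fix t assume t: "t \<in> {a..b}"
    have "\<bar>(avg v t - q * t) - (avg v s - q * s)\<bar> \<le> integral {a..b} ?G"
      by (rule abs_diff_le_integral_of_derivative_bound[OF deriv _ bound s t])
         (auto intro!: continuous_intros continuous_e)
    also have "\<dots> = (1 + L) * (E + \<mu> * (b - a)) + (b - a) * (L * (\<eta> + \<Delta>) + C * (\<eta> + 4 * C * \<omega>))" (is "_ = ?K")
      unfolding integral_unique[OF G] by (simp add: algebra_simps)
    finally have "\<bar>(avg v t - q * t) - (avg v s - q * s)\<bar> \<le> ?K" .
    moreover have "\<bar>x - y - (X - Y)\<bar> \<le> K + 2 * n"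
      if "\<bar>(A - X) - (B - Y)\<bar> \<le> K" "\<bar>A - x\<bar> \<le> n" "\<bar>B - y\<bar> \<le> n" for A B x y X Y K n :: real
      using that by linarith
    ultimately have "\<bar>u (t, f t) - u (s, f s) - (q * t - q * s)\<bar> \<le> ?K + 2 * (\<eta> + 2 * C * \<omega>)"
      using near[OF t] near[OF s] by blast
    then show "\<bar>u (t, f t) - u (s, f s) - q * (t - s)\<bar>
      \<le> ?K + 2 * (\<eta> + 2 * C * \<omega>)"
      by (simp only: right_diff_distrib)
  qed
qed

end

section \<open>The flow of a Lipschitz field\<close>

text \<open>
  Both bounds hold because \<open>D\<^sup>2 exp (- 2 C x)\<close> decreases and \<open>D\<^sup>2 exp (2 C x)\<close> increases. The second one shows
  that two solutions that differ at one time never meet.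
\<close>

lemma gronwall_interval:
  fixes D :: "real \<Rightarrow> real"
  assumes st: "s \<le> t"
    and deriv: "\<And>x. x \<in> {s..t} \<Longrightarrow> (D has_real_derivative D' x) (at x within {s..t})"
    and bound: "\<And>x. x \<in> {s..t} \<Longrightarrow> \<bar>D' x\<bar> \<le> C * \<bar>D x\<bar>"
  shows "\<bar>D t\<bar> \<le> exp (C * (t - s)) * \<bar>D s\<bar>" "\<bar>D s\<bar> \<le> exp (C * (t - s)) * \<bar>D t\<bar>"
proof -
  have deriv_at: "(D has_real_derivative D' x) (at x)" if "s < x" "x < t" for x
    using deriv[of x] that by (simp add: at_within_Icc_at)
  have cont: "continuous_on {s..t} D"
    by (rule DERIV_continuous_on[OF deriv])
  have sq: "D x * D' x \<le> C * (D x)\<^sup>2" "- (C * (D x)\<^sup>2) \<le> D x * D' x" if "s < x" "x < t" for x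
  proof -
    have "\<bar>D x\<bar> * \<bar>D' x\<bar> \<le> \<bar>D x\<bar> * (C * \<bar>D x\<bar>)"
      using bound[of x] that by (intro mult_left_mono) auto
    also have "\<dots> = C * (D x)\<^sup>2" by (simp add: power2_eq_square)
    finally have "\<bar>D x * D' x\<bar> \<le> C * (D x)\<^sup>2" by (simp only: abs_mult)
    then show "D x * D' x \<le> C * (D x)\<^sup>2" "- (C * (D x)\<^sup>2) \<le> D x * D' x" unfolding abs_le_iff by linarith+
  qed
  have E: "(exp (C * (t - s)))\<^sup>2 = exp (2 * C * t) * exp (- (2 * C * s))"
    by (simp add: power2_eq_square exp_add[symmetric] algebra_simps)
  show "\<bar>D t\<bar> \<le> exp (C * (t - s)) * \<bar>D s\<bar>"
  proof -
    have "(D t)\<^sup>2 * exp (- (2 * C * t)) \<le> (D s)\<^sup>2 * exp (- (2 * C * s))"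
    proof (cases "s = t")
      case False
      show ?thesis
      proof (rule DERIV_nonpos_imp_decreasing_open[where a = s and b = t and f = "\<lambda>x. (D x)\<^sup>2 * exp (- (2 * C * x))"])
        show "s \<le> t" by (rule st)
        fix x assume x: "s < x" "x < t"
        have "((\<lambda>x. (D x)\<^sup>2 * exp (- (2 * C * x))) has_real_derivative
            2 * (D x * D' x - C * (D x)\<^sup>2) * exp (- (2 * C * x))) (at x)"
          by (rule derivative_eq_intros deriv_at x refl)+ (simp add: algebra_simps power2_eq_square)
        moreover have "2 * (D x * D' x - C * (D x)\<^sup>2) \<le> 0"
          by (rule mult_nonneg_nonpos) (simp_all only: diff_le_0_iff_le sq[OF x] zero_le_numeral)
        then have "2 * (D x * D' x - C * (D x)\<^sup>2) * exp (- (2 * C * x)) \<le> 0"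
          by (rule mult_nonpos_nonneg) simp
        ultimately show "\<exists>y. ((\<lambda>x. (D x)\<^sup>2 * exp (- (2 * C * x))) has_real_derivative y) (at x) \<and> y \<le> 0"
          by blast
      qed (intro continuous_intros cont)
    qed simp
    from mult_right_mono[OF this, of "exp (2 * C * t)"]
    have "(D t)\<^sup>2 * (exp (- (2 * C * t)) * exp (2 * C * t)) \<le> (D s)\<^sup>2 * (exp (2 * C * t) * exp (- (2 * C * s)))"
      by (simp only: ac_simps zero_le_square exp_ge_zero)
    then have "(D t)\<^sup>2 \<le> (exp (C * (t - s)) * \<bar>D s\<bar>)\<^sup>2"
      by (simp add: power_mult_distrib E mult_exp_exp mult.commute)
    then show ?thesis
      by (intro power2_le_imp_le[of "\<bar>D t\<bar>"]) simp_all
  qed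
  show "\<bar>D s\<bar> \<le> exp (C * (t - s)) * \<bar>D t\<bar>"
  proof -
    have "(D s)\<^sup>2 * exp (2 * C * s) \<le> (D t)\<^sup>2 * exp (2 * C * t)"
    proof (cases "s = t")
      case False
      show ?thesis
      proof (rule DERIV_nonneg_imp_increasing_open[where a = s and b = t and f = "\<lambda>x. (D x)\<^sup>2 * exp (2 * C * x)"])
        show "s \<le> t" by (rule st)
        fix x assume x: "s < x" "x < t"
        have "((\<lambda>x. (D x)\<^sup>2 * exp (2 * C * x)) has_real_derivative
            2 * (D x * D' x + C * (D x)\<^sup>2) * exp (2 * C * x)) (at x)"
          by (rule derivative_eq_intros deriv_at x refl)+ (simp add: algebra_simps power2_eq_square)
        moreover have "0 \<le> D x * D' x + C * (D x)\<^sup>2"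
          using sq(2)[OF x] by linarith
        then have "0 \<le> 2 * (D x * D' x + C * (D x)\<^sup>2)"
          by (rule mult_nonneg_nonneg[OF zero_le_numeral])
        then have "0 \<le> 2 * (D x * D' x + C * (D x)\<^sup>2) * exp (2 * C * x)"
          by (rule mult_nonneg_nonneg) simp
        ultimately show "\<exists>y. ((\<lambda>x. (D x)\<^sup>2 * exp (2 * C * x)) has_real_derivative y) (at x) \<and> 0 \<le> y"
          by blast
      qed (intro continuous_intros cont)
    qed simp
    from mult_right_mono[OF this, of "exp (- (2 * C * s))"]
    have "(D s)\<^sup>2 * (exp (2 * C * s) * exp (- (2 * C * s))) \<le> (D t)\<^sup>2 * (exp (2 * C * t) * exp (- (2 * C * s)))"
      by (simp only: ac_simps zero_le_square exp_ge_zero)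
    then have "(D s)\<^sup>2 \<le> (exp (C * (t - s)) * \<bar>D t\<bar>)\<^sup>2"
      by (simp add: power_mult_distrib E mult_exp_exp mult.commute)
    then show ?thesis
      by (intro power2_le_imp_le[of "\<bar>D s\<bar>"]) simp_all
  qed
qed

lemma leaf_separation:
  fixes u :: "plane \<Rightarrow> real"
  assumes lip: "C-lipschitz_on \<Omega> u"
    and f: "\<And>x. x \<in> {a..b} \<Longrightarrow> (f has_real_derivative u (x, f x)) (at x within {a..b})" "\<And>x. x \<in> {a..b} \<Longrightarrow> (x, f x) \<in> \<Omega>"
    and g: "\<And>x. x \<in> {a..b} \<Longrightarrow> (g has_real_derivative u (x, g x)) (at x within {a..b})" "\<And>x. x \<in> {a..b} \<Longrightarrow> (x, g x) \<in> \<Omega>"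
    and st: "s \<in> {a..b}" "t \<in> {a..b}"
  shows "\<bar>f t - g t\<bar> \<le> exp (C * \<bar>t - s\<bar>) * \<bar>f s - g s\<bar>"
proof -
  have *: "\<bar>f y - g y\<bar> \<le> exp (C * (y - x)) * \<bar>f x - g x\<bar> \<and> \<bar>f x - g x\<bar> \<le> exp (C * (y - x)) * \<bar>f y - g y\<bar>"
    if xy: "x \<le> y" "x \<in> {a..b}" "y \<in> {a..b}" for x y
  proof -
    have sub: "{x..y} \<subseteq> {a..b}" using xy by auto
    have 1: "((\<lambda>x. f x - g x) has_real_derivative u (z, f z) - u (z, g z)) (at z within {x..y})" if "z \<in> {x..y}" for z
      using that sub by (intro DERIV_diff has_field_derivative_subset[OF f(1) sub] has_field_derivative_subset[OF g(1) sub]) auto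
    have 2: "\<bar>u (z, f z) - u (z, g z)\<bar> \<le> C * \<bar>f z - g z\<bar>" if "z \<in> {x..y}" for z
    proof -
      have "z \<in> {a..b}" using that sub by blast
      from lipschitz_onD[OF lip f(2)[OF this] g(2)[OF this]] show ?thesis
        by (simp add: dist_Pair_Pair dist_real_def)
    qed
    from gronwall_interval[OF xy(1) 1 2] show ?thesis by blast
  qed
  show ?thesis
    using *[of s t] *[of t s] st by (cases "s \<le> t") (auto simp: abs_if)
qed

text \<open>
  The Picard operator is a contraction of the bounded continuous functions on the line. Clipping the upper limit of
  the integral to the time interval makes it an operator on functions defined everywhere.
\<close>

lemma picard_exists:
  fixes F :: "plane \<Rightarrow> real"
  assumes cont: "continuous_on UNIV F"
    and lip: "\<And>t x y. \<bar>F (t, x) - F (t, y)\<bar> \<le> C * \<bar>x - y\<bar>"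
    and \<tau>: "0 < \<tau>" "C * (2 * \<tau>) \<le> 1 / 2" and C: "0 \<le> C"
  shows "\<exists>y. y t0 = s \<and> (\<forall>t\<in>{t0-\<tau>..t0+\<tau>}. (y has_real_derivative F (t, y t)) (at t within {t0-\<tau>..t0+\<tau>}))"
proof -
  let ?ap = "apply_bcontfun :: (real \<Rightarrow>\<^sub>C real) \<Rightarrow> real \<Rightarrow> real"
  let ?I = "{t0-\<tau>..t0+\<tau>}"
  define clip where "clip t = max (t0 - \<tau>) (min (t0 + \<tau>) t)" for t
  define J where "J y t = integral {t0-\<tau>..t} (\<lambda>r. F (r, y r))" for y :: "real \<Rightarrow> real" and t
  define T where "T y t = s + (J y (clip t) - J y t0)" for y :: "real \<Rightarrow> real" and t
  have clip_in: "clip t \<in> ?I" for t using \<tau> by (auto simp: clip_def)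
  have clip_id: "clip t = t" if "t \<in> ?I" for t using that by (auto simp: clip_def)
  have clip_cont: "continuous_on UNIV clip"
    unfolding clip_def[abs_def] by (intro continuous_intros)
  have integrand: "continuous_on ?I (\<lambda>r. F (r, y r))" if "continuous_on UNIV y" for y
    using continuous_on_subset[OF that subset_UNIV]
    by (intro continuous_on_compose2[OF cont] continuous_intros) auto
  have J_deriv: "(J y has_real_derivative F (t, y t)) (at t within ?I)" if "continuous_on UNIV y" "t \<in> ?I" for y t
    unfolding J_def[abs_def] by (rule integral_has_real_derivative[OF integrand[OF that(1)] that(2)])
  have T_bcont: "T y \<in> bcontfun" if y: "continuous_on UNIV y" for y
  proof -
    have Jc: "continuous_on ?I (J y)" by (rule DERIV_continuous_on[OF J_deriv[OF y]])
    then have "continuous_on UNIV (T y)"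
      unfolding T_def[abs_def] using clip_in
      by (intro continuous_intros continuous_on_compose2[OF Jc clip_cont]) auto
    moreover have "bounded (range (T y))"
    proof (rule bounded_subset)
      show "bounded ((\<lambda>x. s + (J y x - J y t0)) ` ?I)"
        by (intro compact_imp_bounded compact_continuous_image continuous_intros Jc) simp
      show "range (T y) \<subseteq> (\<lambda>x. s + (J y x - J y t0)) ` ?I"
        unfolding T_def using clip_in by auto
    qed
    ultimately show ?thesis by (simp add: bcontfun_def)
  qed
  define \<Phi> where "\<Phi> y = Bcontfun (T (?ap y))" for y :: "real \<Rightarrow>\<^sub>C real"
  have yc: "continuous_on UNIV (?ap y)" for y :: "real \<Rightarrow>\<^sub>C real"
    using apply_bcontfun[of y] by (simp add: bcontfun_def)
  have \<Phi>: "?ap (\<Phi> y) = T (?ap y)" for y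
    unfolding \<Phi>_def by (rule Bcontfun_inverse[OF T_bcont[OF yc]])
  have contraction: "dist (\<Phi> y) (\<Phi> z) \<le> (1 / 2) * dist y z" for y z
  proof (rule dist_bound)
    fix t
    let ?h = "\<lambda>t. J (?ap y) t - J (?ap z) t"
    have "\<bar>?h (clip t) - ?h t0\<bar> \<le> integral ?I (\<lambda>_. C * dist y z)"
    proof (rule abs_diff_le_integral_of_derivative_bound[where h = ?h
          and h' = "\<lambda>x. F (x, ?ap y x) - F (x, ?ap z x)"])
      show "(?h has_real_derivative F (x, ?ap y x) - F (x, ?ap z x)) (at x within ?I)"
        if "x \<in> ?I" for x
        using that by (intro DERIV_diff J_deriv yc)
      show "\<bar>F (x, ?ap y x) - F (x, ?ap z x)\<bar> \<le> C * dist y z" for x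
      proof -
        have "\<bar>F (x, ?ap y x) - F (x, ?ap z x)\<bar> \<le> C * dist (?ap y x) (?ap z x)"
          using lip by (simp add: dist_real_def)
        also have "\<dots> \<le> C * dist y z" by (rule mult_left_mono[OF dist_bounded C])
        finally show ?thesis .
      qed
    qed (use clip_in \<tau> in auto)
    also have "\<dots> = C * (2 * \<tau>) * dist y z"
      using \<tau> by simp
    also have "\<dots> \<le> (1 / 2) * dist y z"
      using \<tau>(2) by (intro mult_right_mono) auto
    finally show "dist (?ap (\<Phi> y) t) (?ap (\<Phi> z) t) \<le> (1 / 2) * dist y z"
      unfolding \<Phi> by (simp add: T_def dist_real_def algebra_simps)
  qed
  then obtain y where "\<Phi> y = y"
    using banach_fix_type[of "1/2" \<Phi>] by auto
  then have y: "?ap y = T (?ap y)" using \<Phi>[of y] by simp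
  have "(?ap y has_real_derivative F (t, ?ap y t)) (at t within ?I)" if t: "t \<in> ?I" for t
    unfolding has_field_derivative_def
  proof (rule has_derivative_transform[OF t])
    have "((\<lambda>t. s + (J (?ap y) t - J (?ap y) t0)) has_real_derivative
        F (t, ?ap y t)) (at t within ?I)"
      using DERIV_add[OF DERIV_const DERIV_diff[OF J_deriv[OF yc[of y] t] DERIV_const]] by simp
    then show "((\<lambda>t. s + (J (?ap y) t - J (?ap y) t0)) has_derivative
        (*) (F (t, ?ap y t))) (at t within ?I)"
      by (simp add: has_field_derivative_def)
    show "?ap y x = s + (J (?ap y) x - J (?ap y) t0)" if "x \<in> ?I" for x
      by (subst y) (simp add: T_def clip_id[OF that])
  qed
  moreover have "?ap y t0 = s"
    by (subst y) (use \<tau> in \<open>simp add: T_def clip_id\<close>)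
  ultimately show ?thesis by blast
qed

lemma lipschitz_on_compact_bounded:
  fixes u :: "plane \<Rightarrow> real"
  assumes "C-lipschitz_on \<Omega> u" "compact K" "K \<subseteq> \<Omega>"
  shows "\<exists>M>0. \<forall>x\<in>K. \<bar>u x\<bar> \<le> M"
proof -
  have "continuous_on K u"
    using lipschitz_on_continuous_on[OF assms(1)] assms(3) continuous_on_subset by blast
  then have "bounded (u ` K)" by (intro compact_imp_bounded compact_continuous_image assms(2))
  then show ?thesis unfolding bounded_pos by auto
qed

text \<open>
  A rectangle around \<open>(t0, y0)\<close> and the flow \<open>Y s\<close> of the field \<open>(1, u)\<close>, where \<open>s\<close> is the height at time \<open>t0\<close>. All
  flow lines that start at height \<open>y0 - \<sigma>\<close> to \<open>y0 + \<sigma>\<close> stay in the rectangle throughout the time interval.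
\<close>

locale flow_box =
  fixes \<Omega> :: "plane set" and u :: "plane \<Rightarrow> real" and t0 y0 \<tau> \<sigma> \<rho> :: real and Y :: "real \<Rightarrow> real \<Rightarrow> real"
  assumes pos: "0 < \<tau>" "0 < \<sigma>"
    and box: "cbox (t0 - \<tau>, y0 - \<rho>) (t0 + \<tau>, y0 + \<rho>) \<subseteq> \<Omega>"
    and deriv: "\<And>s t. s \<in> {y0-\<sigma>..y0+\<sigma>} \<Longrightarrow> t \<in> {t0-\<tau>..t0+\<tau>} \<Longrightarrow>
      (Y s has_real_derivative u (t, Y s t)) (at t within {t0-\<tau>..t0+\<tau>})"
    and range: "\<And>s t. s \<in> {y0-\<sigma>..y0+\<sigma>} \<Longrightarrow> t \<in> {t0-\<tau>..t0+\<tau>} \<Longrightarrow> Y s t \<in> {y0-\<rho>..y0+\<rho>}"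
    and start: "\<And>s. s \<in> {y0-\<sigma>..y0+\<sigma>} \<Longrightarrow> Y s t0 = s"
    and sep: "\<And>s r t. s \<in> {y0-\<sigma>..y0+\<sigma>} \<Longrightarrow> r \<in> {y0-\<sigma>..y0+\<sigma>} \<Longrightarrow> s \<le> r \<Longrightarrow> t \<in> {t0-\<tau>..t0+\<tau>} \<Longrightarrow>
      (r - s) / 2 \<le> Y r t - Y s t \<and> Y r t - Y s t \<le> 2 * (r - s)"
begin

abbreviation "R \<equiv> cbox (t0 - \<tau>, y0 - \<rho>) (t0 + \<tau>, y0 + \<rho>)"
abbreviation "I \<equiv> {t0-\<tau>..t0+\<tau>}"
abbreviation "S \<equiv> {y0-\<sigma>..y0+\<sigma>}"

lemma centre_in: "y0 \<in> S" "t0 \<in> I"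
  using pos by auto

lemma in_box: "s \<in> S \<Longrightarrow> t \<in> I \<Longrightarrow> (t, Y s t) \<in> R"
  using range[of s t] by (auto simp: cbox_Pair_eq)

end

text \<open>
  Clipping both coordinates to a rectangle extends \<open>u\<close> to a globally Lipschitz function, and solutions that start
  near the centre stay in the rectangle where the extension agrees with \<open>u\<close>. The time interval is so short that
  \<open>exp (C \<tau>) \<le> 2\<close>, so that Gronwall's inequality makes the flow bi-Lipschitz with constant \<open>2\<close>.
\<close>

lemma flow_box_exists:
  fixes u :: "plane \<Rightarrow> real"
  assumes op: "open \<Omega>" and lip: "C-lipschitz_on \<Omega> u" and x0: "(t0, y0) \<in> \<Omega>"
  obtains \<tau> \<sigma> \<rho> Y where "flow_box \<Omega> u t0 y0 \<tau> \<sigma> \<rho> Y"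
proof -
  have C0: "0 \<le> C" using lip lipschitz_on_nonneg by blast
  obtain e where e: "e > 0" "cball (t0, y0) e \<subseteq> \<Omega>"
    using op x0 open_contains_cball by blast
  define \<rho> where "\<rho> = e / 2"
  have \<rho>: "0 < \<rho>" using e by (simp add: \<rho>_def)
  let ?R = "cbox (t0 - \<rho>, y0 - \<rho>) (t0 + \<rho>, y0 + \<rho>)"
  have R: "?R \<subseteq> \<Omega>"
  proof
    fix z assume z: "z \<in> ?R"
    then have "dist (t0, y0) z \<le> \<bar>t0 - fst z\<bar> + \<bar>y0 - snd z\<bar>"
      by (cases z) (simp add: dist_Pair_Pair dist_real_def sqrt_sum_squares_le_sum_abs)
    also have "\<dots> \<le> e"
      using z by (cases z) (auto simp: cbox_Pair_eq \<rho>_def abs_le_iff)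
    finally show "z \<in> \<Omega>" using e by auto
  qed
  have uR: "continuous_on ?R u"
    using lipschitz_on_continuous_on[OF lip] R continuous_on_subset by blast
  obtain M where M: "M > 0" "\<And>z. z \<in> ?R \<Longrightarrow> \<bar>u z\<bar> \<le> M"
    using lipschitz_on_compact_bounded[OF lip compact_cbox R] by blast
  define \<tau> where "\<tau> = min \<rho> (min (\<rho> / (2 * M)) (1 / (4 * (C + 1))))"
  have \<tau>: "0 < \<tau>" "\<tau> \<le> \<rho>" "M * \<tau> \<le> \<rho> / 2" "C * (2 * \<tau>) \<le> 1 / 2"
  proof -
    show "0 < \<tau>" "\<tau> \<le> \<rho>" using \<rho> M C0 by (auto simp: \<tau>_def)
    have "M * \<tau> \<le> M * (\<rho> / (2 * M))" using M by (intro mult_left_mono) (auto simp: \<tau>_def)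
    then show "M * \<tau> \<le> \<rho> / 2" using M by simp
    have "C * (2 * \<tau>) \<le> (C + 1) * (2 * (1 / (4 * (C + 1))))"
      using C0 \<open>0 < \<tau>\<close> by (intro mult_mono) (auto simp: \<tau>_def)
    also have "\<dots> = 1 / 2" using C0 by simp
    finally show "C * (2 * \<tau>) \<le> 1 / 2" .
  qed
  have exp2: "exp (C * \<bar>x\<bar>) \<le> 2" if "\<bar>x\<bar> \<le> \<tau>" for x
  proof -
    have "C * \<bar>x\<bar> \<le> 1 / 4" using mult_left_mono[OF that C0] \<tau>(4) by linarith
    then have "exp (C * \<bar>x\<bar>) \<le> 1 + C * \<bar>x\<bar> + (C * \<bar>x\<bar>)\<^sup>2"
      using C0 by (intro exp_bound) auto
    also have "(C * \<bar>x\<bar>)\<^sup>2 \<le> (1 / 4)\<^sup>2"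
      using \<open>C * \<bar>x\<bar> \<le> 1 / 4\<close> C0 by (intro power_mono) auto
    finally show ?thesis using \<open>C * \<bar>x\<bar> \<le> 1 / 4\<close> by (simp add: power2_eq_square)
  qed
  define cl where "cl c x = max (c - \<rho>) (min (c + \<rho>) x)" for c x :: real
  define F where "F z = u (cl t0 (fst z), cl y0 (snd z))" for z :: plane
  have cl_in: "(cl t0 t, cl y0 x) \<in> ?R" for t x
    using \<rho> by (auto simp: cl_def cbox_Pair_eq)
  have cl_id: "cl c x = x" if "x \<in> {c-\<rho>..c+\<rho>}" for c x using that by (auto simp: cl_def)
  have cl_lip: "\<bar>cl c x - cl c y\<bar> \<le> \<bar>x - y\<bar>" for c x y using \<rho> by (auto simp: cl_def)
  have Fcont: "continuous_on UNIV F"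
    unfolding F_def[abs_def] cl_def
    by (rule continuous_on_compose2[OF uR], intro continuous_intros) (use cl_in in \<open>auto simp: cl_def\<close>)
  have Flip: "\<bar>F (t, x) - F (t, y)\<bar> \<le> C * \<bar>x - y\<bar>" for t x y
  proof -
    have "\<bar>F (t, x) - F (t, y)\<bar> \<le> C * \<bar>cl y0 x - cl y0 y\<bar>"
      using lipschitz_onD[OF lip subsetD[OF R cl_in] subsetD[OF R cl_in], of t x t y]
      by (simp add: F_def dist_Pair_Pair dist_real_def)
    also have "\<dots> \<le> C * \<bar>x - y\<bar>" using C0 cl_lip by (intro mult_left_mono)
    finally show ?thesis .
  qed
  let ?I = "{t0-\<tau>..t0+\<tau>}" and ?S = "{y0-\<rho>/2..y0+\<rho>/2}"
  have "\<forall>s. \<exists>y. y t0 = s \<and> (\<forall>t\<in>?I. (y has_real_derivative F (t, y t)) (at t within ?I))"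
    using picard_exists[OF Fcont Flip \<tau>(1,4) C0] by blast
  then obtain Y where Y: "\<And>s. Y s t0 = s"
    "\<And>s t. t \<in> ?I \<Longrightarrow> (Y s has_real_derivative F (t, Y s t)) (at t within ?I)"
    by metis
  have range: "Y s t \<in> {y0-\<rho>..y0+\<rho>}" if s: "s \<in> ?S" and t: "t \<in> ?I" for s t
  proof -
    have "norm (Y s t - Y s t0) \<le> M * norm (t - t0)"
    proof (rule field_differentiable_bound[of ?I])
      show "(Y s has_field_derivative F (z, Y s z)) (at z within ?I)" if "z \<in> ?I" for z
        using Y(2)[OF that] .
      show "norm (F (z, Y s z)) \<le> M" for z
        using M(2)[OF cl_in] by (simp add: F_def)
    qed (use t \<tau> in auto)
    also have "\<dots> \<le> M * \<tau>" using t M by (intro mult_left_mono) (auto simp: abs_le_iff)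
    finally have "\<bar>Y s t - s\<bar> \<le> \<rho> / 2" using \<tau>(3) Y(1)[of s] by simp
    then show ?thesis using s unfolding atLeastAtMost_iff abs_le_iff by linarith
  qed
  have inR: "(t, Y s t) \<in> ?R" if "s \<in> ?S" "t \<in> ?I" for s t
    using range[OF that] that \<tau>(2) by (auto simp: cbox_Pair_eq)
  have deriv: "(Y s has_real_derivative u (t, Y s t)) (at t within ?I)" if "s \<in> ?S" "t \<in> ?I" for s t
  proof -
    have "F (t, Y s t) = u (t, Y s t)"
      using cl_id[of t t0] cl_id[of "Y s t" y0] range[OF that] that \<tau>(2) by (auto simp: F_def)
    then show ?thesis using Y(2)[OF that(2), of s] by simp
  qed
  have t0: "t0 \<in> ?I" using \<tau> by auto
  have separation: "\<bar>Y s t - Y r t\<bar> \<le> 2 * \<bar>Y s t' - Y r t'\<bar>"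
    if "s \<in> ?S" "r \<in> ?S" "t \<in> ?I" "t' \<in> ?I" "\<bar>t - t'\<bar> \<le> \<tau>" for s r t t'
  proof -
    have "\<bar>Y s t - Y r t\<bar> \<le> exp (C * \<bar>t - t'\<bar>) * \<bar>Y s t' - Y r t'\<bar>"
      using that inR R by (intro leaf_separation[OF lip, of "t0-\<tau>" "t0+\<tau>"] deriv) auto
    also have "\<dots> \<le> 2 * \<bar>Y s t' - Y r t'\<bar>"
      using exp2[OF that(5)] by (rule mult_right_mono) simp
    finally show ?thesis .
  qed
  have order: "Y s t \<le> Y r t" if sr: "s \<in> ?S" "r \<in> ?S" "s \<le> r" "t \<in> ?I" for s r t
  proof (rule ccontr)
    assume neg: "\<not> Y s t \<le> Y r t"
    then have "s \<noteq> r" by auto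
    let ?g = "\<lambda>t. Y r t - Y s t"
    have c: "continuous_on ?I ?g"
      using sr by (intro continuous_intros DERIV_continuous_on[OF deriv])
    have "connected (?g ` ?I)" by (intro connected_continuous_image c) simp
    moreover have "?g t0 \<in> ?g ` ?I" "?g t \<in> ?g ` ?I" using t0 sr by blast+
    moreover have "?g t \<le> 0" "0 \<le> ?g t0" using neg sr Y(1) by auto
    ultimately have "0 \<in> ?g ` ?I" using connectedD_interval by blast
    then obtain z where z: "z \<in> ?I" "Y r z = Y s z" by auto
    have "\<bar>Y s t0 - Y r t0\<bar> \<le> 2 * \<bar>Y s z - Y r z\<bar>"
      using z sr t0 by (intro separation) (auto simp: abs_le_iff)
    then show False using z \<open>s \<noteq> r\<close> Y(1) by simp
  qed
  have "flow_box \<Omega> u t0 y0 \<tau> (\<rho> / 2) \<rho> Y"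
  proof
    show "0 < \<tau>" "0 < \<rho> / 2" using \<tau> \<rho> by auto
    show "cbox (t0 - \<tau>, y0 - \<rho>) (t0 + \<tau>, y0 + \<rho>) \<subseteq> \<Omega>"
      using R \<tau>(2) by (auto simp: cbox_Pair_eq)
    show "(r - s) / 2 \<le> Y r t - Y s t \<and> Y r t - Y s t \<le> 2 * (r - s)"
      if "s \<in> ?S" "r \<in> ?S" "s \<le> r" "t \<in> ?I" for s r t
    proof -
      have "\<bar>t - t0\<bar> \<le> \<tau>" "\<bar>t0 - t\<bar> \<le> \<tau>" using that(4) by auto
      with separation[of r s t t0] separation[of r s t0 t] that t0
      have "\<bar>Y r t - Y s t\<bar> \<le> 2 * \<bar>r - s\<bar>" "\<bar>r - s\<bar> \<le> 2 * \<bar>Y r t - Y s t\<bar>"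
        unfolding Y(1) by blast+
      with order[OF that] that(3) have "r - s \<le> (Y r t - Y s t) * 2" "Y r t - Y s t \<le> 2 * (r - s)" by simp_all
      then show ?thesis by (simp only: pos_divide_le_eq zero_less_numeral)
    qed
  qed (use deriv range Y(1) in auto)
  then show ?thesis by (rule that)
qed

section \<open>The limit is affine along flow lines\<close>

lemma abs_cross_difference_le:
  fixes a b a' b' K T :: real
  assumes "\<bar>a\<bar> \<le> K" "\<bar>b\<bar> \<le> T" "\<bar>a'\<bar> \<le> K" "\<bar>b'\<bar> \<le> T"
  shows "\<bar>a * b - a' * b'\<bar> \<le> 2 * (K * T)"
proof -
  have "\<bar>a * b\<bar> \<le> K * T" "\<bar>a' * b'\<bar> \<le> K * T"
    unfolding abs_mult using assms by (auto intro!: mult_mono)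
  then show ?thesis by linarith
qed

text \<open>
  Each summand is the integral of \<open>\<phi>\<close> from \<open>F i\<close> to \<open>F (Suc i)\<close>, so the sum telescopes along a primitive of \<open>\<phi>\<close>.
\<close>

lemma sum_strip_averages_le:
  fixes \<phi> :: "real \<Rightarrow> real" and F :: "nat \<Rightarrow> real"
  assumes cont: "continuous_on {c..d} \<phi>" and nonneg: "\<And>x. x \<in> {c..d} \<Longrightarrow> 0 \<le> \<phi> x"
    and F: "\<And>i. i \<le> N \<Longrightarrow> F i \<in> {c..d}" "\<And>i. i < N \<Longrightarrow> F i \<le> F (Suc i)"
  shows "(\<Sum>i<N. (F (Suc i) - F i) * integral {0..1} (\<lambda>\<theta>. \<phi> (F i + \<theta> * (F (Suc i) - F i)))) \<le> integral {c..d} \<phi>"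
proof -
  define \<Psi> where "\<Psi> x = integral {c..x} \<phi>" for x
  have \<Psi>: "(\<Psi> has_real_derivative \<phi> x) (at x within {c..d})" if "x \<in> {c..d}" for x
    unfolding \<Psi>_def[abs_def] by (rule integral_has_real_derivative[OF cont that])
  have int: "\<phi> integrable_on {c..x}" if "x \<in> {c..d}" for x
    by (rule integrable_continuous_interval, rule continuous_on_subset[OF cont]) (use that in auto)
  have step: "(F (Suc i) - F i) * integral {0..1} (\<lambda>\<theta>. \<phi> (F i + \<theta> * (F (Suc i) - F i))) = \<Psi> (F (Suc i)) - \<Psi> (F i)"
    if i: "i < N" for i
  proof -
    let ?w = "F (Suc i) - F i"
    have w: "0 \<le> ?w" using F(2)[OF i] by simp
    have rng: "F i + \<theta> * ?w \<in> {c..d}" if "\<theta> \<in> {0..1}" for \<theta>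
    proof -
      have "0 \<le> \<theta> * ?w" "\<theta> * ?w \<le> 1 * ?w"
        using that w mult_right_mono[of \<theta> 1 ?w] by auto
      moreover have "c \<le> F i" "F (Suc i) \<le> d" using F(1)[of i] F(1)[of "Suc i"] i by auto
      ultimately show ?thesis by simp
    qed
    have "((\<lambda>\<theta>. ?w * \<phi> (F i + \<theta> * ?w)) has_integral \<Psi> (F i + 1 * ?w) - \<Psi> (F i + 0 * ?w)) {0..1}"
    proof (rule fundamental_theorem_of_calculus)
      fix \<theta> :: real assume \<theta>: "\<theta> \<in> {0..1}"
      have inner: "((\<lambda>\<theta>. F i + \<theta> * ?w) has_real_derivative ?w) (at \<theta> within {0..1})"
        by (auto intro!: derivative_eq_intros)
      have "(\<lambda>\<theta>. F i + \<theta> * ?w) ` {0..1} \<subseteq> {c..d}" using rng by blast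
      then have "(\<Psi> has_real_derivative \<phi> (F i + \<theta> * ?w)) (at (F i + \<theta> * ?w) within (\<lambda>\<theta>. F i + \<theta> * ?w) ` {0..1})"
        by (rule has_field_derivative_subset[OF \<Psi>[OF rng[OF \<theta>]]])
      from DERIV_image_chain[OF this inner]
      show "((\<lambda>\<theta>. \<Psi> (F i + \<theta> * ?w)) has_vector_derivative ?w * \<phi> (F i + \<theta> * ?w)) (at \<theta> within {0..1})"
        by (simp add: o_def mult.commute has_real_derivative_iff_has_vector_derivative)
    qed simp
    from integral_unique[OF this] have "?w * integral {0..1} (\<lambda>\<theta>. \<phi> (F i + \<theta> * ?w)) = \<Psi> (F i + 1 * ?w) - \<Psi> (F i + 0 * ?w)"
      by (simp only: integral_mult_right)
    then show ?thesis by simp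
  qed
  have "(\<Sum>i<N. (F (Suc i) - F i) * integral {0..1} (\<lambda>\<theta>. \<phi> (F i + \<theta> * (F (Suc i) - F i))))
      = (\<Sum>i<N. \<Psi> (F (Suc i)) - \<Psi> (F i))"
    by (intro sum.cong refl step) simp
  also have "\<dots> = \<Psi> (F N) - \<Psi> (F 0)" by (rule sum_lessThan_telescope)
  also have "\<dots> \<le> \<Psi> d"
  proof -
    have N: "F N \<in> {c..d}" "F 0 \<in> {c..d}" using F(1) by simp_all
    have "0 \<le> \<Psi> (F 0)"
      unfolding \<Psi>_def using N nonneg by (intro integral_nonneg int) auto
    moreover have "\<Psi> (F N) \<le> \<Psi> d"
      unfolding \<Psi>_def using N nonneg by (intro integral_subset_le int) auto
    ultimately show ?thesis by linarith
  qed
  finally show ?thesis by (simp add: \<Psi>_def)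
qed

text \<open>
  The data in the definition of a vanishing viscosity solution, with one Lipschitz constant for the solution and all
  its approximations.
\<close>

locale viscous_approximation =
  fixes \<Omega> :: "plane set" and u :: "plane \<Rightarrow> real" and \<epsilon> :: "nat \<Rightarrow> real" and v :: "nat \<Rightarrow> plane \<Rightarrow> real" and C :: real
  assumes open_domain: "open \<Omega>"
    and lip_u: "C-lipschitz_on \<Omega> u"
    and eps_pos: "\<And>j. 0 < \<epsilon> j" and eps_lim: "\<epsilon> \<longlonglongrightarrow> 0"
    and smooth: "\<And>j. smooth_on_plane \<Omega> (v j)"
    and minimal: "\<And>j. regularized_minimal_graph \<Omega> (\<epsilon> j) (v j)"
    and lip_v: "\<And>j. C-lipschitz_on \<Omega> (v j)"
    and conv: "\<And>K. compact K \<Longrightarrow> K \<subseteq> \<Omega> \<Longrightarrow> uniform_limit K v u sequentially"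
begin

lemma C_nonneg: "0 \<le> C" using lip_u lipschitz_on_nonneg by blast

lemma partials_le: "x \<in> \<Omega> \<Longrightarrow> \<bar>pd1 (v j) x\<bar> \<le> C" "x \<in> \<Omega> \<Longrightarrow> \<bar>pd2 (v j) x\<bar> \<le> C"
  using lipschitz_on_partials_le[OF open_domain lip_v smooth_on_plane_Ck_1(1)[OF smooth]] by blast+

lemma eventually_close:
  assumes "compact K" "K \<subseteq> \<Omega>" "0 < \<zeta>"
  shows "eventually (\<lambda>j. \<epsilon> j \<le> \<zeta> \<and> (\<forall>x\<in>K. \<bar>v j x - u x\<bar> \<le> \<zeta>)) sequentially"
proof -
  have "eventually (\<lambda>j. \<epsilon> j < \<zeta>) sequentially"
    using order_tendstoD(2)[OF eps_lim assms(3)] .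
  moreover have "eventually (\<lambda>j. \<forall>x\<in>K. dist (v j x) (u x) < \<zeta>) sequentially"
    using uniform_limitD[OF conv[OF assms(1,2)] assms(3)] .
  ultimately show ?thesis
    by eventually_elim (auto simp: dist_real_def intro: less_imp_le)
qed

text \<open>
  The index \<open>J\<close> is where the approximations become bounded on the rectangle; from there on the slopes are
  bounded by a common constant.
\<close>

lemma slopes_L1_Cauchy:
  assumes R: "cbox (a, c) (b, d) \<subseteq> \<Omega>" and ab: "a \<le> b" and cd: "c \<le> d"
  shows "\<exists>P J. (\<forall>j\<ge>J. \<forall>x\<in>cbox (a, c) (b, d). \<bar>X1 (v j) (v j) x\<bar> \<le> P) \<and>
    (\<forall>\<delta>>0. \<exists>k\<ge>J. \<forall>j\<ge>k. integral (cbox (a, c) (b, d)) (\<lambda>x. \<bar>X1 (v j) (v j) x - X1 (v k) (v k) x\<bar>) \<le> \<delta>)"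
proof -
  let ?R = "cbox (a, c) (b, d)"
  obtain M0 where M0: "M0 > 0" "\<And>x. x \<in> ?R \<Longrightarrow> \<bar>u x\<bar> \<le> M0"
    using lipschitz_on_compact_bounded[OF lip_u compact_cbox R] by blast
  define M where "M = M0 + 1"
  define P where "P = C + M * C"
  obtain J where J: "\<And>j x. j \<ge> J \<Longrightarrow> x \<in> ?R \<Longrightarrow> \<epsilon> j \<le> 1 \<and> \<bar>v j x - u x\<bar> \<le> 1"
    using eventually_close[OF compact_cbox R, of 1] unfolding eventually_sequentially by auto
  have vM: "\<bar>v j x\<bar> \<le> M" if "j \<ge> J" "x \<in> ?R" for j x
    using J[OF that] M0(2)[OF that(2)] by (auto simp: M_def)
  have slope: "\<bar>X1 (v j) (v j) x\<bar> \<le> P" if "j \<ge> J" "x \<in> ?R" for j x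
  proof -
    have "x \<in> \<Omega>" using R that by blast
    note pd = partials_le[OF this, of j]
    have "\<bar>v j x * pd2 (v j) x\<bar> \<le> M * C"
      unfolding abs_mult using vM[OF that] pd M0(1)
      by (intro mult_mono) (auto simp: M_def)
    then show ?thesis
      unfolding X1_def P_def using pd(1) by (intro order_trans[OF abs_triangle_ineq] add_mono) auto
  qed
  have Cauchy: "\<exists>k\<ge>J. \<forall>j\<ge>k. integral ?R (\<lambda>x. \<bar>X1 (v j) (v j) x - X1 (v k) (v k) x\<bar>) \<le> \<delta>" if \<delta>: "\<delta> > 0" for \<delta>
  proof -
    define A where "A = (b - a) * (d - c)"
  (* \<kappa> and \<zeta> each spend half of \<delta>; the summands 1 keep the denominators positive *)
    define \<kappa> where "\<kappa> = \<delta> / (2 * (A + 1))"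
    define L where "L = sqrt (1 + P\<^sup>2) ^ 3"
    define K1 where "K1 = 2 * (2 * (d - c) + 2 * (M + C) * (b - a) + 2 * C * A)"
    define K2 where "K2 = (2 * C\<^sup>2 + 2 * C * P) * A"
    define B where "B = L / \<kappa> * (2 * K1 + 2 * K2)"
    define \<zeta> where "\<zeta> = \<delta> / (2 * (B + 1))"
    have A0: "0 \<le> A" using ab cd by (simp add: A_def)
    have \<kappa>0: "0 < \<kappa>" using A0 \<delta> by (simp add: \<kappa>_def)
    have \<kappa>A: "\<kappa> * A \<le> \<delta> / 2"
      using A0 \<delta> by (simp add: \<kappa>_def field_simps)
    have M00: "0 \<le> M" using M0(1) by (simp add: M_def)
    have K0: "0 \<le> K1" "0 \<le> K2" "0 \<le> L"
      using A0 ab cd C_nonneg M00 by (auto simp: K1_def K2_def L_def P_def)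
    then have B0: "0 \<le> B" using \<kappa>0 by (simp add: B_def)
    have \<zeta>0: "0 < \<zeta>" using B0 \<delta> by (simp add: \<zeta>_def)
    have B\<zeta>: "B * \<zeta> \<le> \<delta> / 2"
      using B0 \<delta> by (simp add: \<zeta>_def field_simps)
    obtain k0 where k0: "\<And>j. j \<ge> k0 \<Longrightarrow> \<epsilon> j \<le> \<zeta> \<and> (\<forall>x\<in>?R. \<bar>v j x - u x\<bar> \<le> \<zeta>)"
      using eventually_close[OF compact_cbox R \<zeta>0] unfolding eventually_sequentially by auto
    define k where "k = max J k0"
    have "integral ?R (\<lambda>x. \<bar>X1 (v j) (v j) x - X1 (v k) (v k) x\<bar>) \<le> \<delta>" if j: "j \<ge> k" for j
    proof -
      have jk: "j \<ge> J" "j \<ge> k0" "k \<ge> J" "k \<ge> k0" using j by (auto simp: k_def)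
      have corner: "(a, c) \<in> ?R" using ab cd by (simp add: cbox_Pair_eq)
      have "integral ?R (\<lambda>x. \<bar>X1 (v j) (v j) x - X1 (v k) (v k) x\<bar>)
        \<le> \<kappa> * A + L / \<kappa> * (K1 * (2 * \<zeta>) + K2 * (\<epsilon> j + \<epsilon> k))"
        unfolding A_def L_def K1_def K2_def
      proof (rule slope_L1_distance_bound[OF smooth minimal less_imp_le[OF eps_pos] smooth minimal less_imp_le[OF eps_pos] _ _ R ab cd])
        show "\<epsilon> j \<le> 1" "\<epsilon> k \<le> 1" using J[OF jk(1) corner] J[OF jk(3) corner] by auto
        fix x assume x: "x \<in> ?R"
        show "\<bar>pd2 (v j) x\<bar> \<le> C \<and> \<bar>pd2 (v k) x\<bar> \<le> C" using partials_le(2) R x by blast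
        show "\<bar>v j x\<bar> \<le> M \<and> \<bar>v k x\<bar> \<le> M" using vM jk x by blast
        show "\<bar>X1 (v j) (v j) x\<bar> \<le> P \<and> \<bar>X1 (v k) (v k) x\<bar> \<le> P" using slope jk x by blast
        have "\<bar>v j x - u x\<bar> \<le> \<zeta>" "\<bar>v k x - u x\<bar> \<le> \<zeta>" using k0 jk x by blast+
        then show "\<bar>v j x - v k x\<bar> \<le> 2 * \<zeta>" by linarith
      qed (rule \<kappa>0)
      also have "\<dots> \<le> \<delta> / 2 + L / \<kappa> * (K1 * (2 * \<zeta>) + K2 * (\<zeta> + \<zeta>))"
        using \<kappa>A K0 \<kappa>0 k0[OF jk(2)] k0[OF jk(4)] by (intro add_mono mult_left_mono) auto
      also have "\<dots> = \<delta> / 2 + B * \<zeta>"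
        by (simp add: B_def algebra_simps)
      finally show ?thesis using B\<zeta> by linarith
    qed
    then show ?thesis by (intro exI[of _ k]) (auto simp: k_def)
  qed
  show ?thesis using slope Cauchy by blast
qed

text \<open>
  The graph of \<open>t \<mapsto> u (t, Y y0 t)\<close> contains no three points in general position. If the collinearity defect \<open>D\<close> were
  nonzero on the leaf through \<open>y0\<close>, it would be at least some \<open>h > 0\<close> on all leaves that start in \<open>{y0..y0+l}\<close>. Cut
  this range into \<open>N\<close> strips of width \<open>\<omega> = l / N\<close>: by \<open>leaf_almost_affine\<close> and up to fixed factors, \<open>h\<close> is bounded in every
  strip by the mean slope error of the strip plus a small constant, and the errors weighted with \<open>\<omega>\<close> sum up to at most twice
  the \<open>L\<^sup>1\<close> distance between the slopes of \<open>v j\<close> and \<open>v k\<close>. This contradicts \<open>l h > 0\<close>.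
\<close>

theorem flow_line_collinear:
  assumes "flow_box \<Omega> u t0 y0 \<tau> \<sigma> \<rho> Y"
    and xyz: "x \<in> {t0-\<tau>..t0+\<tau>}" "y \<in> {t0-\<tau>..t0+\<tau>}" "z \<in> {t0-\<tau>..t0+\<tau>}"
  shows "(u (y, Y y0 y) - u (x, Y y0 x)) * (z - x) = (u (z, Y y0 z) - u (x, Y y0 x)) * (y - x)"
proof (rule ccontr)
  assume neq: "\<not> ?thesis"
  interpret flow_box \<Omega> u t0 y0 \<tau> \<sigma> \<rho> Y by fact
  let ?I = "{t0-\<tau>..t0+\<tau>}" and ?S = "{y0-\<sigma>..y0+\<sigma>}" and ?R = "cbox (t0 - \<tau>, y0 - \<rho>) (t0 + \<tau>, y0 + \<rho>)"
  note R = box and y0S = centre_in(1) and inR = in_box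
  define H where "H s t = u (t, Y s t)" for s t
  define D where "D s = (H s y - H s x) * (z - x) - (H s z - H s x) * (y - x)" for s
  define h where "h = \<bar>D y0\<bar> / 2"
  have h0: "0 < h" using neq by (simp add: h_def D_def H_def)
  have diffs: "\<bar>z - x\<bar> \<le> 2 * \<tau>" "\<bar>y - x\<bar> \<le> 2 * \<tau>" using xyz by auto
  have ab: "t0 - \<tau> \<le> t0 + \<tau>" using pos by simp
  have cd: "y0 - \<rho> \<le> y0 + \<rho>" using range[OF y0S xyz(1)] by auto
  (* l is chosen so that the defect changes by at most h, that is by half of its value at y0 *)
  define l where "l = min \<sigma> (h / (16 * C * \<tau> + 1))"
  have den: "0 < 16 * C * \<tau> + 1" using C_nonneg pos by (simp add: add_nonneg_pos)
  have l0: "0 < l" "l \<le> \<sigma>" using pos h0 den by (auto simp: l_def)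
  have l1: "16 * C * \<tau> * l \<le> h"
  proof -
    have "16 * C * \<tau> * l \<le> (16 * C * \<tau> + 1) * (h / (16 * C * \<tau> + 1))"
      using C_nonneg pos l0 by (intro mult_mono) (auto simp: l_def)
    also have "\<dots> = h" using den by simp
    finally show ?thesis .
  qed
  have D_ge: "h \<le> \<bar>D s\<bar>" if s: "s \<in> {y0..y0+l}" for s
  proof -
    have sS: "s \<in> ?S" using s l0 pos by auto
    have HH: "\<bar>H s t - H y0 t\<bar> \<le> 2 * C * l" if t: "t \<in> ?I" for t
    proof -
      have "\<bar>H s t - H y0 t\<bar> \<le> C * \<bar>Y s t - Y y0 t\<bar>"
        using lipschitz_onD[OF lip_u subsetD[OF R inR[OF sS t]] subsetD[OF R inR[OF y0S t]]]
        by (simp add: H_def dist_Pair_Pair dist_real_def)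
      also have "\<dots> \<le> C * (2 * l)"
        using sep[OF y0S sS _ t] s C_nonneg by (intro mult_left_mono) auto
      finally show ?thesis by simp
    qed
    have b: "\<bar>(H s t - H s x) - (H y0 t - H y0 x)\<bar> \<le> 4 * C * l" if "t \<in> ?I" for t
      using HH[OF that] HH[OF xyz(1)] by linarith
    have "D s - D y0 = ((H s y - H s x) - (H y0 y - H y0 x)) * (z - x) - ((H s z - H s x) - (H y0 z - H y0 x)) * (y - x)"
      by (simp add: D_def algebra_simps)
    also have "\<bar>\<dots>\<bar> \<le> 2 * ((4 * C * l) * (2 * \<tau>))"
      by (intro abs_cross_difference_le b xyz diffs)
    also have "\<dots> = 16 * C * \<tau> * l" by simp
    finally have "\<bar>D s - D y0\<bar> \<le> h" using l1 by linarith
    moreover have "\<bar>D y0\<bar> = 2 * h" by (simp add: h_def)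
    ultimately show ?thesis by linarith
  qed
  obtain P J where PJ: "\<forall>j\<ge>J. \<forall>x\<in>?R. \<bar>X1 (v j) (v j) x\<bar> \<le> P"
    and Cauchy: "\<forall>\<delta>>0. \<exists>k\<ge>J. \<forall>j\<ge>k. integral ?R (\<lambda>x. \<bar>X1 (v j) (v j) x - X1 (v k) (v k) x\<bar>) \<le> \<delta>"
    using slopes_L1_Cauchy[OF R ab cd] by (elim exE conjE) (rule that)
  have P: "\<bar>X1 (v j) (v j) x\<bar> \<le> P" if "j \<ge> J" "x \<in> ?R" for j x
    using PJ that by blast
  define L where "L = sqrt (1 + P\<^sup>2) ^ 3"
  have L0: "0 \<le> L" by (simp add: L_def)
  define \<alpha> where "\<alpha> = 1 + L + 4 * \<tau> * L * C"
  have \<alpha>0: "0 < \<alpha>" using L0 C_nonneg pos by (simp add: \<alpha>_def add_pos_nonneg)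
  (* B1, B2, B3, B4 are the factors of \<zeta>, \<omega>, \<eta> and \<eta> / \<omega> in the bound of leaf_almost_affine *)
  define B1 where "B1 = (1 + L) * 2 * \<tau> + 8 * L * C * \<tau>\<^sup>2"
  define B2 where "B2 = 8 * \<tau> * C\<^sup>2 + 4 * C"
  define B3 where "B3 = 2 * \<tau> * L + 8 * L * C * \<tau>\<^sup>2 + 2 * \<tau> * C + 2"
  define B4 where "B4 = 48 * L * \<tau>\<^sup>2"
  define B where "B = B1 + B2 + B3 + B4"
  have B_nonneg: "0 \<le> B1" "0 \<le> B2" "2 \<le> B3" "0 \<le> B4"
    using L0 C_nonneg pos by (auto simp: B1_def B2_def B3_def B4_def)
  then have B0: "0 < B" by (simp add: B_def)
  define \<zeta> where "\<zeta> = h / (64 * \<tau> * B)"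
  have \<zeta>0: "0 < \<zeta>" using h0 pos B0 by (simp add: \<zeta>_def)
  define \<delta> where "\<delta> = l * h / (32 * \<tau> * \<alpha>)"
  have \<delta>0: "0 < \<delta>" using h0 pos \<alpha>0 l0 by (simp add: \<delta>_def)
  obtain k where k: "k \<ge> J"
    and kj: "\<And>j. j \<ge> k \<Longrightarrow> integral ?R (\<lambda>x. \<bar>X1 (v j) (v j) x - X1 (v k) (v k) x\<bar>) \<le> \<delta>"
    using Cauchy[rule_format, OF \<delta>0] by (elim exE conjE) (rule that, blast+)
  let ?r = "X1 (v k) (v k)"
  have rc: "continuous_on ?R ?r"
    by (rule continuous_on_subset[OF Ck_on_1_continuous[OF C1_slope[OF smooth]] R])
  then have "uniformly_continuous_on ?R ?r" by (rule compact_uniformly_continuous) simp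
  then have "\<exists>m>0. \<forall>x\<in>?R. \<forall>x'\<in>?R. dist x' x < m \<longrightarrow> dist (?r x') (?r x) < \<zeta>"
    using \<zeta>0 unfolding uniformly_continuous_on_def by blast
  then obtain m where m: "m > 0" "\<forall>x\<in>?R. \<forall>x'\<in>?R. dist x' x < m \<longrightarrow> dist (?r x') (?r x) < \<zeta>"
    by (elim exE conjE) (rule that)
  obtain N :: nat where N: "N > 0" "l / real N \<le> \<zeta>" "2 * (l / real N) < m"
  proof -
    obtain N :: nat where N: "real N > max (l / \<zeta>) (2 * l / m)" using reals_Archimedean2 by blast
    have "0 < l / \<zeta>" using l0 \<zeta>0 by simp
    moreover have N': "l / \<zeta> < real N" "2 * l / m < real N" using N by auto
    ultimately have N0: "real N > 0" by linarith
    note N'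
    then have "l < real N * \<zeta>" "2 * l < real N * m" using \<zeta>0 m(1) by (simp_all add: pos_divide_less_eq)
    then show ?thesis using N0 by (intro that[of N]) (auto simp: pos_divide_le_eq pos_divide_less_eq mult.commute)
  qed
  define \<omega> where "\<omega> = l / real N"
  have \<omega>0: "0 < \<omega>" using N l0 by (simp add: \<omega>_def)
  have N\<omega>: "real N * \<omega> = l" using N by (simp add: \<omega>_def)
  (* the error \<eta> / \<omega> forces the approximation to be chosen after the number of strips *)
  define \<eta> where "\<eta> = min \<zeta> (\<zeta> * \<omega>)"
  have \<eta>0: "0 < \<eta>" using \<zeta>0 \<omega>0 by (simp add: \<eta>_def)
  obtain J1 where J1: "\<And>j. j \<ge> J1 \<Longrightarrow> \<epsilon> j \<le> min 1 (\<eta> / (C + 1)) \<and> (\<forall>x\<in>?R. \<bar>v j x - u x\<bar> \<le> min 1 (\<eta> / (C + 1)))"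
    using eventually_close[OF compact_cbox R, of "min 1 (\<eta> / (C + 1))"] \<eta>0 C_nonneg unfolding eventually_sequentially by auto
  define j where "j = max k J1"
  have jk: "j \<ge> k" "j \<ge> J" "j \<ge> J1" using k by (auto simp: j_def)
  have \<eta>C: "\<eta> / (C + 1) \<le> \<eta>" "\<eta> / (C + 1) * C \<le> \<eta>"
    using \<eta>0 C_nonneg by (simp_all add: pos_divide_le_eq field_simps)
  have ej: "\<epsilon> j \<le> 1" "\<epsilon> j * C \<le> \<eta>"
    using J1[OF jk(3)] mult_right_mono[of "\<epsilon> j" "\<eta> / (C + 1)" C] C_nonneg \<eta>C by auto
  have close_j: "\<bar>v j x - u x\<bar> \<le> \<eta>" if "x \<in> ?R" for x
    using J1[OF jk(3)] that \<eta>C(1) by force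
  let ?\<Phi> = "\<lambda>x. \<bar>X1 (v j) (v j) x - ?r x\<bar>"
  define s where "s i = y0 + real i * \<omega>" for i
  have sS: "s i \<in> {y0..y0+l}" "s i \<in> ?S" if "i \<le> N" for i
  proof -
    have "real i * \<omega> \<le> real N * \<omega>" using that \<omega>0 by (intro mult_right_mono) auto
    then have "real i * \<omega> \<le> l" unfolding N\<omega> .
    moreover have "0 \<le> real i * \<omega>" using \<omega>0 by simp
    ultimately show "s i \<in> {y0..y0+l}" "s i \<in> ?S" unfolding s_def atLeastAtMost_iff using l0 pos by linarith+
  qed
  have s_step: "s (Suc i) - s i = \<omega>" for i by (simp add: s_def algebra_simps)
  define e where "e i t = integral {0..1} (\<lambda>\<theta>. ?\<Phi> (t, Y (s i) t + \<theta> * (Y (s (Suc i)) t - Y (s i) t)))" for i t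
  have widths: "\<omega> / 2 \<le> Y (s (Suc i)) t - Y (s i) t \<and> Y (s (Suc i)) t - Y (s i) t \<le> 2 * \<omega>" if "i < N" "t \<in> ?I" for i t
    using sep[OF sS(2) sS(2) _ that(2), of i "Suc i"] s_step[of i] that \<omega>0 by simp
  define Z where "Z = B * (4 * \<zeta>)"
  have strip: "continuous_on ?I (e i) \<and> h \<le> 4 * \<tau> * (\<alpha> * integral ?I (e i) + Z)" if i: "i < N" for i
  proof -
    have iS: "s i \<in> ?S" "s (Suc i) \<in> ?S" using sS i by auto
    interpret S: thin_strip \<Omega> u "v j" ?r "\<epsilon> j" C P \<eta> \<zeta> \<omega> "t0 - \<tau>" "t0 + \<tau>" "y0 - \<rho>" "y0 + \<rho>" "Y (s i)" "Y (s (Suc i))"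
    proof
      show "open \<Omega>" "?R \<subseteq> \<Omega>" "smooth_on_plane \<Omega> (v j)" "regularized_minimal_graph \<Omega> (\<epsilon> j) (v j)" "0 \<le> \<epsilon> j"
        "C-lipschitz_on \<Omega> u" "C-lipschitz_on \<Omega> (v j)"
        using open_domain R smooth minimal eps_pos lip_u lip_v by (auto intro: less_imp_le)
      show "y0 - \<rho> \<le> Y (s i) t \<and> Y (s (Suc i)) t \<le> y0 + \<rho>" if "t \<in> ?I" for t
        using range[OF iS(1) that] range[OF iS(2) that] by auto
      show "\<bar>?r (t, x) - ?r (t, y)\<bar> \<le> \<zeta>"
        if "(t, x) \<in> ?R" "(t, y) \<in> ?R" "\<bar>x - y\<bar> \<le> 2 * \<omega>" for t x y
      proof -
        have "dist (t, x) (t, y) < m" using that(3) N(3) by (simp add: dist_Pair_Pair dist_real_def \<omega>_def)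
        from m(2)[rule_format, OF that(2,1) this] show ?thesis by (simp add: dist_real_def)
      qed
    qed (use ej P jk k close_j deriv iS widths[OF i] \<omega>0 rc in auto)
    have eS: "S.e = e i"
      by (rule ext) (simp add: S.e_def S.avg_def S.pt_def S.w_def e_def)
    let ?E = "integral ?I (e i)"
    let ?K = "(1 + L) * (?E + \<zeta> * (2 * \<tau>)) + 2 * \<tau> * (L * (\<eta> + (2 * C * (?E + 2 * \<tau> * (\<zeta> + \<eta>)) + 2 * \<tau> * (12 * \<eta> / \<omega>))) + C * (\<eta> + 4 * C * \<omega>)) + 2 * (\<eta> + 2 * C * \<omega>)"
    have length: "t0 + \<tau> - (t0 - \<tau>) = 2 * \<tau>" by simp
    have "\<exists>q. \<forall>t\<in>?I. \<bar>H (s i) t - H (s i) x - q * (t - x)\<bar> \<le> ?K"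
      using S.leaf_almost_affine[OF xyz(1)] unfolding S.\<Delta>_def S.E_def eS length L_def H_def .
    then obtain q where "\<forall>t\<in>?I. \<bar>H (s i) t - H (s i) x - q * (t - x)\<bar> \<le> ?K"
      by (elim exE) (rule that)
    then have q: "\<bar>H (s i) t - H (s i) x - q * (t - x)\<bar> \<le> ?K" if "t \<in> ?I" for t
      using that by (rule bspec)
    have "h \<le> \<bar>D (s i)\<bar>" using i by (intro D_ge sS) simp
    also have "D (s i) = (H (s i) y - H (s i) x - q * (y - x)) * (z - x) - (H (s i) z - H (s i) x - q * (z - x)) * (y - x)"
      by (simp add: D_def algebra_simps)
    also have "\<bar>\<dots>\<bar> \<le> 2 * (?K * (2 * \<tau>))"
      by (intro abs_cross_difference_le q xyz diffs)
    also have "\<dots> = 4 * \<tau> * ?K" by simp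
    also have "?K = \<alpha> * ?E + (B1 * \<zeta> + B2 * \<omega> + B3 * \<eta> + B4 * (\<eta> / \<omega>))"
      by (simp add: \<alpha>_def B1_def B2_def B3_def B4_def algebra_simps power2_eq_square add_divide_distrib)
    also have "4 * \<tau> * (\<alpha> * ?E + (B1 * \<zeta> + B2 * \<omega> + B3 * \<eta> + B4 * (\<eta> / \<omega>))) \<le> 4 * \<tau> * (\<alpha> * ?E + Z)"
    proof -
      have "\<eta> / \<omega> \<le> \<zeta>" "\<eta> \<le> \<zeta>" using \<omega>0 by (simp_all add: \<eta>_def pos_divide_le_eq)
      moreover have "\<omega> \<le> \<zeta>" using N(2) by (simp only: \<omega>_def)
      ultimately have "B1 * \<zeta> + B2 * \<omega> + B3 * \<eta> + B4 * (\<eta> / \<omega>) \<le> B1 * \<zeta> + B2 * \<zeta> + B3 * \<zeta> + B4 * \<zeta>"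
        using B_nonneg by (intro add_mono mult_left_mono) auto
      also have "\<dots> = B * \<zeta>" by (simp add: B_def algebra_simps)
      also have "\<dots> \<le> Z" using B0 \<zeta>0 by (simp add: Z_def)
      finally show ?thesis using pos by (intro mult_left_mono) auto
    qed
    finally show ?thesis using S.continuous_e eS by simp
  qed
  have \<Phi>c: "continuous_on ?R ?\<Phi>"
    by (intro continuous_intros rc continuous_on_subset[OF Ck_on_1_continuous[OF C1_slope[OF smooth]] R])
  have total: "\<omega> * (\<Sum>i<N. integral ?I (e i)) \<le> 2 * \<delta>"
  proof -
    have inner: "\<omega> * (\<Sum>i<N. e i t) \<le> 2 * integral {y0-\<rho>..y0+\<rho>} (\<lambda>x. ?\<Phi> (t, x))" if t: "t \<in> ?I" for t
    proof -
      have e0: "0 \<le> e i t" if "i < N" for i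
      proof (cases "(\<lambda>\<theta>. ?\<Phi> (t, Y (s i) t + \<theta> * (Y (s (Suc i)) t - Y (s i) t))) integrable_on {0..1}")
        case True
        then show ?thesis unfolding e_def by (rule integral_nonneg) simp
      next
        case False
        then show ?thesis by (simp add: e_def not_integrable_integral)
      qed
      have "\<omega> * (\<Sum>i<N. e i t) = 2 * (\<Sum>i<N. (\<omega> / 2) * e i t)"
        by (simp add: sum_distrib_left)
      also have "\<dots> \<le> 2 * (\<Sum>i<N. (Y (s (Suc i)) t - Y (s i) t) * e i t)"
        using widths[OF _ t] e0 by (intro mult_left_mono sum_mono mult_right_mono) auto
      also have "\<dots> \<le> 2 * integral {y0-\<rho>..y0+\<rho>} (\<lambda>x. ?\<Phi> (t, x))"
        unfolding e_def
      proof (intro mult_left_mono sum_strip_averages_le[where F = "\<lambda>i. Y (s i) t"])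
        show "continuous_on {y0-\<rho>..y0+\<rho>} (\<lambda>x. ?\<Phi> (t, x))"
          by (rule continuous_on_compose2[OF \<Phi>c], intro continuous_intros) (use t in \<open>auto simp: cbox_Pair_eq\<close>)
        show "Y (s i) t \<in> {y0-\<rho>..y0+\<rho>}" if "i \<le> N" for i using range[OF sS(2)[OF that] t] .
        show "Y (s i) t \<le> Y (s (Suc i)) t" if "i < N" for i using widths[OF that t] \<omega>0 by linarith
      qed auto
      finally show ?thesis .
    qed
    have ei: "e i integrable_on ?I" if "i < N" for i
      using strip[OF that] by (intro integrable_continuous_interval) blast
    have "\<omega> * (\<Sum>i<N. integral ?I (e i)) = integral ?I (\<lambda>t. \<omega> * (\<Sum>i<N. e i t))"
    proof -
      have "integral ?I (\<lambda>t. \<Sum>i<N. e i t) = (\<Sum>i<N. integral ?I (e i))"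
        by (rule integral_sum) (use ei in auto)
      then show ?thesis by simp
    qed
    also have "\<dots> \<le> integral ?I (\<lambda>t. 2 * integral {y0-\<rho>..y0+\<rho>} (\<lambda>x. ?\<Phi> (t, x)))"
    proof (rule integral_le[OF _ _ inner])
      show "(\<lambda>t. \<omega> * (\<Sum>i<N. e i t)) integrable_on ?I"
        using ei by (intro integrable_on_mult_right integrable_sum) auto
      show "(\<lambda>t. 2 * integral {y0-\<rho>..y0+\<rho>} (\<lambda>x. ?\<Phi> (t, x))) integrable_on ?I"
        using integral_integrable_2dim[OF \<Phi>c] by (intro integrable_on_mult_right) simp
    qed
    also have "\<dots> = 2 * integral ?R ?\<Phi>"
      using integral_prod_continuous[OF \<Phi>c] by simp
    also have "\<dots> \<le> 2 * \<delta>" using kj[OF jk(1)] by simp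
    finally show ?thesis .
  qed
  have "l * h = \<omega> * (\<Sum>i<N. h)" using N\<omega> by (simp add: mult.commute mult.left_commute)
  also have "\<dots> \<le> \<omega> * (\<Sum>i<N. 4 * \<tau> * (\<alpha> * integral ?I (e i) + Z))"
    using strip \<omega>0 by (intro mult_left_mono sum_mono) auto
  also have "\<dots> = 4 * \<tau> * \<alpha> * (\<omega> * (\<Sum>i<N. integral ?I (e i))) + 4 * \<tau> * Z * (real N * \<omega>)"
    by (simp add: sum_distrib_left sum.distrib algebra_simps)
  also have "\<dots> \<le> 4 * \<tau> * \<alpha> * (2 * \<delta>) + 4 * \<tau> * Z * l"
    using total pos \<alpha>0 unfolding N\<omega> by (intro add_right_mono mult_left_mono) auto
  also have "4 * \<tau> * \<alpha> * (2 * \<delta>) = l * h / 4"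
    using pos \<alpha>0 by (simp add: \<delta>_def)
  also have "4 * \<tau> * Z * l = l * h / 4"
    using pos B0 by (simp add: Z_def \<zeta>_def)
  finally have "l * h \<le> l * h / 2" by simp
  moreover have "0 < l * h" using l0 h0 by simp
  ultimately show False by (simp add: mult.commute)
qed

end

section \<open>Maximal integral curves\<close>

lemma integral_curve_open: "integral_curve X \<Omega> \<gamma> I \<Longrightarrow> open I"
  and integral_curve_in: "integral_curve X \<Omega> \<gamma> I \<Longrightarrow> t \<in> I \<Longrightarrow> \<gamma> t \<in> \<Omega>"
  and integral_curve_deriv: "integral_curve X \<Omega> \<gamma> I \<Longrightarrow> t \<in> I \<Longrightarrow> (\<gamma> has_vector_derivative X (\<gamma> t)) (at t)"
  by (auto simp: integral_curve_def)

lemma maximal_imp_integral_curve: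
  "maximal_integral_curve X \<Omega> \<gamma> I \<Longrightarrow> integral_curve X \<Omega> \<gamma> I"
  unfolding maximal_integral_curve_def by (rule conjunct1)

lemma integral_curve_convex: "integral_curve X \<Omega> \<gamma> I \<Longrightarrow> convex I" "integral_curve X \<Omega> \<gamma> I \<Longrightarrow> connected I"
  unfolding integral_curve_def by (auto simp: is_interval_convex is_interval_connected)

lemma integral_curve_segment:
  "integral_curve X \<Omega> \<gamma> I \<Longrightarrow> s \<in> I \<Longrightarrow> t \<in> I \<Longrightarrow> {s..t} \<subseteq> I"
  unfolding integral_curve_def is_interval_1 by (meson atLeastAtMost_iff subsetI)

abbreviation "leaf_curve u \<Omega> \<equiv> integral_curve (X1_field u) \<Omega>"
abbreviation "maximal_leaf_curve u \<Omega> \<equiv> maximal_integral_curve (X1_field u) \<Omega>"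

lemma integral_curve_components:
  assumes "leaf_curve u \<Omega> \<gamma> I" "t \<in> I"
  shows "((\<lambda>t. fst (\<gamma> t)) has_real_derivative 1) (at t)"
    and "((\<lambda>t. snd (\<gamma> t)) has_real_derivative u (\<gamma> t)) (at t)"
proof -
  note d = integral_curve_deriv[OF assms]
  show "((\<lambda>t. fst (\<gamma> t)) has_real_derivative 1) (at t)"
    using bounded_linear.has_vector_derivative[OF bounded_linear_fst d]
    by (simp add: X1_field_def has_real_derivative_iff_has_vector_derivative)
  show "((\<lambda>t. snd (\<gamma> t)) has_real_derivative u (\<gamma> t)) (at t)"
    using bounded_linear.has_vector_derivative[OF bounded_linear_snd d]
    by (simp add: X1_field_def has_real_derivative_iff_has_vector_derivative)
qed

lemma integral_curve_first_coordinate: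
  assumes \<gamma>: "leaf_curve u \<Omega> \<gamma> I" and st: "s \<in> I" "t \<in> I"
  shows "fst (\<gamma> t) - fst (\<gamma> s) = t - s"
proof -
  have d: "((\<lambda>t. fst (\<gamma> t) - t) has_real_derivative 0) (at x within I)" if "x \<in> I" for x
    using DERIV_diff[OF integral_curve_components(1)[OF \<gamma> that] DERIV_ident]
    by (auto intro: has_field_derivative_at_within)
  have "\<exists>c. \<forall>x\<in>I. fst (\<gamma> x) - x = c"
    by (rule has_field_derivative_zero_constant[OF integral_curve_convex(1)[OF \<gamma>] d])
  then obtain c where c: "\<And>x. x \<in> I \<Longrightarrow> fst (\<gamma> x) - x = c" by blast
  show ?thesis using c[OF st(1)] c[OF st(2)] by linarith
qed

lemma integral_curve_unique:
  assumes lip: "C-lipschitz_on \<Omega> u"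
    and \<gamma>: "leaf_curve u \<Omega> \<gamma> I" and \<sigma>: "leaf_curve u \<Omega> \<sigma> J"
    and s: "s \<in> I" "s \<in> J" "\<gamma> s = \<sigma> s" and t: "t \<in> I" "t \<in> J"
  shows "\<gamma> t = \<sigma> t"
proof -
  let ?D = "\<lambda>t. snd (\<gamma> t) - snd (\<sigma> t)"
  have fst_eq: "fst (\<gamma> x) = fst (\<sigma> x)" if "x \<in> I" "x \<in> J" for x
    using integral_curve_first_coordinate[OF \<gamma> s(1) that(1)] integral_curve_first_coordinate[OF \<sigma> s(2) that(2)] s(3)
    by simp
  have D: "(?D has_real_derivative u (\<gamma> x) - u (\<sigma> x)) (at x within A)" if "x \<in> I" "x \<in> J" for x A
    using DERIV_diff[OF integral_curve_components(2)[OF \<gamma> that(1)] integral_curve_components(2)[OF \<sigma> that(2)]]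
    by (rule has_field_derivative_at_within)
  have B: "\<bar>u (\<gamma> x) - u (\<sigma> x)\<bar> \<le> C * \<bar>?D x\<bar>" if "x \<in> I" "x \<in> J" for x
  proof -
    have "dist (\<gamma> x) (\<sigma> x) = \<bar>?D x\<bar>"
      using fst_eq[OF that] by (cases "\<gamma> x"; cases "\<sigma> x") (simp add: dist_Pair_Pair dist_real_def)
    then show ?thesis
      using lipschitz_onD[OF lip integral_curve_in[OF \<gamma> that(1)] integral_curve_in[OF \<sigma> that(2)]]
      by (simp add: dist_real_def)
  qed
  have "?D t = 0"
  proof (cases "s \<le> t")
    case True
    have sub: "{s..t} \<subseteq> I" "{s..t} \<subseteq> J"
      using integral_curve_segment[OF \<gamma>] integral_curve_segment[OF \<sigma>] s t by auto
    have "\<bar>?D t\<bar> \<le> exp (C * (t - s)) * \<bar>?D s\<bar>"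
      by (rule gronwall_interval(1)[OF True D B]) (use sub in auto)
    then show ?thesis using s(3) by simp
  next
    case False
    have sub: "{t..s} \<subseteq> I" "{t..s} \<subseteq> J"
      using integral_curve_segment[OF \<gamma>] integral_curve_segment[OF \<sigma>] s t by auto
    have "t \<le> s" using False by simp
    have "\<bar>?D t\<bar> \<le> exp (C * (s - t)) * \<bar>?D s\<bar>"
      by (rule gronwall_interval(2)[OF \<open>t \<le> s\<close> D B]) (use sub in auto)
    then show ?thesis using s(3) by simp
  qed
  then show ?thesis using fst_eq[OF t] by (simp add: prod_eq_iff)
qed

lemma integral_curve_translate:
  assumes \<gamma>: "integral_curve X \<Omega> \<gamma> I"
  shows "integral_curve X \<Omega> (\<lambda>t. \<gamma> (t + c)) {t. t + c \<in> I}"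
proof -
  obtain i where i: "i \<in> I" using \<gamma> by (auto simp: integral_curve_def)
  then have "i - c \<in> {t. t + c \<in> I}" by simp
  then have "{t. t + c \<in> I} \<noteq> {}" by blast
  moreover have "open ((\<lambda>t. t + c) -` I)"
    by (intro open_vimage integral_curve_open[OF \<gamma>] continuous_intros)
  then have "open {t. t + c \<in> I}" by (simp add: vimage_def)
  moreover have "is_interval {t. t + c \<in> I}"
  proof -
    have "is_interval I" using \<gamma> by (simp add: integral_curve_def)
    then have *: "p \<in> I" if "q \<in> I" "r \<in> I" "q \<le> p" "p \<le> r" for p q r
      using that unfolding is_interval_1 by blast
    show ?thesis
      unfolding is_interval_1
    proof (intro ballI allI impI)
      fix q r p assume "q \<in> {t. t + c \<in> I}" "r \<in> {t. t + c \<in> I}" "q \<le> p \<and> p \<le> r"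
      then show "p \<in> {t. t + c \<in> I}" using *[of "q + c" "r + c" "p + c"] by simp
    qed
  qed
  moreover have "((\<lambda>t. \<gamma> (t + c)) has_vector_derivative X (\<gamma> (t + c))) (at t)" if "t + c \<in> I" for t
  proof -
    have "((\<lambda>t. t + c) has_real_derivative 1) (at t)" by (auto intro!: derivative_eq_intros)
    from vector_diff_chain_at[OF this[unfolded has_real_derivative_iff_has_vector_derivative] integral_curve_deriv[OF \<gamma> that]]
    show ?thesis by (simp add: o_def)
  qed
  ultimately show ?thesis
    using integral_curve_in[OF \<gamma>] unfolding integral_curve_def by auto
qed

lemma integral_curve_glue:
  assumes lip: "C-lipschitz_on \<Omega> u"
    and \<gamma>: "leaf_curve u \<Omega> \<gamma> I" and \<sigma>: "leaf_curve u \<Omega> \<sigma> J"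
    and s: "s \<in> I" "s \<in> J" "\<gamma> s = \<sigma> s"
  shows "leaf_curve u \<Omega> (\<lambda>t. if t \<in> I then \<gamma> t else \<sigma> t) (I \<union> J)"
proof -
  let ?\<delta> = "\<lambda>t. if t \<in> I then \<gamma> t else \<sigma> t"
  have J: "?\<delta> t = \<sigma> t" if "t \<in> J" for t
    using integral_curve_unique[OF lip \<gamma> \<sigma> s _ that] by auto
  have "(?\<delta> has_vector_derivative X1_field u (?\<delta> t)) (at t)" if "t \<in> I \<union> J" for t
  proof (cases "t \<in> I")
    case True
    have "(?\<delta> has_vector_derivative X1_field u (\<gamma> t)) (at t)"
      by (rule has_vector_derivative_transform_within_open[OF integral_curve_deriv[OF \<gamma> True] integral_curve_open[OF \<gamma>] True]) simp
    then show ?thesis using True by simp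
  next
    case False
    with that have t: "t \<in> J" by simp
    have "(?\<delta> has_vector_derivative X1_field u (\<sigma> t)) (at t)"
      by (rule has_vector_derivative_transform_within_open[OF integral_curve_deriv[OF \<sigma> t] integral_curve_open[OF \<sigma>] t]) (simp only: J)
    then show ?thesis using J[OF t] by simp
  qed
  moreover have "is_interval (I \<union> J)"
    using connected_Un[OF integral_curve_convex(2)[OF \<gamma>] integral_curve_convex(2)[OF \<sigma>]] s
    by (auto simp: is_interval_connected_1)
  moreover have "open (I \<union> J)" "I \<union> J \<noteq> {}"
    using integral_curve_open[OF \<gamma>] integral_curve_open[OF \<sigma>] s by auto
  moreover have "?\<delta> ` (I \<union> J) \<subseteq> \<Omega>"
    using integral_curve_in[OF \<gamma>] integral_curve_in[OF \<sigma>] by auto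
  ultimately show ?thesis unfolding integral_curve_def by blast
qed

text \<open>
  Translate the parameter of \<open>\<sigma>\<close> so that the curves agree at one time, glue them, and use maximality.
\<close>

lemma maximal_curve_absorbs:
  assumes lip: "C-lipschitz_on \<Omega> u"
    and \<gamma>: "maximal_leaf_curve u \<Omega> \<gamma> I" and \<sigma>: "leaf_curve u \<Omega> \<sigma> J"
    and st: "t \<in> I" "s \<in> J" "\<gamma> t = \<sigma> s"
  shows "\<sigma> ` J \<subseteq> \<gamma> ` I"
proof -
  note \<gamma>' = maximal_imp_integral_curve[OF \<gamma>]
    and max = \<gamma>[unfolded maximal_integral_curve_def, THEN conjunct2, rule_format]
  let ?\<sigma> = "\<lambda>r. \<sigma> (r + (s - t))" and ?J = "{r. r + (s - t) \<in> J}"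
  have \<sigma>': "leaf_curve u \<Omega> ?\<sigma> ?J" by (rule integral_curve_translate[OF \<sigma>])
  have t: "t \<in> ?J" "\<gamma> t = ?\<sigma> t" using st by simp_all
  have "I \<union> ?J = I"
    by (rule max[of "\<lambda>r. if r \<in> I then \<gamma> r else ?\<sigma> r"])
      (use integral_curve_glue[OF lip \<gamma>' \<sigma>' st(1) t] in auto)
  then have sub: "?J \<subseteq> I" by blast
  show ?thesis
  proof
    fix x assume "x \<in> \<sigma> ` J"
    then obtain r where r: "r \<in> J" "x = \<sigma> r" by blast
    then have r': "r - (s - t) \<in> ?J" by simp
    then have "\<gamma> (r - (s - t)) = ?\<sigma> (r - (s - t))"
      using integral_curve_unique[OF lip \<gamma>' \<sigma>' st(1) t] sub by blast
    then show "x \<in> \<gamma> ` I" using r r' sub by (auto intro!: image_eqI[of _ _ "r - (s - t)"])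
  qed
qed

text \<open>
  The union of all integral curves with the given value at time \<open>s\<close>; they agree wherever two of them are defined.
\<close>

lemma exists_maximal_integral_curve:
  assumes lip: "C-lipschitz_on \<Omega> u"
    and \<gamma>0: "leaf_curve u \<Omega> \<gamma>0 I0" "s \<in> I0" "\<gamma>0 s = x"
  shows "\<exists>\<gamma> I. maximal_leaf_curve u \<Omega> \<gamma> I \<and> s \<in> I \<and> \<gamma> s = x"
proof -
  define Q where "Q \<gamma> I \<longleftrightarrow> leaf_curve u \<Omega> \<gamma> I \<and> s \<in> I \<and> \<gamma> s = x" for \<gamma> I
  define M where "M = \<Union>{I. \<exists>\<gamma>. Q \<gamma> I}"
  define \<Gamma> where "\<Gamma> t = (SOME y. \<exists>\<gamma> I. Q \<gamma> I \<and> t \<in> I \<and> y = \<gamma> t)" for t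
  have \<Gamma>: "\<Gamma> t = \<gamma> t" if Q: "Q \<gamma> I" "t \<in> I" for \<gamma> I t
    unfolding \<Gamma>_def
  proof (rule some_equality)
    show "\<exists>\<gamma>' I. Q \<gamma>' I \<and> t \<in> I \<and> \<gamma> t = \<gamma>' t"
      by (intro exI[of _ \<gamma>] exI[of _ I] conjI Q refl)
    show "y = \<gamma> t" if "\<exists>\<gamma>' I. Q \<gamma>' I \<and> t \<in> I \<and> y = \<gamma>' t" for y
    proof -
      from that obtain \<gamma>' I' where Q': "Q \<gamma>' I'" "t \<in> I'" "y = \<gamma>' t" by blast
      show ?thesis
        using integral_curve_unique[OF lip, of \<gamma> I \<gamma>' I' s t] Q Q' unfolding Q_def by simp
    qed
  qed
  have M_sub: "I \<subseteq> M" if "Q \<gamma> I" for \<gamma> I using that by (auto simp: M_def)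
  have sM: "s \<in> M" using M_sub[of \<gamma>0 I0] \<gamma>0 by (auto simp: Q_def)
  have \<Gamma>s: "\<Gamma> s = x" using \<Gamma>[of \<gamma>0 I0 s] \<gamma>0 by (simp add: Q_def)
  have "leaf_curve u \<Omega> \<Gamma> M"
    unfolding integral_curve_def
  proof (intro conjI ballI)
    show "M \<noteq> {}" using sM by blast
    show "open M" unfolding M_def by (rule open_Union) (auto simp: Q_def integral_curve_def)
    have "connected M"
      unfolding M_def
    proof (rule connected_Union)
      show "connected I" if "I \<in> {I. \<exists>\<gamma>. Q \<gamma> I}" for I
        using that integral_curve_convex(2) unfolding Q_def by blast
      have "s \<in> \<Inter>{I. \<exists>\<gamma>. Q \<gamma> I}" unfolding Q_def by blast
      then show "\<Inter>{I. \<exists>\<gamma>. Q \<gamma> I} \<noteq> {}" by blast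
    qed
    then show "is_interval M" by (simp add: is_interval_connected_1)
    show "\<Gamma> ` M \<subseteq> \<Omega>"
    proof
      fix y assume "y \<in> \<Gamma> ` M"
      then obtain t \<gamma> I where "y = \<Gamma> t" "Q \<gamma> I" "t \<in> I" by (auto simp: M_def)
      then show "y \<in> \<Omega>" using \<Gamma>[of \<gamma> I t] integral_curve_in[of _ \<Omega> \<gamma> I t] by (auto simp: Q_def)
    qed
    fix t assume "t \<in> M"
    then obtain \<gamma> I where Q: "Q \<gamma> I" and t: "t \<in> I" by (auto simp: M_def)
    have \<gamma>: "leaf_curve u \<Omega> \<gamma> I" using Q by (simp add: Q_def)
    have "(\<Gamma> has_vector_derivative X1_field u (\<gamma> t)) (at t)"
      by (rule has_vector_derivative_transform_within_open[OF integral_curve_deriv[OF \<gamma> t] integral_curve_open[OF \<gamma>] t])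
         (simp add: \<Gamma>[OF Q])
    then show "(\<Gamma> has_vector_derivative X1_field u (\<Gamma> t)) (at t)" by (simp add: \<Gamma>[OF Q t])
  qed
  moreover have "J = M" if "leaf_curve u \<Omega> \<sigma> J" "M \<subseteq> J" "\<forall>t\<in>M. \<sigma> t = \<Gamma> t" for \<sigma> J
  proof -
    have "Q \<sigma> J" using that sM \<Gamma>s by (auto simp: Q_def)
    then show ?thesis using M_sub that(2) by blast
  qed
  ultimately show ?thesis
    using sM \<Gamma>s unfolding maximal_integral_curve_def by blast
qed

lemma maximal_curves_same_image:
  assumes lip: "C-lipschitz_on \<Omega> u"
    and \<gamma>: "maximal_leaf_curve u \<Omega> \<gamma> I" and \<sigma>: "maximal_leaf_curve u \<Omega> \<sigma> J"
    and x: "x \<in> \<gamma> ` I" "x \<in> \<sigma> ` J"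
  shows "\<gamma> ` I = \<sigma> ` J"
proof -
  obtain t s where ts: "t \<in> I" "s \<in> J" "\<gamma> t = \<sigma> s" using x by auto
  have c: "leaf_curve u \<Omega> \<gamma> I" "leaf_curve u \<Omega> \<sigma> J"
    by (rule maximal_imp_integral_curve[OF \<gamma>] maximal_imp_integral_curve[OF \<sigma>])+
  show ?thesis
    using maximal_curve_absorbs[OF lip \<gamma> c(2) ts] maximal_curve_absorbs[OF lip \<sigma> c(1) ts(2,1) ts(3)[symmetric]] by blast
qed

section \<open>The foliation\<close>

lemma (in flow_box) flow_line_integral_curve:
  assumes s: "s \<in> S"
  shows "leaf_curve u \<Omega> (\<lambda>t. (t, Y s t)) {t0-\<tau><..<t0+\<tau>}"
  unfolding integral_curve_def
proof (intro conjI ballI)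
  show "{t0-\<tau><..<t0+\<tau>} \<noteq> {}" "open {t0-\<tau><..<t0+\<tau>}" "is_interval {t0-\<tau><..<t0+\<tau>}"
    using pos by (auto simp: is_interval_1)
  show "(\<lambda>t. (t, Y s t)) ` {t0-\<tau><..<t0+\<tau>} \<subseteq> \<Omega>"
  proof
    fix p assume "p \<in> (\<lambda>t. (t, Y s t)) ` {t0-\<tau><..<t0+\<tau>}"
    then obtain t where t: "t \<in> I" "p = (t, Y s t)" by auto
    then show "p \<in> \<Omega>" using in_box[OF s t(1)] box by blast
  qed
  fix t assume t: "t \<in> {t0-\<tau><..<t0+\<tau>}"
  then have "(Y s has_vector_derivative u (t, Y s t)) (at t)"
    using deriv[OF s, of t] by (simp add: at_within_Icc_at has_real_derivative_iff_has_vector_derivative)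
  from has_vector_derivative_Pair[OF has_vector_derivative_id this]
  show "((\<lambda>t. (t, Y s t)) has_vector_derivative X1_field u (t, Y s t)) (at t)"
    by (simp add: X1_field_def)
qed

lemma integral_curve_exists:
  assumes "open \<Omega>" and lip: "C-lipschitz_on \<Omega> u" and x: "x \<in> \<Omega>"
  shows "\<exists>\<gamma> I. maximal_leaf_curve u \<Omega> \<gamma> I \<and> 0 \<in> I \<and> \<gamma> 0 = x"
proof -
  obtain t0 y0 where x': "x = (t0, y0)" by fastforce
  have x0: "(t0, y0) \<in> \<Omega>" using x x' by simp
  obtain \<tau> \<sigma> \<rho> Y where "flow_box \<Omega> u t0 y0 \<tau> \<sigma> \<rho> Y"
    by (rule flow_box_exists[OF assms(1) lip x0])
  then interpret flow_box \<Omega> u t0 y0 \<tau> \<sigma> \<rho> Y .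
  note curve = flow_line_integral_curve[OF centre_in(1)]
  show ?thesis
  proof (rule exists_maximal_integral_curve[OF lip integral_curve_translate[OF curve, of t0]])
    show "0 \<in> {t. t + t0 \<in> {t0-\<tau><..<t0+\<tau>}}" using pos by simp
    show "(0 + t0, Y y0 (0 + t0)) = x" using start[OF centre_in(1)] x' by simp
  qed
qed

lemma leaves_partition:
  assumes "open \<Omega>" and lip: "C-lipschitz_on \<Omega> u"
  shows "partition_on \<Omega> (leaves (X1_field u) \<Omega>)"
proof (rule partition_onI)
  show "\<Union>(leaves (X1_field u) \<Omega>) = \<Omega>"
  proof
    show "\<Union>(leaves (X1_field u) \<Omega>) \<subseteq> \<Omega>"
      unfolding leaves_def using maximal_imp_integral_curve integral_curve_in by blast
    show "\<Omega> \<subseteq> \<Union>(leaves (X1_field u) \<Omega>)"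
    proof
      fix x assume "x \<in> \<Omega>"
      then obtain \<gamma> I where g: "maximal_leaf_curve u \<Omega> \<gamma> I" "0 \<in> I" "\<gamma> 0 = x"
        using integral_curve_exists[OF assms] by blast
      then have "x \<in> \<gamma> ` I" by blast
      with g(1) show "x \<in> \<Union>(leaves (X1_field u) \<Omega>)" unfolding leaves_def by blast
    qed
  qed
  show "disjnt L M" if LM: "L \<in> leaves (X1_field u) \<Omega>" "M \<in> leaves (X1_field u) \<Omega>" "L \<noteq> M" for L M
  proof -
    obtain \<gamma> I \<sigma> J where c: "maximal_leaf_curve u \<Omega> \<gamma> I" "L = \<gamma> ` I"
      "maximal_leaf_curve u \<Omega> \<sigma> J" "M = \<sigma> ` J"
      using LM(1,2) unfolding leaves_def by blast
    show ?thesis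
      using maximal_curves_same_image[OF lip c(1,3)] LM(3) unfolding c(2,4) disjnt_def by blast
  qed
  show "{} \<notin> leaves (X1_field u) \<Omega>"
    using maximal_imp_integral_curve unfolding leaves_def integral_curve_def by blast
qed

lemma leaf_connected:
  assumes "L \<in> leaves (X1_field u) \<Omega>" shows "connected L"
proof -
  obtain \<gamma> I where c: "maximal_leaf_curve u \<Omega> \<gamma> I" "L = \<gamma> ` I"
    using assms unfolding leaves_def by blast
  note \<gamma> = maximal_imp_integral_curve[OF c(1)]
  have "continuous_on I \<gamma>"
    using integral_curve_deriv[OF \<gamma>] by (intro continuous_at_imp_continuous_on ballI has_vector_derivative_continuous)
  then show ?thesis
    unfolding c(2) by (rule connected_continuous_image) (rule integral_curve_convex(2)[OF \<gamma>])
qed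

text \<open>
  The first coordinate is a translation of the parameter, hence injective on a leaf.
\<close>

lemma leaf_graph:
  assumes "L \<in> leaves (X1_field u) \<Omega>" "p \<in> L" "q \<in> L" "fst p = fst q" shows "p = q"
proof -
  obtain \<gamma> I where c: "maximal_leaf_curve u \<Omega> \<gamma> I" "L = \<gamma> ` I"
    using assms(1) unfolding leaves_def by blast
  then obtain s t where st: "s \<in> I" "t \<in> I" "p = \<gamma> s" "q = \<gamma> t" using assms(2,3) by blast
  from integral_curve_first_coordinate[OF maximal_imp_integral_curve[OF c(1)] st(1,2)] assms(4) st(3,4)
  have "s = t" by simp
  then show ?thesis using st by simp
qed

lemma leaf_absorbs:
  assumes lip: "C-lipschitz_on \<Omega> u" and L: "L \<in> leaves (X1_field u) \<Omega>"
    and \<sigma>: "leaf_curve u \<Omega> \<sigma> J" and s: "s \<in> J" "\<sigma> s \<in> L"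
  shows "\<sigma> ` J \<subseteq> L"
proof -
  obtain \<gamma> I where c: "maximal_leaf_curve u \<Omega> \<gamma> I" "L = \<gamma> ` I"
    using L unfolding leaves_def by blast
  then obtain t where t: "t \<in> I" "\<gamma> t = \<sigma> s" using s(2) by force
  show ?thesis unfolding c(2) by (rule maximal_curve_absorbs[OF lip c(1) \<sigma> t(1) s(1) t(2)])
qed

text \<open>
  The chart is the flow box, rescaled to the square; invariance of domain provides openness and the
  continuity of its inverse. A leaf is a graph over the first coordinate, so it contains at most one of the
  horizontal slices, and it contains every slice that it meets.
\<close>

lemma foliation_chart:
  assumes op: "open \<Omega>" and lip: "C-lipschitz_on \<Omega> u" and x: "x \<in> \<Omega>"
  shows "\<exists>U \<phi> \<psi>. open U \<and> x \<in> U \<and> U \<subseteq> \<Omega> \<and>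
        homeomorphism U ({-1<..<1::real} \<times> {-1<..<1::real}) \<phi> \<psi> \<and>
        (\<forall>L\<in>leaves (X1_field u) \<Omega>. \<forall>K\<in>components (L \<inter> U). \<exists>c\<in>{-1<..<1}. \<phi> ` K = {-1<..<1} \<times> {c})"
proof -
  obtain t0 y0 where x': "x = (t0, y0)" by fastforce
  have x0: "(t0, y0) \<in> \<Omega>" using x x' by simp
  obtain \<tau> \<sigma> \<rho> Y where "flow_box \<Omega> u t0 y0 \<tau> \<sigma> \<rho> Y"
    by (rule flow_box_exists[OF op lip x0])
  then interpret flow_box \<Omega> u t0 y0 \<tau> \<sigma> \<rho> Y .
  let ?J = "{-1<..<1::real}"
  define T where "T a = t0 + \<tau> * a" for a
  define V where "V b = y0 + \<sigma> * b" for b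
  define \<psi> where "\<psi> z = (T (fst z), Y (V (snd z)) (T (fst z)))" for z :: plane
  have T_in: "T a \<in> {t0-\<tau><..<t0+\<tau>}" "T a \<in> I" if "a \<in> ?J" for a
  proof -
    have "\<tau> * a < \<tau> * 1" "\<tau> * (-1) < \<tau> * a"
      by (rule mult_strict_left_mono; use that pos in simp)+
    then show "T a \<in> {t0-\<tau><..<t0+\<tau>}" "T a \<in> I"
      unfolding T_def atLeastAtMost_iff greaterThanLessThan_iff by linarith+
  qed
  have V_in: "V b \<in> S" if "b \<in> ?J" for b
  proof -
    have "\<sigma> * b < \<sigma> * 1" "\<sigma> * (-1) < \<sigma> * b"
      by (rule mult_strict_left_mono; use that pos in simp)+
    then show "V b \<in> S" unfolding V_def atLeastAtMost_iff by linarith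
  qed
  obtain M where M: "M > 0" "\<And>z. z \<in> R \<Longrightarrow> \<bar>u z\<bar> \<le> M"
    using lipschitz_on_compact_bounded[OF lip compact_cbox box] by blast
  have Y_space: "\<bar>Y s t - Y r t\<bar> \<le> 2 * \<bar>s - r\<bar>" if "s \<in> S" "r \<in> S" "t \<in> I" for s r t
  proof (cases "s \<le> r")
    case True
    with sep[OF that(1,2) True that(3)] show ?thesis by simp
  next
    case False
    then have "r \<le> s" by simp
    with sep[OF that(2,1) this that(3)] show ?thesis by simp
  qed
  have Y_injective: "s = r" if "s \<in> S" "r \<in> S" "t \<in> I" "Y s t = Y r t" for s r t
  proof (cases "s \<le> r")
    case True
    with sep[OF that(1,2) True that(3)] that(4) show ?thesis by simp
  next
    case False
    then have "r \<le> s" by simp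
    with sep[OF that(2,1) this that(3)] that(4) show ?thesis by simp
  qed
  have Y_time: "\<bar>Y s t - Y s t'\<bar> \<le> M * \<bar>t - t'\<bar>" if "s \<in> S" "t \<in> I" "t' \<in> I" for s t t'
  proof -
    have "norm (Y s t - Y s t') \<le> M * norm (t - t')"
    proof (rule field_differentiable_bound[of I])
      show "(Y s has_field_derivative u (z, Y s z)) (at z within I)" if "z \<in> I" for z
        by (rule deriv) fact+
      show "norm (u (z, Y s z)) \<le> M" if "z \<in> I" for z
        using M(2)[OF in_box] \<open>s \<in> S\<close> that by simp
    qed (use that in auto)
    then show ?thesis by simp
  qed
  have "(\<tau> + (2 * \<sigma> + M * \<tau>))-lipschitz_on (?J \<times> ?J) \<psi>"
  proof (rule lipschitz_onI)
    fix z z' assume z: "z \<in> ?J \<times> ?J" "z' \<in> ?J \<times> ?J"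
    let ?a = "fst z" and ?b = "snd z" and ?a' = "fst z'" and ?b' = "snd z'"
    have da: "\<bar>?a - ?a'\<bar> \<le> dist z z'" "\<bar>?b - ?b'\<bar> \<le> dist z z'"
      using dist_fst_le[of z z'] dist_snd_le[of z z'] by (simp_all add: dist_real_def)
    have i: "?a \<in> ?J" "?b \<in> ?J" "?a' \<in> ?J" "?b' \<in> ?J" using z by auto
    have "\<bar>T ?a - T ?a'\<bar> = \<tau> * \<bar>?a - ?a'\<bar>" "\<bar>V ?b - V ?b'\<bar> = \<sigma> * \<bar>?b - ?b'\<bar>"
    proof -
      have "T ?a - T ?a' = \<tau> * (?a - ?a')" "V ?b - V ?b' = \<sigma> * (?b - ?b')"
        by (simp_all add: T_def V_def right_diff_distrib)
      then show "\<bar>T ?a - T ?a'\<bar> = \<tau> * \<bar>?a - ?a'\<bar>" "\<bar>V ?b - V ?b'\<bar> = \<sigma> * \<bar>?b - ?b'\<bar>"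
        using pos by (simp_all add: abs_mult)
    qed
    then have TV: "\<bar>T ?a - T ?a'\<bar> \<le> \<tau> * dist z z'" "\<bar>V ?b - V ?b'\<bar> \<le> \<sigma> * dist z z'"
      using da pos by (simp_all add: mult_left_mono)
    have "dist (\<psi> z) (\<psi> z') \<le> \<bar>T ?a - T ?a'\<bar> + \<bar>Y (V ?b) (T ?a) - Y (V ?b') (T ?a')\<bar>"
      by (simp add: \<psi>_def dist_Pair_Pair dist_real_def sqrt_sum_squares_le_sum_abs)
    also have "\<bar>Y (V ?b) (T ?a) - Y (V ?b') (T ?a')\<bar> \<le> 2 * \<bar>V ?b - V ?b'\<bar> + M * \<bar>T ?a - T ?a'\<bar>"
      using Y_space[OF V_in V_in T_in(2), of ?b ?b' ?a] Y_time[OF V_in T_in(2) T_in(2), of ?b' ?a ?a'] i by linarith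
    also have "\<bar>T ?a - T ?a'\<bar> + (2 * \<bar>V ?b - V ?b'\<bar> + M * \<bar>T ?a - T ?a'\<bar>)
        \<le> \<tau> * dist z z' + (2 * (\<sigma> * dist z z') + M * (\<tau> * dist z z'))"
      using TV M(1) by (intro add_mono mult_left_mono) auto
    also have "\<dots> = (\<tau> + (2 * \<sigma> + M * \<tau>)) * dist z z'" by (simp add: algebra_simps)
    finally show "dist (\<psi> z) (\<psi> z') \<le> (\<tau> + (2 * \<sigma> + M * \<tau>)) * dist z z'" by simp
  qed (use pos M in simp)
  then have \<psi>c: "continuous_on (?J \<times> ?J) \<psi>" by (rule lipschitz_on_continuous_on)
  have \<psi>inj: "inj_on \<psi> (?J \<times> ?J)"
  proof (rule inj_onI)
    fix z z' assume z: "z \<in> ?J \<times> ?J" "z' \<in> ?J \<times> ?J" and eq: "\<psi> z = \<psi> z'"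
    have a: "fst z = fst z'" using eq pos by (simp add: \<psi>_def T_def)
    have Yeq: "Y (V (snd z)) (T (fst z)) = Y (V (snd z')) (T (fst z))" using eq a by (simp add: \<psi>_def)
    have i: "V (snd z) \<in> S" "V (snd z') \<in> S" "T (fst z) \<in> I" using z V_in T_in(2) by auto
    have "V (snd z) = V (snd z')"
      by (rule Y_injective[OF i Yeq])
    then have "snd z = snd z'" using pos by (simp add: V_def)
    then show "z = z'" using a by (simp add: prod_eq_iff)
  qed
  have open_box: "open (?J \<times> ?J)" by (intro open_Times) auto
  define U where "U = \<psi> ` (?J \<times> ?J)"
  have U_open: "open U" unfolding U_def by (rule invariance_of_domain[OF \<psi>c open_box \<psi>inj])
  obtain \<phi> where "homeomorphism (?J \<times> ?J) (\<psi> ` (?J \<times> ?J)) \<psi> \<phi>"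
    by (rule invariance_of_domain_homeomorphism[OF open_box \<psi>c order_refl \<psi>inj])
  then have hom: "homeomorphism U (?J \<times> ?J) \<phi> \<psi>" unfolding U_def by (rule homeomorphism_symD)
  have \<phi>\<psi>: "\<phi> (\<psi> z) = z" if "z \<in> ?J \<times> ?J" for z
    using homeomorphism_apply2[OF hom that] .
  have U_sub: "U \<subseteq> \<Omega>"
  proof
    fix p assume "p \<in> U"
    then obtain z where z: "z \<in> ?J \<times> ?J" "p = \<psi> z" by (auto simp: U_def)
    then have "fst z \<in> ?J" "snd z \<in> ?J" by auto
    from in_box[OF V_in[OF this(2)] T_in(2)[OF this(1)]] have "p \<in> R" by (simp only: z(2) \<psi>_def)
    then show "p \<in> \<Omega>" using box by blast
  qed
  have "\<psi> (0, 0) = x"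
    using start[OF V_in[of 0]] x' by (simp add: \<psi>_def T_def V_def)
  then have xU: "x \<in> U" unfolding U_def by (force intro!: image_eqI[of x \<psi> "(0, 0)"])
  have plaque: "(t, Y (V c) t) \<in> L" if L: "L \<in> leaves (X1_field u) \<Omega>" "\<psi> (a, c) \<in> L" "a \<in> ?J" "c \<in> ?J"
    "t \<in> {t0-\<tau><..<t0+\<tau>}" for L a c t
    using leaf_absorbs[OF lip L(1) flow_line_integral_curve[OF V_in[OF L(4)]] T_in(1)[OF L(3)]] L(2,5) by (auto simp: \<psi>_def)
  have "\<exists>c\<in>?J. \<phi> ` K = ?J \<times> {c}" if L: "L \<in> leaves (X1_field u) \<Omega>" and K: "K \<in> components (L \<inter> U)" for L K
  proof -
    have "K \<noteq> {}" "K \<subseteq> L \<inter> U" using K in_components_nonempty in_components_subset by blast+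
    then obtain a c where ac: "\<psi> (a, c) \<in> L" "a \<in> ?J" "c \<in> ?J" unfolding U_def by blast
    have LU: "L \<inter> U = \<psi> ` (?J \<times> {c})"
    proof
      show "\<psi> ` (?J \<times> {c}) \<subseteq> L \<inter> U"
        using plaque[OF L ac T_in(1)] ac(3) by (auto simp: U_def \<psi>_def)
      show "L \<inter> U \<subseteq> \<psi> ` (?J \<times> {c})"
      proof
        fix p assume p: "p \<in> L \<inter> U"
        then obtain a' c' where ac': "p = \<psi> (a', c')" "a' \<in> ?J" "c' \<in> ?J" unfolding U_def by blast
        then have p': "\<psi> (a', c') \<in> L" using p by simp
        have t0: "t0 \<in> {t0-\<tau><..<t0+\<tau>}" using pos by simp
        have "(t0, Y (V c) t0) = (t0, Y (V c') t0)"
          by (rule leaf_graph[OF L plaque[OF L ac t0] plaque[OF L p' ac'(2,3) t0]]) simp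
        then have "V c = V c'" using start[OF V_in[OF ac(3)]] start[OF V_in[OF ac'(3)]] by simp
        then have "c = c'" using pos by (simp add: V_def)
        then show "p \<in> \<psi> ` (?J \<times> {c})" using ac' by auto
      qed
    qed
    have "connected (\<psi> ` (?J \<times> {c}))"
      by (intro connected_continuous_image continuous_on_subset[OF \<psi>c] connected_Times) (use ac in auto)
    then have "components (L \<inter> U) = {L \<inter> U}"
      using ac LU by (subst components_eq_sing_iff) (auto simp: image_iff)
    then have "K = \<psi> ` (?J \<times> {c})" using K LU by simp
    then have "\<phi> ` K = (\<lambda>z. \<phi> (\<psi> z)) ` (?J \<times> {c})" by (simp add: image_image)
    also have "\<dots> = (\<lambda>z. z) ` (?J \<times> {c})" using ac(3) by (intro image_cong refl \<phi>\<psi>) auto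
    finally have "\<phi> ` K = ?J \<times> {c}" by simp
    then show ?thesis using ac(3) by blast
  qed
  then show ?thesis using U_open xU U_sub hom by blast
qed

theorem leaves_foliation:
  assumes "open \<Omega>" "C-lipschitz_on \<Omega> u"
  shows "foliation \<Omega> (leaves (X1_field u) \<Omega>)"
  unfolding foliation_def
proof (intro conjI ballI)
  show "partition_on \<Omega> (leaves (X1_field u) \<Omega>)" by (rule leaves_partition[OF assms])
qed (rule leaf_connected, assumption, rule foliation_chart[OF assms], assumption)

section \<open>The leaves of a vanishing viscosity solution\<close>

lemma vanishing_viscosity_approximation:
  assumes "open \<Omega>" "vanishing_viscosity_solution \<Omega> u"
  obtains \<epsilon> v C where "viscous_approximation \<Omega> u \<epsilon> v C"
proof -
  obtain C1 where C1: "C1-lipschitz_on \<Omega> u"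
    using assms(2) unfolding vanishing_viscosity_solution_def by blast
  obtain \<epsilon> :: "nat \<Rightarrow> real" and v C2 where v: "\<forall>j. \<epsilon> j > 0" "\<epsilon> \<longlonglongrightarrow> 0" "\<forall>j. smooth_on_plane \<Omega> (v j)"
    "\<forall>j. regularized_minimal_graph \<Omega> (\<epsilon> j) (v j)" "\<forall>j. C2-lipschitz_on \<Omega> (v j)"
    "\<forall>K. compact K \<and> K \<subseteq> \<Omega> \<longrightarrow> uniform_limit K v u sequentially"
    using assms(2) unfolding vanishing_viscosity_solution_def
    by (elim conjE exE) (rule that, assumption+)
  have "viscous_approximation \<Omega> u \<epsilon> v (max C1 C2)"
  proof
    show "(max C1 C2)-lipschitz_on \<Omega> u" using C1 by (rule lipschitz_on_le) simp
    show "(max C1 C2)-lipschitz_on \<Omega> (v j)" for j by (rule lipschitz_on_le[OF v(5)[rule_format]]) simp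
    show "uniform_limit K v u sequentially" if "compact K" "K \<subseteq> \<Omega>" for K
      using v(6) that by blast
    show "open \<Omega>" "\<epsilon> \<longlonglongrightarrow> 0" by fact+
    show "0 < \<epsilon> j" "smooth_on_plane \<Omega> (v j)" "regularized_minimal_graph \<Omega> (\<epsilon> j) (v j)" for j
      using v(1,3,4) by blast+
  qed
  then show thesis by (rule that)
qed

context viscous_approximation
begin

text \<open>
  Near any of its points, an integral curve is a translate of a line of a flow box.
\<close>

lemma locally_affine_along_curve:
  assumes \<gamma>: "leaf_curve u \<Omega> \<gamma> I" and t1: "t1 \<in> I"
  shows "\<exists>q. \<exists>e>0. \<forall>t. \<bar>t - t1\<bar> < e \<longrightarrow> t \<in> I \<and> u (\<gamma> t) = u (\<gamma> t1) + q * (t - t1)"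
proof -
  obtain t0 y0 where x: "\<gamma> t1 = (t0, y0)" by fastforce
  have x0: "(t0, y0) \<in> \<Omega>" using integral_curve_in[OF \<gamma> t1] x by simp
  obtain \<tau> \<sigma> \<rho> Y where fb: "flow_box \<Omega> u t0 y0 \<tau> \<sigma> \<rho> Y"
    by (rule flow_box_exists[OF open_domain lip_u x0])
  then interpret B: flow_box \<Omega> u t0 y0 \<tau> \<sigma> \<rho> Y .
  note pos = B.pos and start = B.start and y0 = B.centre_in(1) and \<sigma> = B.flow_line_integral_curve[OF B.centre_in(1)]
  define c where "c = t0 - t1"
  have \<sigma>': "leaf_curve u \<Omega> (\<lambda>t. (t + c, Y y0 (t + c))) {t. t + c \<in> {t0-\<tau><..<t0+\<tau>}}"
    by (rule integral_curve_translate[OF \<sigma>])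
  obtain e1 where e1: "e1 > 0" "\<And>t. dist t t1 < e1 \<Longrightarrow> t \<in> I"
    using integral_curve_open[OF \<gamma>] t1 unfolding open_dist by blast
  define H where "H t = u (t, Y y0 t)" for t
  define q where "q = (H (t0 + \<tau>) - H t0) / \<tau>"
  have aff: "H t = H t0 + q * (t - t0)" if "t \<in> {t0-\<tau>..t0+\<tau>}" for t
  proof -
    have ends: "t0 \<in> {t0-\<tau>..t0+\<tau>}" "t0 + \<tau> \<in> {t0-\<tau>..t0+\<tau>}" using pos by auto
    have "(H t - H t0) * (t0 + \<tau> - t0) = (H (t0 + \<tau>) - H t0) * (t - t0)"
      unfolding H_def by (rule flow_line_collinear[OF fb ends(1) that ends(2)])
    then show ?thesis using pos by (simp add: q_def field_simps)
  qed
  have "t \<in> I \<and> u (\<gamma> t) = u (\<gamma> t1) + q * (t - t1)" if t: "\<bar>t - t1\<bar> < min e1 \<tau>" for t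
  proof -
    have tI: "t \<in> I" using e1(2)[of t] t by (simp add: dist_real_def)
    have tc: "t + c \<in> {t0-\<tau><..<t0+\<tau>}" "t1 + c \<in> {t0-\<tau><..<t0+\<tau>}" using t pos by (auto simp: c_def)
    have "\<gamma> t1 = (t1 + c, Y y0 (t1 + c))" using x start[OF y0] by (simp add: c_def)
    then have "\<gamma> t = (t + c, Y y0 (t + c))"
      using tc by (intro integral_curve_unique[OF lip_u \<gamma> \<sigma>' t1 _ _ tI]) simp_all
    then have "u (\<gamma> t) = H (t + c)" by (simp add: H_def)
    also have "\<dots> = H t0 + q * (t + c - t0)" using tc by (intro aff) auto
    also have "H t0 = u (\<gamma> t1)" using x start[OF y0] by (simp add: H_def)
    finally show ?thesis using tI by (simp add: c_def)
  qed
  moreover have "min e1 \<tau> > 0" using e1(1) pos by simp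
  ultimately show ?thesis by blast
qed

text \<open>
  The derivative of \<open>u \<circ> \<gamma>\<close> is locally constant, and its domain is an interval.
\<close>

theorem affine_along_curve:
  assumes \<gamma>: "leaf_curve u \<Omega> \<gamma> I"
  shows "\<exists>k m. \<forall>t\<in>I. u (\<gamma> t) = m + k * t"
proof -
  define h where "h t = u (\<gamma> t)" for t
  have local: "\<exists>q. \<exists>e>0. (\<forall>t. \<bar>t - t1\<bar> < e \<longrightarrow> t \<in> I \<and> (h has_real_derivative q) (at t))" if t1: "t1 \<in> I" for t1
  proof -
    obtain q e where e: "e > 0" and q: "\<forall>t. \<bar>t - t1\<bar> < e \<longrightarrow> t \<in> I \<and> u (\<gamma> t) = u (\<gamma> t1) + q * (t - t1)"
      using locally_affine_along_curve[OF \<gamma> t1] by blast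
    have "(h has_real_derivative q) (at t)" if t: "\<bar>t - t1\<bar> < e" for t
    proof -
      have "((\<lambda>t. h t1 + q * (t - t1)) has_real_derivative q) (at t)"
        by (auto intro!: derivative_eq_intros)
      moreover have "t \<in> ball t1 e" using t by (simp add: dist_real_def abs_minus_commute)
      moreover have "h t1 + q * (s - t1) = h s" if "s \<in> ball t1 e" for s
        using q[rule_format, of s] that by (simp add: h_def dist_real_def abs_minus_commute)
      ultimately show ?thesis
        using has_field_derivative_transform_within_open[OF _ open_ball] by blast
    qed
    then show ?thesis using e q by blast
  qed
  have dh: "(h has_real_derivative deriv h t) (at t)" if t: "t \<in> I" for t
  proof -
    obtain q e where "e > 0" "\<forall>s. \<bar>s - t\<bar> < e \<longrightarrow> s \<in> I \<and> (h has_real_derivative q) (at s)"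
      using local[OF t] by blast
    then have "(h has_real_derivative q) (at t)" by simp
    then show ?thesis using DERIV_imp_deriv by blast
  qed
  have "(deriv h has_real_derivative 0) (at t within I)" if t: "t \<in> I" for t
  proof -
    obtain q e where e: "e > 0" and q: "\<forall>s. \<bar>s - t\<bar> < e \<longrightarrow> s \<in> I \<and> (h has_real_derivative q) (at s)"
      using local[OF t] by blast
    have "deriv h s = q" if "s \<in> ball t e" for s
      using q[rule_format, of s] that by (intro DERIV_imp_deriv) (simp add: dist_real_def abs_minus_commute)
    then have "(deriv h has_real_derivative 0) (at t)"
      by (intro has_field_derivative_transform_within_open[OF DERIV_const open_ball, of t t e q]) (use e in auto)
    then show ?thesis by (rule has_field_derivative_at_within)
  qed
  then have "\<exists>k. \<forall>t\<in>I. deriv h t = k"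
    by (rule has_field_derivative_zero_constant[OF integral_curve_convex(1)[OF \<gamma>]])
  then obtain k where k: "\<And>t. t \<in> I \<Longrightarrow> deriv h t = k" by blast
  have "((\<lambda>t. h t - k * t) has_real_derivative 0) (at t within I)" if "t \<in> I" for t
  proof -
    have "((\<lambda>t. h t - k * t) has_real_derivative deriv h t - k) (at t)"
      by (intro DERIV_diff dh that) (auto intro!: derivative_eq_intros)
    then show ?thesis using k[OF that] by (auto intro: has_field_derivative_at_within)
  qed
  then have "\<exists>m. \<forall>t\<in>I. h t - k * t = m"
    by (rule has_field_derivative_zero_constant[OF integral_curve_convex(1)[OF \<gamma>]])
  then obtain m where m: "\<And>t. t \<in> I \<Longrightarrow> h t - k * t = m" by blast
  show ?thesis
  proof (intro exI ballI)
    fix t assume "t \<in> I"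
    from m[OF this] show "u (\<gamma> t) = m + k * t" by (simp add: h_def)
  qed
qed

lemma curve_polynomial:
  assumes \<gamma>: "leaf_curve u \<Omega> \<gamma> I"
  shows "polynomial_curve_deg_le 2 \<gamma> I"
proof -
  obtain k m where km: "\<And>t. t \<in> I \<Longrightarrow> u (\<gamma> t) = m + k * t"
    using affine_along_curve[OF \<gamma>] by blast
  obtain t1 where t1: "t1 \<in> I" using \<gamma> by (auto simp: integral_curve_def)
  define s where "s = fst (\<gamma> t1) - t1"
  have fst: "fst (\<gamma> t) = t + s" if "t \<in> I" for t
    using integral_curve_first_coordinate[OF \<gamma> t1 that] by (simp add: s_def)
  have "((\<lambda>t. snd (\<gamma> t) - (m * t + k * t\<^sup>2 / 2)) has_real_derivative 0) (at t within I)" if "t \<in> I" for t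
  proof -
    have "((\<lambda>t. m * t + k * t\<^sup>2 / 2) has_real_derivative m + k * t) (at t)"
      by (auto intro!: derivative_eq_intros)
    from DERIV_diff[OF integral_curve_components(2)[OF \<gamma> that] this] km[OF that]
    have "((\<lambda>t. snd (\<gamma> t) - (m * t + k * t\<^sup>2 / 2)) has_real_derivative 0) (at t)" by simp
    then show ?thesis by (rule has_field_derivative_at_within)
  qed
  then have "\<exists>n. \<forall>t\<in>I. snd (\<gamma> t) - (m * t + k * t\<^sup>2 / 2) = n"
    by (rule has_field_derivative_zero_constant[OF integral_curve_convex(1)[OF \<gamma>]])
  then obtain n where n: "\<And>t. t \<in> I \<Longrightarrow> snd (\<gamma> t) - (m * t + k * t\<^sup>2 / 2) = n" by blast
  let ?p = "[:n - m * s + k * s\<^sup>2 / 2, m - k * s, k / 2:]"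
  have "degree ?p \<le> 2" by (simp add: degree_pCons_le[THEN order_trans] degree_pCons_eq_if)
  moreover have "\<gamma> t = (t + s, poly ?p (t + s))" if "t \<in> I" for t
  proof -
    have "poly ?p (t + s) = n + (m * t + k * t\<^sup>2 / 2)"
      by (simp add: field_simps power2_eq_square)
    then have "snd (\<gamma> t) = poly ?p (t + s)" using n[OF that] by linarith
    then show ?thesis using fst[OF that] by (simp add: prod_eq_iff)
  qed
  ultimately show ?thesis unfolding polynomial_curve_deg_le_def by blast
qed

lemma curve_second_derivative:
  assumes \<gamma>: "leaf_curve u \<Omega> \<gamma> I" and t: "t \<in> I"
  shows "((\<lambda>s. u (\<gamma> s)) has_real_derivative deriv (\<lambda>s. u (\<gamma> s)) t) (at t)"
    and "(deriv (\<lambda>s. u (\<gamma> s)) has_real_derivative 0) (at t)"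
proof -
  obtain k m where km: "\<And>t. t \<in> I \<Longrightarrow> u (\<gamma> t) = m + k * t"
    using affine_along_curve[OF \<gamma>] by blast
  have d: "((\<lambda>s. u (\<gamma> s)) has_real_derivative k) (at t)" if "t \<in> I" for t
  proof -
    have "((\<lambda>t. m + k * t) has_real_derivative k) (at t)" by (auto intro!: derivative_eq_intros)
    then show ?thesis
      by (rule has_field_derivative_transform_within_open[OF _ integral_curve_open[OF \<gamma>] that]) (simp add: km)
  qed
  have dk: "deriv (\<lambda>s. u (\<gamma> s)) t = k" if "t \<in> I" for t by (rule DERIV_imp_deriv[OF d[OF that]])
  show "((\<lambda>s. u (\<gamma> s)) has_real_derivative deriv (\<lambda>s. u (\<gamma> s)) t) (at t)"
    using d[OF t] dk[OF t] by simp
  show "(deriv (\<lambda>s. u (\<gamma> s)) has_real_derivative 0) (at t)"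
    by (rule has_field_derivative_transform_within_open[OF DERIV_const integral_curve_open[OF \<gamma>] t]) (simp add: dk)
qed

end

lemma has_lie_derivative_along:
  assumes \<gamma>: "integral_curve X \<Omega> \<gamma> I" "t \<in> I" and d: "((\<lambda>s. f (\<gamma> s)) has_real_derivative D) (at t)"
  shows "has_lie_derivative X \<Omega> f (\<gamma> t) D"
  unfolding has_lie_derivative_def
proof (intro exI conjI)
  show "integral_curve X \<Omega> (\<lambda>s. \<gamma> (s + t)) {s. s + t \<in> I}" by (rule integral_curve_translate[OF \<gamma>(1)])
  show "0 \<in> {s. s + t \<in> I}" "\<gamma> (0 + t) = \<gamma> t" using \<gamma>(2) by simp_all
  show "((\<lambda>h. f (\<gamma> (h + t))) has_real_derivative D) (at 0)"
    using d DERIV_shift[of "\<lambda>s. f (\<gamma> s)" D 0 t] by simp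
qed

text \<open>
  Integral curves through the same point agree near it, so the Lie derivative does not depend on the curve.
\<close>

lemma has_lie_derivative_unique:
  assumes lip: "C-lipschitz_on \<Omega> u"
    and "has_lie_derivative (X1_field u) \<Omega> f x D" "has_lie_derivative (X1_field u) \<Omega> f x D'"
  shows "D = D'"
proof -
  obtain \<gamma> I \<sigma> J where c: "leaf_curve u \<Omega> \<gamma> I" "0 \<in> I" "\<gamma> 0 = x"
    "((\<lambda>h. f (\<gamma> h)) has_real_derivative D) (at 0)"
    "leaf_curve u \<Omega> \<sigma> J" "0 \<in> J" "\<sigma> 0 = x" "((\<lambda>h. f (\<sigma> h)) has_real_derivative D') (at 0)"
    using assms(2,3) unfolding has_lie_derivative_def by blast
  have eq: "\<gamma> h = \<sigma> h" if "h \<in> I \<inter> J" for h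
    using integral_curve_unique[OF lip c(1,5,2,6)] c(3,7) that by simp
  have op: "open (I \<inter> J)" by (intro open_Int integral_curve_open[OF c(1)] integral_curve_open[OF c(5)])
  have "((\<lambda>h. f (\<sigma> h)) has_real_derivative D) (at 0)"
    by (rule has_field_derivative_transform_within_open[OF c(4) op]) (use c(2,6) eq in auto)
  then show ?thesis using c(8) DERIV_unique by blast
qed

theorem corollary1p6:
  fixes \<Omega> :: "(real \<times> real) set" and u :: "real \<times> real \<Rightarrow> real"
  assumes "open \<Omega>"
    and "vanishing_viscosity_solution \<Omega> u"
  shows "foliation \<Omega> (leaves (X1_field u) \<Omega>) \<and>
         (\<forall>\<gamma> I. maximal_integral_curve (X1_field u) \<Omega> \<gamma> I \<longrightarrow> polynomial_curve_deg_le 2 \<gamma> I) \<and>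
         (\<forall>x0\<in>\<Omega>.
           (\<exists>!L. L \<in> leaves (X1_field u) \<Omega> \<and> x0 \<in> L) \<and>
           (\<exists>D. has_lie_derivative (X1_field u) \<Omega> u x0 D) \<and>
           has_lie_derivative (X1_field u) \<Omega>
             (\<lambda>y. lie_deriv (X1_field u) \<Omega> u y
                   / sqrt (1 + \<bar>lie_deriv (X1_field u) \<Omega> u y\<bar>\<^sup>2)) x0 0 \<and>
           (\<forall>\<gamma> I. maximal_integral_curve (X1_field u) \<Omega> \<gamma> I \<and> x0 \<in> \<gamma> ` I \<longrightarrow>
              (\<forall>t\<in>I. ((\<lambda>s. u (\<gamma> s)) has_real_derivative deriv (\<lambda>s. u (\<gamma> s)) t) (at t) \<and>
                     (deriv (\<lambda>s. u (\<gamma> s)) has_real_derivative 0) (at t))))"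
proof -
  obtain \<epsilon> v C where "viscous_approximation \<Omega> u \<epsilon> v C"
    using vanishing_viscosity_approximation[OF assms] .
  then interpret viscous_approximation \<Omega> u \<epsilon> v C .
  let ?X = "X1_field u"
  note part = leaves_partition[OF open_domain lip_u]
  have leaf: "\<exists>!L. L \<in> leaves ?X \<Omega> \<and> x0 \<in> L" if x0: "x0 \<in> \<Omega>" for x0
  proof -
    obtain L where L: "L \<in> leaves ?X \<Omega>" "x0 \<in> L"
      using partition_onD1[OF part] x0 by blast
    moreover have "M = L" if "M \<in> leaves ?X \<Omega> \<and> x0 \<in> M" for M
      using disjointD[OF partition_onD2[OF part], of M L] that L by blast
    ultimately show ?thesis by blast
  qed
  have lie: "\<exists>D. has_lie_derivative ?X \<Omega> u x0 D \<and>
      has_lie_derivative ?X \<Omega> (\<lambda>y. lie_deriv ?X \<Omega> u y / sqrt (1 + \<bar>lie_deriv ?X \<Omega> u y\<bar>\<^sup>2)) x0 0"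
    if x0: "x0 \<in> \<Omega>" for x0
  proof -
    obtain \<gamma> I where m: "maximal_integral_curve ?X \<Omega> \<gamma> I" and 0: "0 \<in> I" "\<gamma> 0 = x0"
      using integral_curve_exists[OF open_domain lip_u x0] by blast
    note \<gamma> = maximal_imp_integral_curve[OF m]
    obtain k m where km: "\<And>t. t \<in> I \<Longrightarrow> u (\<gamma> t) = m + k * t"
      using affine_along_curve[OF \<gamma>] by blast
    have D: "has_lie_derivative ?X \<Omega> u (\<gamma> t) k" if t: "t \<in> I" for t
    proof (rule has_lie_derivative_along[OF \<gamma> t])
      have "((\<lambda>t. m + k * t) has_real_derivative k) (at t)" by (auto intro!: derivative_eq_intros)
      then show "((\<lambda>s. u (\<gamma> s)) has_real_derivative k) (at t)"
        by (rule has_field_derivative_transform_within_open[OF _ integral_curve_open[OF \<gamma>] t]) (simp add: km)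
    qed
    have lie_k: "lie_deriv ?X \<Omega> u (\<gamma> t) = k" if "t \<in> I" for t
      unfolding lie_deriv_def using D[OF that] has_lie_derivative_unique[OF lip_u _ D[OF that]]
      by (rule the_equality)
    let ?F = "\<lambda>y. lie_deriv ?X \<Omega> u y / sqrt (1 + \<bar>lie_deriv ?X \<Omega> u y\<bar>\<^sup>2)"
    have "((\<lambda>s. ?F (\<gamma> s)) has_real_derivative 0) (at 0)"
      by (rule has_field_derivative_transform_within_open[OF DERIV_const[of "k / sqrt (1 + \<bar>k\<bar>\<^sup>2)"] integral_curve_open[OF \<gamma>] 0(1)])
        (simp add: lie_k)
    from has_lie_derivative_along[OF \<gamma> 0(1), of ?F, OF this] D[OF 0(1)] show ?thesis
      unfolding 0(2) by blast
  qed
  show ?thesis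
  proof (intro conjI allI ballI impI)
    show "foliation \<Omega> (leaves ?X \<Omega>)" by (rule leaves_foliation[OF open_domain lip_u])
    show "polynomial_curve_deg_le 2 \<gamma> I" if "maximal_integral_curve ?X \<Omega> \<gamma> I" for \<gamma> I
      by (rule curve_polynomial[OF maximal_imp_integral_curve[OF that]])
    fix x0 assume x0: "x0 \<in> \<Omega>"
    show "\<exists>!L. L \<in> leaves ?X \<Omega> \<and> x0 \<in> L" by (rule leaf[OF x0])
    show "\<exists>D. has_lie_derivative ?X \<Omega> u x0 D"
      "has_lie_derivative ?X \<Omega> (\<lambda>y. lie_deriv ?X \<Omega> u y / sqrt (1 + \<bar>lie_deriv ?X \<Omega> u y\<bar>\<^sup>2)) x0 0"
      using lie[OF x0] by blast+
    fix \<gamma> I t assume "maximal_integral_curve ?X \<Omega> \<gamma> I \<and> x0 \<in> \<gamma> ` I" and t: "t \<in> I"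
    then have \<gamma>: "integral_curve ?X \<Omega> \<gamma> I" using maximal_imp_integral_curve by blast
    show "((\<lambda>s. u (\<gamma> s)) has_real_derivative deriv (\<lambda>s. u (\<gamma> s)) t) (at t)"
      "(deriv (\<lambda>s. u (\<gamma> s)) has_real_derivative 0) (at t)"
      by (rule curve_second_derivative[OF \<gamma> t])+
  qed
qed

end
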